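(* Let $\nu_1,\nu_2>0$. Then the limit $$\lim_{\kappa\to\infty}\Big(J^{B_2}_{(\kappa\nu_1,\kappa\nu_2)}(x,\kappa y)\Big)^{1/\kappa}$$ exists locally uniformly for $x,y\in C_2^B$, and for $j=1,2$ the limit $$\lim_{\kappa\to\infty}\frac{\partial_{x_j}J^{B_2}_{(\kappa\nu_1,\kappa\nu_2)}(x,\kappa y)}{\kappa\cdot J^{B_2}_{(\kappa\nu_1,\kappa\nu_2)}(x,\kappa y)}$$ exists locally uniformly for $x,y$ in the interior of $C_2^B$.
   Context: $C_2^B:=\{x\in\mathbb{R}^2: x_1\ge x_2\ge 0\}$. The root system of type $B_2$ is $\{\pm e_1,\pm e_2\}\cup\{\pm e_1\pm e_2\}$, with multiplicity $k=(k_1,k_2)$, $k_1,k_2\ge0$, where $k_1$ belongs to $\pm e_i$ and $k_2$ to $\pm e_1\pm e_2$. Let $R_+=\{e_1,e_2,e_1+e_2,e_1-e_2\}$, $\sigma_\alpha$ the reflection in the line orthogonal to $\alpha$, and $W$ the generated reflection group (of order $8$). The Dunkl operators are $T_\xi f(x)=\partial_\xi f(x)+\sum_{\alpha\in R_+}k(\alpha)\langle\alpha,\xi\rangle\frac{f(x)-f(\sigma_\alpha x)}{\langle\alpha,x\rangle}$, $\xi\in\mathbb{R}^2$; the Dunkl kernel $E_k(\cdot,y)$ is the unique analytic solution of $T_\xi f=\langle\xi,y\rangle f$ for all $\xi\in\mathbb{R}^2$, $f(0)=1$; and $J^{B_2}_k(x,y)=\frac18\sum_{g\in W}E_k(x,gy)$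 is the Bessel function of type $B_2$. Here $\kappa$ tends to infinity through positive reals. *)

theory Defs
  imports "HOL-Analysis.Analysis"
begin

abbreviation e1 :: "real^2" where "e1 \<equiv> axis 1 1"
abbreviation e2 :: "real^2" where "e2 \<equiv> axis 2 1"

definition short_roots :: "(real^2) set" where
  "short_roots = {e1, - e1, e2, - e2}"

definition long_roots :: "(real^2) set" where
  "long_roots = {e1 + e2, - e1 - e2, e1 - e2, e2 - e1}"

definition pos_roots :: "(real^2) set" where
  "pos_roots = {e1, e2, e1 + e2, e1 - e2}"

definition root_mult :: "real \<times> real \<Rightarrow> real^2 \<Rightarrow> real" where
  "root_mult k \<alpha> = (if \<alpha> \<in> short_roots then fst k else if \<alpha> \<in> long_roots then snd k else 0)"

definition refl_along :: "real^2 \<Rightarrow> real^2 \<Rightarrow> real^2" where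
  "refl_along \<alpha> x = x - (2 * (\<alpha> \<bullet> x) / (\<alpha> \<bullet> \<alpha>)) *\<^sub>R \<alpha>"

text \<open>Reflections are involutions, so closing under composition with them already gives a group.\<close>

inductive_set weyl_group :: "(real^2 \<Rightarrow> real^2) set" where
  weyl_id: "id \<in> weyl_group"
| weyl_refl: "g \<in> weyl_group \<Longrightarrow> \<alpha> \<in> pos_roots \<Longrightarrow> refl_along \<alpha> \<circ> g \<in> weyl_group"

definition chamber :: "(real^2) set" where
  "chamber = {x. x $ 1 \<ge> x $ 2 \<and> x $ 2 \<ge> 0}"

definition dir_deriv :: "real^2 \<Rightarrow> (real^2 \<Rightarrow> real) \<Rightarrow> real^2 \<Rightarrow> real" where
  "dir_deriv \<xi> f x = frechet_derivative f (at x) \<xi>"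

text \<open>On the line orthogonal to \<open>\<alpha>\<close> the quotient is understood by continuous extension.\<close>

definition diff_quot :: "real^2 \<Rightarrow> (real^2 \<Rightarrow> real) \<Rightarrow> real^2 \<Rightarrow> real" where
  "diff_quot \<alpha> f x =
    (if \<alpha> \<bullet> x \<noteq> 0 then (f x - f (refl_along \<alpha> x)) / (\<alpha> \<bullet> x)
     else Lim (at x within {z. \<alpha> \<bullet> z \<noteq> 0}) (\<lambda>z. (f z - f (refl_along \<alpha> z)) / (\<alpha> \<bullet> z)))"

definition dunkl_op :: "real \<times> real \<Rightarrow> real^2 \<Rightarrow> (real^2 \<Rightarrow> real) \<Rightarrow> real^2 \<Rightarrow> real" where
  "dunkl_op k \<xi> f x =
    dir_deriv \<xi> f x + (\<Sum>\<alpha>\<in>pos_roots. root_mult k \<alpha> * (\<alpha> \<bullet> \<xi>) * diff_quot \<alpha> f x)"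

definition real_analytic :: "(real^2 \<Rightarrow> real) \<Rightarrow> bool" where
  "real_analytic f \<longleftrightarrow>
    (\<forall>a. \<exists>r>0. \<exists>c :: nat \<times> nat \<Rightarrow> real. \<forall>x\<in>ball a r.
      ((\<lambda>(m, n). c (m, n) * (x $ 1 - a $ 1) ^ m * (x $ 2 - a $ 2) ^ n) has_sum f x) UNIV)"

definition is_dunkl_kernel :: "real \<times> real \<Rightarrow> real^2 \<Rightarrow> (real^2 \<Rightarrow> real) \<Rightarrow> bool" where
  "is_dunkl_kernel k y f \<longleftrightarrow>
    real_analytic f \<and> (\<forall>\<xi> x. dunkl_op k \<xi> f x = (\<xi> \<bullet> y) * f x) \<and> f 0 = 1"

definition dunkl_kernel :: "real \<times> real \<Rightarrow> real^2 \<Rightarrow> real^2 \<Rightarrow> real" where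
  "dunkl_kernel k x y = (THE f. is_dunkl_kernel k y f) x"

definition bessel_B2 :: "real \<times> real \<Rightarrow> real^2 \<Rightarrow> real^2 \<Rightarrow> real" where
  "bessel_B2 k x y = 1 / 8 * (\<Sum>g\<in>weyl_group. dunkl_kernel k x (g y))"

definition locally_uniform_limit ::
  "'a::topological_space set \<Rightarrow> ('i \<Rightarrow> 'a \<Rightarrow> 'b::metric_space) \<Rightarrow> ('a \<Rightarrow> 'b) \<Rightarrow> 'i filter \<Rightarrow> bool" where
  "locally_uniform_limit S f l F \<longleftrightarrow>
    (\<forall>p\<in>S. \<exists>U. open U \<and> p \<in> U \<and> uniform_limit (S \<inter> U) f l F)"

end

theory Submission
  imports Defs
begin

text \<open>Write \<open>E\<close> for the Dunkl kernel and consider its values \<open>\<Psi>\<^sub>w(t) = E(t x, \<kappa> w y)\<close>, with \<open>w\<close> in the Weyl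
group, along the ray through \<open>x\<close>. Taking the direction \<open>\<xi> = x\<close> in the Dunkl equation cancels every
denominator \<open>\<langle>\<alpha>, x\<rangle>\<close>, and \<open>E(\<sigma> x, y) = E(x, \<sigma> y)\<close> turns values at reflected points into other
components. The result is a linear system \<open>t \<Psi>' = \<kappa> (t D - K) \<Psi>\<close>, \<open>\<Psi>(0) = (1, \<dots>, 1)\<close>, where \<open>D\<close> is
diagonal with entries \<open>\<langle>x, w y\<rangle>\<close> and \<open>K\<close> is the weighted Laplacian
\<open>(K v)\<^sub>w = \<Sum>\<^sub>\<alpha> \<nu>\<^sub>\<alpha> (v\<^sub>w - v\<^bsub>\<sigma>\<^sub>\<alpha> w\<^esub>)\<close> on the group. The matrices \<open>t D - K\<close> do not depend on \<open>\<kappa>\<close>, are symmetric, have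
nonnegative off-diagonal entries and are irreducible because both \<open>\<nu>\<^sub>i\<close> are positive. So the largest
eigenvalue is simple, with a positive eigenvector, and the spectral gap is bounded below while \<open>x\<close> and
\<open>y\<close> stay bounded (\<open>spectral_gap_compact\<close>).

The large factor \<open>\<kappa>\<close> makes the system follow this Perron vector. The defect of the Rayleigh quotient of
\<open>\<Psi>\<close> from the largest eigenvalue vanishes at \<open>t = 0\<close>, since constants span the kernel of \<open>K\<close>, and once it
reaches a small level \<open>\<epsilon>\<close> the growth of the quotient, of order \<open>\<kappa> \<epsilon>\<close>, beats the drift of the matrices.
Hence it stays below \<open>\<epsilon>\<close> (\<open>rayleigh_defect_small\<close>), and all weighted means
\<open>(\<Sum>\<^sub>w l\<^sub>w \<Psi>\<^sub>w) / (\<Sum>\<^sub>w \<Psi>\<^sub>w)\<close> converge uniformly (\<open>radial_asymptotics\<close>).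

Both limits are read off from such means. In the sum of the Dunkl equations over the group the
difference terms cancel, so \<open>\<partial>\<^sub>\<xi> J / (\<kappa> J)\<close> is the mean with \<open>l\<^sub>w = \<langle>\<xi>, w y\<rangle>\<close>. For \<open>\<xi> = x\<close> this is the
derivative of \<open>(ln J) / \<kappa>\<close> along the ray, and integrating it from \<open>0\<close> to \<open>1\<close> shows that \<open>J\<close> to the power
\<open>1/\<kappa>\<close> is uniformly Cauchy (\<open>radial_growth_cauchy\<close>).

The Dunkl kernel is defined as the unique solution of the Dunkl equations, so existence and uniqueness
have to be established first. The radial equation determines the power series: on the monomials of
one degree it decouples into \<open>2 \<times> 2\<close> systems, which give an entire series. That the series satisfies the
equations in all directions is the commutativity of the Dunkl operators in disguise: the defects
\<open>T\<^sub>\<xi> E - \<langle>\<xi>, y\<rangle> E\<close> satisfy a radial system of the same kind with a damping term, whose only solution that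
is not too singular at \<open>0\<close> is zero (\<open>defect_ray\<close>, \<open>defect_zero\<close>). Uniqueness follows from the same energy
estimate for radial systems (\<open>radial_zero\<close>).\<close>

section \<open>Weighted Laplacians on a finite set of states and their Perron vectors\<close>

text \<open>The states form the type \<open>'n\<close>; each label in \<open>A\<close> pairs them by an involution and carries a rate. For
the application the states are the elements of the Weyl group and the labels are the positive roots,
acting by multiplication with their reflections.\<close>

locale reflection_system =
  fixes A :: "'a set" and nu :: "'a \<Rightarrow> real" and r :: "'a \<Rightarrow> 'n::finite \<Rightarrow> 'n"
  assumes finite_refl: "finite A"
    and nu_nonneg: "a \<in> A \<Longrightarrow> nu a \<ge> 0"
    and invol: "a \<in> A \<Longrightarrow> r a (r a i) = i"
begin

definition lap :: "real^'n \<Rightarrow> real^'n" where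
  "lap v = (\<chi> i. \<Sum>a\<in>A. nu a * (v $ i - v $ r a i))"

definition ham :: "real^'n \<Rightarrow> real^'n \<Rightarrow> real^'n" where
  "ham d v = (\<chi> i. d $ i * v $ i) - lap v"

lemma sum_refl: "a \<in> A \<Longrightarrow> (\<Sum>i\<in>UNIV. f (r a i)) = (\<Sum>i\<in>UNIV. f i :: real)"
  by (rule sum.reindex_bij_witness[of _ "r a" "r a"]) (auto simp: invol)

lemma lap_inner:
  "lap v \<bullet> w = (\<Sum>a\<in>A. nu a * (\<Sum>i\<in>UNIV. (v $ i - v $ r a i) * (w $ i - w $ r a i))) / 2"
proof -
  have "lap v \<bullet> w = (\<Sum>i\<in>UNIV. \<Sum>a\<in>A. nu a * ((v $ i - v $ r a i) * w $ i))"
    by (simp add: inner_vec_def lap_def sum_distrib_right mult.assoc)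
  also have "\<dots> = (\<Sum>a\<in>A. nu a * (\<Sum>i\<in>UNIV. (v $ i - v $ r a i) * w $ i))"
    by (subst sum.swap) (simp add: sum_distrib_left)
  also have "\<dots> = (\<Sum>a\<in>A. nu a * ((\<Sum>i\<in>UNIV. (v $ i - v $ r a i) * (w $ i - w $ r a i)) / 2))"
  proof (rule sum.cong[OF refl])
    fix a assume a: "a \<in> A"
    have "(\<Sum>i\<in>UNIV. (v $ r a i - v $ i) * w $ r a i) = (\<Sum>i\<in>UNIV. (v $ i - v $ r a i) * w $ i)"
      using sum_refl[OF a, of "\<lambda>i. (v $ i - v $ r a i) * w $ i"] by (simp add: invol[OF a])
    then have "(\<Sum>i\<in>UNIV. (v $ i - v $ r a i) * (w $ i - w $ r a i)) = 2 * (\<Sum>i\<in>UNIV. (v $ i - v $ r a i) * w $ i)"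
      by (simp add: right_diff_distrib sum_subtractf left_diff_distrib)
    then show "nu a * (\<Sum>i\<in>UNIV. (v $ i - v $ r a i) * w $ i) =
      nu a * ((\<Sum>i\<in>UNIV. (v $ i - v $ r a i) * (w $ i - w $ r a i)) / 2)" by simp
  qed
  also have "\<dots> = (\<Sum>a\<in>A. nu a * (\<Sum>i\<in>UNIV. (v $ i - v $ r a i) * (w $ i - w $ r a i))) / 2"
  proof -
    have "(\<Sum>a\<in>A. nu a * (X a / 2)) = (\<Sum>a\<in>A. nu a * X a) / 2" for X :: "'a \<Rightarrow> real"
      by (simp add: sum_divide_distrib)
    then show ?thesis .
  qed
  finally show ?thesis .
qed

lemma lap_sym: "lap v \<bullet> w = v \<bullet> lap w"
  unfolding inner_commute[of v] lap_inner by (simp add: mult.commute)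

lemma lap_nonneg: "lap v \<bullet> v \<ge> 0"
  unfolding lap_inner by (intro divide_nonneg_nonneg sum_nonneg mult_nonneg_nonneg nu_nonneg zero_le_square) auto

lemma linear_lap: "linear lap"
  by (rule linearI) (auto simp: lap_def vec_eq_iff sum.distrib[symmetric] sum_distrib_left algebra_simps intro!: sum.cong)

lemma lap_one: "lap (\<chi> i. 1) = 0"
  by (simp add: lap_def vec_eq_iff)

lemma linear_ham: "linear (ham d)"
proof -
  have "linear (\<lambda>v. \<chi> i. d $ i * v $ i)"
    by (rule linearI) (auto simp: vec_eq_iff algebra_simps)
  then show ?thesis unfolding ham_def using linear_lap by (intro linear_compose_sub)
qed

lemma ham_sym: "ham d v \<bullet> w = v \<bullet> ham d w"
  by (simp add: ham_def inner_diff_left inner_diff_right lap_sym) (simp add: inner_vec_def mult_ac)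

lemma ham_inner: "ham d v \<bullet> v = (\<Sum>i\<in>UNIV. d $ i * (v $ i)\<^sup>2) - lap v \<bullet> v"
  by (simp add: ham_def inner_diff_left) (simp add: inner_vec_def power2_eq_square mult_ac)

lemma diag_bound: "\<bar>\<Sum>i\<in>UNIV. d $ i * (v $ i)\<^sup>2\<bar> \<le> norm d * (norm (v::real^'n))\<^sup>2"
proof -
  have "\<bar>\<Sum>i\<in>UNIV. d $ i * (v $ i)\<^sup>2\<bar> \<le> (\<Sum>i\<in>UNIV. \<bar>d $ i * (v $ i)\<^sup>2\<bar>)"
    by (rule sum_abs)
  also have "\<dots> \<le> (\<Sum>i\<in>UNIV. norm d * (v $ i)\<^sup>2)"
    by (intro sum_mono) (simp add: abs_mult mult_right_mono component_le_norm_cart)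
  also have "\<dots> = norm d * (norm v)\<^sup>2"
    unfolding power2_norm_eq_inner by (simp add: sum_distrib_left[symmetric] inner_vec_def power2_eq_square)
  finally show ?thesis .
qed

lemma ham_diff_param: "ham d v \<bullet> v - ham d' v \<bullet> v = (\<Sum>i\<in>UNIV. (d - d') $ i * (v $ i)\<^sup>2)"
  by (simp add: ham_inner sum_subtractf[symmetric] left_diff_distrib)

lemma continuous_on_ham[continuous_intros]:
  assumes "continuous_on S f" "continuous_on S g"
  shows "continuous_on S (\<lambda>x. ham (f x) (g x))"
  unfolding ham_def lap_def using assms by (intro continuous_intros)

text \<open>The largest eigenvalue of the symmetric operator \<open>ham d\<close>, as maximum of its Rayleigh quotient.\<close>

definition mu :: "real^'n \<Rightarrow> real" where
  "mu d = (SUP v\<in>sphere 0 1. ham d v \<bullet> v)"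

lemma mu_attained: "\<exists>v. norm v = 1 \<and> ham d v \<bullet> v = mu d \<and> (\<forall>w. norm w = 1 \<longrightarrow> ham d w \<bullet> w \<le> mu d)"
proof -
  have c: "continuous_on (sphere 0 1) (\<lambda>v. ham d v \<bullet> v)"
    by (intro continuous_intros)
  obtain e :: "real^'n" where "norm e = 1" using vector_choose_size[of 1] by auto
  then have "sphere 0 1 \<noteq> ({} :: (real^'n) set)" by (auto simp: dist_norm)
  with continuous_attains_sup[OF compact_sphere _ c]
  obtain v where v: "v \<in> sphere 0 1" "\<forall>w\<in>sphere 0 1. ham d w \<bullet> w \<le> ham d v \<bullet> v" by auto
  then have "mu d = ham d v \<bullet> v" unfolding mu_def
    by (intro cSup_eq_maximum) auto
  with v show ?thesis by (auto intro!: exI[of _ v])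
qed

lemma mu_upper: "ham d v \<bullet> v \<le> mu d * (norm v)\<^sup>2"
proof (cases "v = 0")
  case True then show ?thesis by (simp add: linear_0[OF linear_ham])
next
  case False
  define w where "w = (1 / norm v) *\<^sub>R v"
  have "norm w = 1" using False by (simp add: w_def)
  then have "ham d w \<bullet> w \<le> mu d" using mu_attained[of d] by blast
  moreover have "v = norm v *\<^sub>R w" using False by (simp add: w_def)
  then have "ham d v \<bullet> v = (norm v)\<^sup>2 * (ham d w \<bullet> w)"
    by (metis (no_types, lifting) inner_scaleR_left inner_scaleR_right linear_ham linear_scale mult.assoc power2_eq_square)
  ultimately show ?thesis by (metis mult.commute mult_left_mono zero_le_power2)
qed

lemma mu_lipschitz: "mu d \<le> mu d' + norm (d - d')"
proof -
  obtain v where v: "norm v = 1" "ham d v \<bullet> v = mu d" using mu_attained[of d] by auto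
  have "ham d v \<bullet> v - ham d' v \<bullet> v \<le> norm (d - d')"
    using diag_bound[of "d - d'" v] v unfolding ham_diff_param by simp
  with mu_upper[of d' v] v show ?thesis by simp
qed

lemma continuous_on_mu: "continuous_on UNIV mu"
proof -
  have "dist (mu d) (mu d') \<le> 1 * dist d d'" for d d'
    using mu_lipschitz[of d d'] mu_lipschitz[of d' d] by (auto simp: dist_norm norm_minus_commute abs_le_iff)
  then have "1-lipschitz_on UNIV mu" by (intro lipschitz_onI) auto
  then show ?thesis by (rule lipschitz_on_continuous_on)
qed

text \<open>The form of \<open>mu d - ham d\<close> is positive semidefinite, and a null vector of such a form lies in the
kernel: otherwise a small step in the direction of its image would make the form negative.\<close>

lemma maximiser_eigenvector:
  assumes "ham d v \<bullet> v = mu d * (norm v)\<^sup>2"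
  shows "ham d v = mu d *\<^sub>R v"
proof -
  define B where "B w = mu d *\<^sub>R w - ham d w" for w
  have lin: "linear B" unfolding B_def using linear_ham by (intro linear_compose_sub) (auto intro: linearI simp: algebra_simps)
  have psd: "B w \<bullet> w \<ge> 0" for w
    using mu_upper[of d w] by (simp add: B_def inner_diff_left power2_norm_eq_inner)
  have sym: "B u \<bullet> w = u \<bullet> B w" for u w
    by (simp add: B_def inner_diff_left inner_diff_right ham_sym)
  have z: "B v \<bullet> v = 0" using assms by (simp add: B_def inner_diff_left power2_norm_eq_inner)
  have q: "0 \<le> 2 * s * (B v \<bullet> B v) + s\<^sup>2 * (B (B v) \<bullet> B v)" for s
  proof -
    have "0 \<le> B (v + s *\<^sub>R B v) \<bullet> (v + s *\<^sub>R B v)" by (rule psd)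
    also have "\<dots> = 2 * s * (B v \<bullet> B v) + s\<^sup>2 * (B (B v) \<bullet> B v)"
      using z sym[of "B v" v]
      by (simp add: linear_add[OF lin] linear_scale[OF lin] inner_add_left inner_add_right power2_eq_square algebra_simps)
    finally show ?thesis .
  qed
  have "B v \<bullet> B v = 0"
  proof (rule ccontr)
    assume "B v \<bullet> B v \<noteq> 0"
    then have p: "B v \<bullet> B v > 0" by simp
    define C where "C = B (B v) \<bullet> B v"
    have C: "C \<ge> 0" using psd by (simp add: C_def)
    define s where "s = - (B v \<bullet> B v) / (C + 1)"
    have "0 \<le> s * (2 * (B v \<bullet> B v) + s * C)" using q[of s] by (simp add: C_def power2_eq_square algebra_simps)
    moreover have "s < 0" using p C by (simp add: s_def divide_neg_pos)
    ultimately have "2 * (B v \<bullet> B v) + s * C \<le> 0" by (simp add: zero_le_mult_iff)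
    moreover have "s * C \<ge> - (B v \<bullet> B v)"
      using p C by (simp add: s_def divide_simps algebra_simps)
    ultimately show False using p by simp
  qed
  then show ?thesis by (simp add: B_def)
qed

lemma eigenvector_rayleigh: "ham d v = mu d *\<^sub>R v \<Longrightarrow> ham d v \<bullet> v = mu d * (norm v)\<^sup>2"
  by (simp add: power2_norm_eq_inner)

lemma norm_sq_derivative:
  assumes "(\<Psi> has_vector_derivative (\<kappa> / t) *\<^sub>R ham (t *\<^sub>R d) (\<Psi> t)) (at t)"
  shows "((\<lambda>t. \<Psi> t \<bullet> \<Psi> t) has_real_derivative (2 * \<kappa> / t) * (ham (t *\<^sub>R d) (\<Psi> t) \<bullet> \<Psi> t)) (at t)"
proof -
  have d: "(\<Psi> has_derivative (\<lambda>h. h *\<^sub>R ((\<kappa> / t) *\<^sub>R ham (t *\<^sub>R d) (\<Psi> t)))) (at t)"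
    using assms by (simp add: has_vector_derivative_def)
  show ?thesis unfolding has_field_derivative_def
    by (rule has_derivative_eq_rhs[OF has_derivative_inner[OF d d]]) (auto simp: inner_commute algebra_simps fun_eq_iff)
qed

text \<open>Since \<open>lap\<close> is positive semidefinite, the singular term \<open>- lap U / t\<close> only damps \<open>U\<close>; the remaining
part grows at most like \<open>exp (t * norm d)\<close>. So a solution is controlled by its value at \<open>0\<close>.\<close>

lemma radial_zero:
  assumes der: "\<And>t. t > 0 \<Longrightarrow> (U has_vector_derivative (1 / t) *\<^sub>R ham (t *\<^sub>R d) (U t)) (at t)"
    and lim: "(U \<longlongrightarrow> 0) (at_right 0)" and t: "t > 0"
  shows "U t = 0"
proof -
  define f where "f = (\<lambda>s. exp (- 2 * norm d * s) * (U s \<bullet> U s))"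
  have mono: "f t \<le> f s" if s: "0 < s" "s \<le> t" for s
  proof (rule DERIV_nonpos_imp_nonincreasing[OF s(2)])
    fix x assume x: "s \<le> x" "x \<le> t"
    then have x0: "x > 0" using s by simp
    let ?h = "ham (x *\<^sub>R d) (U x) \<bullet> U x"
    let ?y = "exp (- 2 * norm d * x) * (2 / x) * (?h - norm (x *\<^sub>R d) * (U x \<bullet> U x))"
    have e: "((\<lambda>s. exp (- 2 * norm d * s)) has_real_derivative (- 2 * norm d) * exp (- 2 * norm d * x)) (at x)"
      by (auto intro!: derivative_eq_intros)
    have "(f has_real_derivative (- 2 * norm d) * exp (- 2 * norm d * x) * (U x \<bullet> U x) +
         (2 * 1 / x) * ?h * exp (- 2 * norm d * x)) (at x)"
      unfolding f_def by (rule DERIV_mult[OF e norm_sq_derivative[OF der[OF x0]]])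
    also have "(- 2 * norm d) * exp (- 2 * norm d * x) * (U x \<bullet> U x) + (2 * 1 / x) * ?h * exp (- 2 * norm d * x) = ?y"
      using x0 by (simp add: field_simps)
    finally have "(f has_real_derivative ?y) (at x)" .
    moreover have "?h \<le> norm (x *\<^sub>R d) * (U x \<bullet> U x)"
      using diag_bound[of "x *\<^sub>R d" "U x"] lap_nonneg[of "U x"]
      unfolding ham_inner power2_norm_eq_inner by linarith
    then have "?y \<le> 0" using x0 by (intro mult_nonneg_nonpos) auto
    ultimately show "\<exists>y. (f has_real_derivative y) (at x) \<and> y \<le> 0" by blast
  qed
  have "(f \<longlongrightarrow> exp (- 2 * norm d * 0) * ((0::real^'n) \<bullet> 0)) (at_right 0)"
    unfolding f_def by (intro tendsto_intros lim)
  then have "(f \<longlongrightarrow> 0) (at_right 0)" by simp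
  moreover have "eventually (\<lambda>s. f t \<le> f s) (at_right 0)"
    unfolding eventually_at_right_field using t mono by (intro exI[of _ t]) auto
  ultimately have "f t \<le> 0" by (intro tendsto_lowerbound) auto
  moreover have "0 < exp (- 2 * norm d * t)" by simp
  ultimately have "U t \<bullet> U t \<le> 0" unfolding f_def using mult_pos_pos not_less by blast
  then show ?thesis by (metis inner_eq_zero_iff inner_ge_zero order_antisym)
qed

end

locale connected_reflection_system = reflection_system A nu r
  for A :: "'a set" and nu :: "'a \<Rightarrow> real" and r :: "'a \<Rightarrow> 'n::finite \<Rightarrow> 'n" +
  assumes nu_pos: "a \<in> A \<Longrightarrow> nu a > 0"
    and connected: "S \<noteq> {} \<Longrightarrow> (\<And>a i. a \<in> A \<Longrightarrow> i \<in> S \<Longrightarrow> r a i \<in> S) \<Longrightarrow> S = UNIV"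
begin

text \<open>Taking absolute values does not increase any term of the Dirichlet form and leaves the diagonal part unchanged.\<close>

lemma abs_eigenvector:
  assumes "ham d v = mu d *\<^sub>R v"
  shows "ham d (\<chi> i. \<bar>v $ i\<bar>) = mu d *\<^sub>R (\<chi> i. \<bar>v $ i\<bar>)"
proof (rule maximiser_eigenvector)
  let ?w = "(\<chi> i. \<bar>v $ i\<bar>) :: real^'n"
  have n: "norm ?w = norm v" by (simp add: norm_vec_def)
  have "lap ?w \<bullet> ?w \<le> lap v \<bullet> v"
  proof -
    have "(\<bar>v $ i\<bar> - \<bar>v $ j\<bar>) * (\<bar>v $ i\<bar> - \<bar>v $ j\<bar>) \<le> (v $ i - v $ j) * (v $ i - v $ j)" for i j
      by (metis abs_le_square_iff abs_triangle_ineq3 power2_eq_square)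
    then show ?thesis unfolding lap_inner
      by (auto intro!: divide_right_mono sum_mono mult_left_mono nu_nonneg)
  qed
  then have "ham d v \<bullet> v \<le> ham d ?w \<bullet> ?w" by (simp add: ham_inner)
  with mu_upper[of d ?w] eigenvector_rayleigh[OF assms] n
  show "ham d ?w \<bullet> ?w = mu d * (norm ?w)\<^sup>2" by simp
qed

text \<open>At a zero of a nonnegative eigenvector the eigenvalue equation says that a positive combination of its
neighbouring values vanishes, so the zeros spread over the whole connected set of states.\<close>

lemma eigenvector_no_zero:
  assumes "ham d v = mu d *\<^sub>R v" "v $ i = 0"
  shows "v = 0"
proof -
  define w where "w = (\<chi> i. \<bar>v $ i\<bar>)"
  have w: "ham d w = mu d *\<^sub>R w" using abs_eigenvector[OF assms(1)] by (simp add: w_def)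
  have "{i. w $ i = 0} = UNIV"
  proof (rule connected)
    show "{i. w $ i = 0} \<noteq> {}" using assms by (auto simp: w_def)
    fix a i assume a: "a \<in> A" and "i \<in> {i. w $ i = 0}"
    then have i: "w $ i = 0" by simp
    have "ham d w $ i = 0" using w i by simp
    then have "(\<Sum>a\<in>A. nu a * w $ r a i) = 0"
      using i by (simp add: ham_def lap_def sum_negf)
    moreover have "\<And>a. a \<in> A \<Longrightarrow> 0 \<le> nu a * w $ r a i"
      by (simp add: nu_nonneg w_def)
    ultimately have "nu a * w $ r a i = 0"
      using a finite_refl by (simp add: sum_nonneg_eq_0_iff)
    then show "r a i \<in> {i. w $ i = 0}" using nu_pos[OF a] by simp
  qed
  then show ?thesis by (auto simp: w_def vec_eq_iff)
qed

lemma eigenspace_orthogonal: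
  assumes "ham d v = mu d *\<^sub>R v" "ham d w = mu d *\<^sub>R w" "v \<bullet> w = 0" "v \<noteq> 0"
  shows "w = 0"
proof -
  obtain i :: 'n where True by simp
  \<comment> \<open>the combination of the two eigenvectors that vanishes at a chosen state\<close>
  define z where "z = w $ i *\<^sub>R v - v $ i *\<^sub>R w"
  have "ham d z = mu d *\<^sub>R z"
    using assms(1,2) by (simp add: z_def linear_diff[OF linear_ham] linear_scale[OF linear_ham] algebra_simps)
  moreover have "z $ i = 0" by (simp add: z_def)
  ultimately have "z = 0" by (rule eigenvector_no_zero)
  then have "z \<bullet> v = 0" by simp
  then have "w $ i * (v \<bullet> v) = 0" using assms(3) inner_commute[of w v] by (simp add: z_def inner_diff_left)
  then have "w $ i = 0" using assms(4) by simp
  with assms(2) show ?thesis by (rule eigenvector_no_zero)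
qed

definition perron :: "real^'n \<Rightarrow> real^'n" where
  "perron d = (SOME v. norm v = 1 \<and> (\<forall>i. v $ i > 0) \<and> ham d v = mu d *\<^sub>R v)"

lemma perron: "norm (perron d) = 1" "perron d $ i > 0" "ham d (perron d) = mu d *\<^sub>R perron d"
proof -
  obtain v where v: "norm v = 1" "ham d v \<bullet> v = mu d" using mu_attained[of d] by auto
  then have e: "ham d v = mu d *\<^sub>R v" by (intro maximiser_eigenvector) auto
  have "v $ i \<noteq> 0" for i using eigenvector_no_zero[OF e, of i] v by auto
  then have "norm (\<chi> i. \<bar>v $ i\<bar>) = 1 \<and> (\<forall>i. (\<chi> i. \<bar>v $ i\<bar>) $ i > 0) \<and> ham d (\<chi> i. \<bar>v $ i\<bar>) = mu d *\<^sub>R (\<chi> i. \<bar>v $ i\<bar>)"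
    using abs_eigenvector[OF e] v by (auto simp: norm_vec_def)
  then have "norm (perron d) = 1 \<and> (\<forall>i. perron d $ i > 0) \<and> ham d (perron d) = mu d *\<^sub>R perron d"
    unfolding perron_def by (rule someI)
  then show "norm (perron d) = 1" "perron d $ i > 0" "ham d (perron d) = mu d *\<^sub>R perron d" by auto
qed

text \<open>The gap is a continuous positive function on the compact set of all triples of a parameter, a unit
top eigenvector and an orthogonal unit vector, hence bounded below.\<close>

lemma spectral_gap_compact:
  "\<exists>g>0. \<forall>d v. norm d \<le> M \<longrightarrow> v \<bullet> perron d = 0 \<longrightarrow> g * (norm v)\<^sup>2 \<le> mu d * (norm v)\<^sup>2 - ham d v \<bullet> v"
proof -
  define Z where "Z = {(d, p, v). norm d \<le> M \<and> norm p = 1 \<and> norm v = 1 \<and> v \<bullet> p = 0 \<and> ham d p = mu d *\<^sub>R p}"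
  have mu_c: "continuous_on S (\<lambda>x. mu (f x))" if "continuous_on S f" for S and f :: "(real^'n) \<times> (real^'n) \<times> (real^'n) \<Rightarrow> real^'n"
    using continuous_on_compose2[OF continuous_on_mu that] by auto
  have "closed Z"
    unfolding Z_def case_prod_beta
    by (intro closed_Collect_conj closed_Collect_le closed_Collect_eq continuous_intros mu_c)
  moreover have "Z \<subseteq> cball 0 M \<times> cball 0 1 \<times> cball 0 1" by (auto simp: Z_def)
  ultimately have cpt: "compact Z"
    using compact_Times[OF compact_cball compact_Times[OF compact_cball compact_cball]]
    by (metis compact_Int_closed inf.absorb_iff2)
  define f where "f = (\<lambda>(d::real^'n, p::real^'n, v). mu d - ham d v \<bullet> v)"
  have fc: "continuous_on Z f" unfolding f_def case_prod_beta by (intro continuous_intros mu_c)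
  have fpos: "f z > 0" if "z \<in> Z" for z
  proof -
    obtain d p v where z: "z = (d, p, v)" by (metis prod_cases3)
    with that have Z: "norm p = 1" "norm v = 1" "v \<bullet> p = 0" "ham d p = mu d *\<^sub>R p" by (auto simp: Z_def)
    have "f z \<noteq> 0"
    proof
      assume "f z = 0"
      then have "ham d v = mu d *\<^sub>R v" using Z z by (intro maximiser_eigenvector) (simp add: f_def)
      then have "v = 0" using eigenspace_orthogonal[of d p v] Z inner_commute[of p v] by fastforce
      with Z show False by simp
    qed
    moreover have "f z \<ge> 0" using mu_upper[of d v] Z z by (simp add: f_def)
    ultimately show ?thesis by simp
  qed
  obtain g where g: "g > 0" "\<And>z. z \<in> Z \<Longrightarrow> g \<le> f z"
  proof (cases "Z = {}")
    case True then show ?thesis using that[of 1] by auto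
  next
    case False
    with continuous_attains_inf[OF cpt False fc] fpos that show ?thesis by blast
  qed
  show ?thesis
  proof (intro exI[of _ g] conjI allI impI g)
    fix d v assume d: "norm d \<le> M" and o: "v \<bullet> perron d = 0"
    show "g * (norm v)\<^sup>2 \<le> mu d * (norm v)\<^sup>2 - ham d v \<bullet> v"
    proof (cases "v = 0")
      case True then show ?thesis by (simp add: linear_0[OF linear_ham])
    next
      case False
      define w where "w = (1 / norm v) *\<^sub>R v"
      have w: "norm w = 1" "w \<bullet> perron d = 0" using False o by (simp_all add: w_def)
      then have "(d, perron d, w) \<in> Z" using d perron by (simp add: Z_def)
      from g(2)[OF this] have "g \<le> mu d - ham d w \<bullet> w" by (simp add: f_def)
      moreover have "v = norm v *\<^sub>R w" using False by (simp add: w_def)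
      then have "ham d v \<bullet> v = (norm v)\<^sup>2 * (ham d w \<bullet> w)"
        by (metis (no_types, lifting) inner_scaleR_left inner_scaleR_right linear_ham linear_scale mult.assoc power2_eq_square)
      ultimately show ?thesis
        using mult_right_mono[of g "mu d - ham d w \<bullet> w" "(norm v)\<^sup>2"] by (simp add: algebra_simps)
    qed
  qed
qed

end

section \<open>Radial systems with a large parameter\<close>

abbreviation mass :: "real^'n::finite \<Rightarrow> real" where
  "mass v \<equiv> (\<Sum>i\<in>UNIV. v $ i)"

abbreviation wmean :: "real^'n::finite \<Rightarrow> real^'n \<Rightarrow> real" where
  "wmean l v \<equiv> (\<Sum>i\<in>UNIV. l $ i * v $ i) / mass v"

text \<open>Used for a function that is merely continuous, because \<open>mu\<close> is only known to be Lipschitz: it suffices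
that the level \<open>e\<close> cannot be crossed upwards at a point where it is attained.\<close>

lemma trapped_below:
  fixes a :: "real \<Rightarrow> real"
  assumes c: "continuous_on {0..T} a" and a0: "a 0 < e"
    and step: "\<And>s. 0 < s \<Longrightarrow> s < T \<Longrightarrow> a s = e \<Longrightarrow> \<exists>\<delta>>0. \<forall>t. s < t \<longrightarrow> t < s + \<delta> \<longrightarrow> a t \<le> e"
    and t: "t \<in> {0..T}"
  shows "a t \<le> e"
proof (rule ccontr)
  assume at: "\<not> a t \<le> e"
  define S where "S = {x\<in>{0..t}. a x \<le> e}"
  have ct: "continuous_on {0..t} a" using c by (rule continuous_on_subset) (use t in auto)
  have "closed S" unfolding S_def
    using continuous_closed_preimage[OF ct closed_atLeastAtMost closed_atMost[of e]]
    by (simp add: vimage_def Int_def)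
  moreover have S0: "0 \<in> S" using a0 t by (auto simp: S_def)
  moreover have bdd: "bdd_above S" by (auto simp: S_def intro!: bdd_aboveI[of _ t])
  ultimately have sS: "Sup S \<in> S" using closed_contains_Sup by blast
  define s where "s = Sup S"
  have s: "0 \<le> s" "s < t" "a s \<le> e" using sS at by (auto simp: S_def s_def less_le)
  have above: "a x > e" if "s < x" "x \<le> t" for x
  proof (rule ccontr)
    assume "\<not> a x > e"
    then have "x \<in> S" using that s by (auto simp: S_def)
    then have "x \<le> s" using cSup_upper[OF _ bdd] by (simp add: s_def)
    with that show False by simp
  qed
  have "a s = e"
  proof (rule ccontr)
    assume "a s \<noteq> e"
    then have lt: "a s < e" using s by simp
    have "continuous_on {s..t} a" using ct by (rule continuous_on_subset) (use s in auto)
    then obtain x where "s \<le> x" "x \<le> t" "a x = e"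
      using IVT'[of a s e t] lt at s by auto
    with above[of x] lt show False by (cases "x = s") auto
  qed
  moreover have "s \<noteq> 0" using a0 \<open>a s = e\<close> by auto
  ultimately obtain \<delta> where \<delta>: "\<delta> > 0" "\<And>x. s < x \<Longrightarrow> x < s + \<delta> \<Longrightarrow> a x \<le> e"
    using step[of s] s t by auto
  define x where "x = min t (s + \<delta> / 2)"
  have "s < x" "x \<le> t" "x < s + \<delta>" using s \<delta>(1) by (auto simp: x_def)
  with above[of x] \<delta>(2)[of x] show False by simp
qed

text \<open>Weighted means depend only on the direction of \<open>v\<close> and are stable near a positive direction: there the
sum of the components, by which one divides, is comparable with the norm.\<close>

lemma ratio_near_direction:
  fixes p v l :: "real^'n::finite"
  assumes p: "norm p = 1" "\<And>i. p $ i > 0" and v: "v \<noteq> 0"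
    and near: "norm (v - (v \<bullet> p) *\<^sub>R p) \<le> \<delta> * norm v" and \<delta>: "sqrt CARD('n) * \<delta> \<le> 1/4"
  shows "mass v \<noteq> 0"
    and "\<bar>wmean l v - wmean l p\<bar>
          \<le> 4 * sqrt CARD('n) * \<delta> * norm l"
proof -
  define one :: "real^'n" where "one = (\<chi> i. 1)"
  define u where "u = v - (v \<bullet> p) *\<^sub>R p"
  have one: "mass w = one \<bullet> w" for w :: "real^'n" by (simp add: one_def inner_vec_def)
  have l: "(\<Sum>i\<in>UNIV. l $ i * w $ i) = l \<bullet> w" for w by (simp add: inner_vec_def)
  have norm_one: "norm one = sqrt CARD('n)" by (simp add: one_def norm_eq_sqrt_inner inner_vec_def)
  have card1: "1 \<le> sqrt CARD('n)" by (simp add: Suc_leI)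
  have \<delta>0: "\<delta> \<ge> 0" using near v by (meson norm_ge_zero order_trans zero_le_mult_iff not_less zero_less_norm_iff)
  have "1 = (\<Sum>i\<in>UNIV. p $ i * p $ i)" using p(1) by (simp add: norm_eq_sqrt_inner inner_vec_def)
  also have "\<dots> \<le> (\<Sum>i\<in>UNIV. 1 * p $ i)"
  proof (intro sum_mono mult_right_mono)
    show "p $ i \<le> 1" for i using component_le_norm_cart[of p i] p(1) by simp
    show "0 \<le> p $ i" for i using p(2)[of i] by simp
  qed
  finally have op: "1 \<le> one \<bullet> p" using one[of p] by simp
  define \<rho> where "\<rho> = (l \<bullet> p) / (one \<bullet> p)"
  have "\<bar>l \<bullet> p\<bar> \<le> norm l" using Cauchy_Schwarz_ineq2[of l p] p(1) by simp
  also have "\<dots> \<le> norm l * (one \<bullet> p)" using mult_left_mono[OF op, of "norm l"] by simp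
  finally have \<rho>: "\<bar>\<rho>\<bar> \<le> norm l"
    using op by (simp add: \<rho>_def divide_le_eq)
  have nu: "norm u \<le> \<delta> * norm v" using near by (simp add: u_def)
  have "norm v \<le> norm u + norm ((v \<bullet> p) *\<^sub>R p)" using norm_triangle_ineq[of u "(v \<bullet> p) *\<^sub>R p"] by (simp add: u_def)
  then have c: "(1 - \<delta>) * norm v \<le> \<bar>v \<bullet> p\<bar>" using nu p(1) by (simp add: algebra_simps)
  have ou: "\<bar>one \<bullet> u\<bar> \<le> sqrt CARD('n) * \<delta> * norm v"
    using Cauchy_Schwarz_ineq2[of one u] mult_left_mono[OF nu, of "sqrt CARD('n)"] unfolding norm_one mult.assoc by (meson order_trans real_sqrt_ge_0_iff of_nat_0_le_iff)
  have \<delta>': "\<delta> \<le> 1/4" using mult_right_mono[OF card1 \<delta>0] \<delta> by linarith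
  have ov: "one \<bullet> v = (v \<bullet> p) * (one \<bullet> p) + one \<bullet> u" by (simp add: u_def inner_diff_right)
  have "\<bar>v \<bullet> p\<bar> * 1 \<le> \<bar>v \<bullet> p\<bar> * (one \<bullet> p)" using op by (intro mult_left_mono) auto
  moreover have "sqrt CARD('n) * \<delta> * norm v \<le> 1/4 * norm v" using \<delta> by (intro mult_right_mono) auto
  moreover have "3/4 * norm v \<le> (1 - \<delta>) * norm v" using \<delta>' by (intro mult_right_mono) auto
  moreover have "\<bar>(v \<bullet> p) * (one \<bullet> p)\<bar> = \<bar>v \<bullet> p\<bar> * (one \<bullet> p)" using op by (simp add: abs_mult)
  ultimately have low: "norm v / 2 \<le> \<bar>one \<bullet> v\<bar>" using ov c ou by linarith
  then show nz: "mass v \<noteq> 0" using v by (auto simp: one)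
  have nv: "one \<bullet> v \<noteq> 0" using nz by (simp add: one)
  have "(l - \<rho> *\<^sub>R one) \<bullet> p = 0" using op by (simp add: \<rho>_def inner_diff_left)
  then have "(l - \<rho> *\<^sub>R one) \<bullet> v = (l - \<rho> *\<^sub>R one) \<bullet> u" by (simp add: u_def inner_diff_right)
  moreover have "(l \<bullet> v) / (one \<bullet> v) - \<rho> = ((l - \<rho> *\<^sub>R one) \<bullet> v) / (one \<bullet> v)"
    using nv by (simp add: inner_diff_left diff_divide_distrib)
  ultimately have eq: "\<bar>(l \<bullet> v) / (one \<bullet> v) - \<rho>\<bar> = \<bar>(l - \<rho> *\<^sub>R one) \<bullet> u\<bar> / \<bar>one \<bullet> v\<bar>" by simp
  have "\<bar>\<rho>\<bar> * sqrt CARD('n) \<le> norm l * sqrt CARD('n)" using \<rho> by (rule mult_right_mono) simp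
  then have "norm (l - \<rho> *\<^sub>R one) \<le> norm l + norm l * sqrt CARD('n)"
    using norm_triangle_ineq4[of l "\<rho> *\<^sub>R one"] unfolding norm_scaleR norm_one by linarith
  also have "\<dots> \<le> 2 * sqrt CARD('n) * norm l" using mult_left_mono[OF card1, of "norm l"] by simp
  finally have "\<bar>(l - \<rho> *\<^sub>R one) \<bullet> u\<bar> \<le> (2 * sqrt CARD('n) * norm l) * (\<delta> * norm v)"
    using Cauchy_Schwarz_ineq2[of "l - \<rho> *\<^sub>R one" u] mult_mono[OF _ nu, of "norm (l - \<rho> *\<^sub>R one)" "2 * sqrt CARD('n) * norm l"] by simp
  also have "\<dots> = (4 * sqrt CARD('n) * \<delta> * norm l) * (norm v / 2)" by simp
  also have "\<dots> \<le> (4 * sqrt CARD('n) * \<delta> * norm l) * \<bar>one \<bullet> v\<bar>"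
    using low \<delta>0 by (intro mult_left_mono) auto
  finally have "\<bar>(l \<bullet> v) / (one \<bullet> v) - \<rho>\<bar> \<le> 4 * sqrt CARD('n) * \<delta> * norm l"
    using nv by (simp add: eq divide_le_eq)
  then show "\<bar>wmean l v - wmean l p\<bar>
          \<le> 4 * sqrt CARD('n) * \<delta> * norm l"
    by (simp add: one l \<rho>_def)
qed

context connected_reflection_system
begin

text \<open>The initial value is the constant vector, which is a top eigenvector of \<open>ham 0 = - lap\<close>. The equation is
\<open>t \<Psi>' = \<kappa> (t D - K) \<Psi>\<close>, with \<open>D\<close> the diagonal matrix of \<open>d\<close> and \<open>K = lap\<close>.\<close>

definition radial_solution :: "real \<Rightarrow> real^'n \<Rightarrow> (real \<Rightarrow> real^'n) \<Rightarrow> bool" where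
  "radial_solution \<kappa> d \<Psi> \<longleftrightarrow> continuous_on {0..1} \<Psi> \<and> \<Psi> 0 = (\<chi> i. 1) \<and>
     (\<forall>t>0. (\<Psi> has_vector_derivative (\<kappa> / t) *\<^sub>R ham (t *\<^sub>R d) (\<Psi> t)) (at t))"

lemma radial_solutionD:
  "radial_solution \<kappa> d \<Psi> \<Longrightarrow> t > 0 \<Longrightarrow> (\<Psi> has_vector_derivative (\<kappa> / t) *\<^sub>R ham (t *\<^sub>R d) (\<Psi> t)) (at t)"
  by (simp add: radial_solution_def)

lemma ham_bound: "\<exists>B\<ge>0. \<forall>v. \<forall>t\<in>{0..1}. \<bar>ham (t *\<^sub>R d) v \<bullet> v\<bar> \<le> B * (norm v)\<^sup>2"
proof -
  have "bounded_linear lap" using linear_lap by (rule linear_conv_bounded_linear[THEN iffD1])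
  then obtain K where K: "\<And>v. norm (lap v) \<le> norm v * K" "K > 0"
    using bounded_linear.pos_bounded by blast
  show ?thesis
  proof (intro exI[of _ "norm d + K"] conjI allI ballI)
    show "0 \<le> norm d + K" using K by (simp add: add_nonneg_nonneg)
    fix v :: "real^'n" and t :: real assume t: "t \<in> {0..1}"
    have "\<bar>\<Sum>i\<in>UNIV. (t *\<^sub>R d) $ i * (v $ i)\<^sup>2\<bar> \<le> norm (t *\<^sub>R d) * (norm v)\<^sup>2" by (rule diag_bound)
    also have "\<dots> \<le> norm d * (norm v)\<^sup>2" using t by (intro mult_right_mono) (auto simp: mult_left_le_one_le)
    finally have 1: "\<bar>\<Sum>i\<in>UNIV. (t *\<^sub>R d) $ i * (v $ i)\<^sup>2\<bar> \<le> norm d * (norm v)\<^sup>2" .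
    have "\<bar>lap v \<bullet> v\<bar> \<le> norm (lap v) * norm v" by (rule Cauchy_Schwarz_ineq2)
    also have "\<dots> \<le> (norm v * K) * norm v" using K by (intro mult_right_mono) auto
    finally have 2: "\<bar>lap v \<bullet> v\<bar> \<le> K * (norm v)\<^sup>2" by (simp add: power2_eq_square mult_ac)
    show "\<bar>ham (t *\<^sub>R d) v \<bullet> v\<bar> \<le> (norm d + K) * (norm v)\<^sup>2"
      unfolding ham_inner distrib_right using 1 2 by linarith
  qed
qed

text \<open>The norm decays at most like a power of \<open>t\<close> going forward, so the square norm times a suitable power of \<open>t\<close>
is nondecreasing: a zero at \<open>t\<close> would force zeros all the way down to \<open>0\<close>.\<close>

lemma radial_solution_nonzero:
  assumes sol: "radial_solution \<kappa> d \<Psi>" and t: "t \<in> {0..1}" and \<kappa>: "\<kappa> \<ge> 0"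
  shows "\<Psi> t \<noteq> 0"
proof
  assume z: "\<Psi> t = 0"
  have \<Psi>0: "\<Psi> 0 \<noteq> 0" using sol by (auto simp: radial_solution_def vec_eq_iff)
  with z t have t0: "t > 0" "t \<le> 1" by (auto simp: less_le)
  obtain B where B: "B \<ge> 0" "\<And>v t. t \<in> {0..1} \<Longrightarrow> \<bar>ham (t *\<^sub>R d) v \<bullet> v\<bar> \<le> B * (norm v)\<^sup>2"
    using ham_bound by blast
  have zero: "\<Psi> s = 0" if s: "0 < s" "s \<le> t" for s
  proof -
    define f where "f = (\<lambda>x. x powr (2 * \<kappa> * B) * (\<Psi> x \<bullet> \<Psi> x))"
    have "f s \<le> f t"
    proof (rule DERIV_nonneg_imp_nondecreasing[OF s(2)])
      fix x assume x: "s \<le> x" "x \<le> t"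
      then have x0: "x > 0" "x \<le> 1" using s t0 by auto
      let ?h = "ham (x *\<^sub>R d) (\<Psi> x) \<bullet> \<Psi> x"
      let ?y = "(2 * \<kappa> / x) * x powr (2 * \<kappa> * B) * (B * (\<Psi> x \<bullet> \<Psi> x) + ?h)"
      have "(f has_real_derivative (2 * \<kappa> * B) * x powr (2 * \<kappa> * B - 1) * (\<Psi> x \<bullet> \<Psi> x) +
            (2 * \<kappa> / x) * ?h * x powr (2 * \<kappa> * B)) (at x)"
        unfolding f_def by (intro DERIV_mult has_real_derivative_powr norm_sq_derivative[OF radial_solutionD[OF sol]] x0)
      also have "(2 * \<kappa> * B) * x powr (2 * \<kappa> * B - 1) * (\<Psi> x \<bullet> \<Psi> x) +
            (2 * \<kappa> / x) * ?h * x powr (2 * \<kappa> * B) = ?y"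
        using x0 by (simp add: powr_diff field_simps)
      finally have "(f has_real_derivative ?y) (at x)" .
      moreover have "?y \<ge> 0"
        using B(2)[of x "\<Psi> x"] x0 \<kappa> by (intro mult_nonneg_nonneg) (auto simp: power2_norm_eq_inner)
      ultimately show "\<exists>y. (f has_real_derivative y) (at x) \<and> 0 \<le> y" by blast
    qed
    then have "s powr (2 * \<kappa> * B) * (\<Psi> s \<bullet> \<Psi> s) \<le> 0" using z by (simp add: f_def)
    then show ?thesis using s by (smt (verit) inner_gt_zero_iff powr_gt_zero zero_less_mult_iff)
  qed
  have "continuous_on {0..1} \<Psi>" using sol by (simp add: radial_solution_def)
  then have "(\<Psi> \<longlongrightarrow> \<Psi> 0) (at 0 within {0..1})" by (simp add: continuous_on_def)
  then have "(\<Psi> \<longlongrightarrow> \<Psi> 0) (at 0 within {0<..t})"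
    by (rule tendsto_within_subset) (use t0 in auto)
  moreover have "(\<Psi> \<longlongrightarrow> 0) (at 0 within {0<..t})"
    by (rule tendsto_eventually) (auto simp: eventually_at_filter zero)
  moreover have "at 0 within {0<..t} \<noteq> bot"
    using t0 by (simp add: at_within_eq_bot_iff)
  ultimately have "\<Psi> 0 = 0" using tendsto_unique by blast
  with \<Psi>0 show False ..
qed

text \<open>How the gap enters: the defect of the Rayleigh quotient bounds the distance to the line of the Perron
vector, and is itself bounded by the residual, which drives the growth of the quotient.\<close>

lemma orthogonal_part:
  assumes gap: "\<And>v. v \<bullet> perron d = 0 \<Longrightarrow> g * (norm v)\<^sup>2 \<le> mu d * (norm v)\<^sup>2 - ham d v \<bullet> v" and g: "g > 0"
  defines "B \<equiv> \<lambda>v. mu d *\<^sub>R v - ham d v"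
  shows "g * (norm (v - (v \<bullet> perron d) *\<^sub>R perron d))\<^sup>2 \<le> B v \<bullet> v"
    and "g * (B v \<bullet> v) \<le> (norm (B v))\<^sup>2"
proof -
  define p where "p = perron d"
  define u where "u = v - (v \<bullet> p) *\<^sub>R p"
  have pp: "p \<bullet> p = 1" using perron(1)[of d] by (simp add: p_def norm_eq_sqrt_inner)
  have up: "u \<bullet> p = 0" using pp by (simp add: u_def inner_diff_left)
  have lin: "linear B" unfolding B_def using linear_ham by (intro linear_compose_sub) (auto intro: linearI simp: algebra_simps)
  have Bp: "B p = 0" using perron(3)[of d] by (simp add: B_def p_def)
  have sym: "B x \<bullet> w = x \<bullet> B w" for x w
    by (simp add: B_def inner_diff_left inner_diff_right ham_sym)
  have vu: "v = u + (v \<bullet> p) *\<^sub>R p" by (simp add: u_def)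
  have Bv: "B v = B u" using Bp by (subst vu) (simp add: linear_add[OF lin] linear_scale[OF lin])
  have "B u \<bullet> (u + (v \<bullet> p) *\<^sub>R p) = B u \<bullet> u" using sym[of u p] Bp by (simp add: inner_add_right)
  then have Bvv: "B v \<bullet> v = B u \<bullet> u" unfolding vu[symmetric] Bv .
  have gu: "g * (norm u)\<^sup>2 \<le> B u \<bullet> u"
    using gap[of u] up by (simp add: p_def B_def inner_diff_left power2_norm_eq_inner)
  then show "g * (norm (v - (v \<bullet> perron d) *\<^sub>R perron d))\<^sup>2 \<le> B v \<bullet> v"
    using Bvv by (simp add: u_def p_def)
  have cs: "B u \<bullet> u \<le> norm (B u) * norm u" using Cauchy_Schwarz_ineq2[of "B u" u] by simp
  have "g * (B u \<bullet> u) \<le> (norm (B u))\<^sup>2"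
  proof (cases "u = 0")
    case True then show ?thesis by simp
  next
    case False
    then have nu: "norm u > 0" by simp
    have "g * norm u * norm u \<le> norm (B u) * norm u" using gu cs by (simp add: power2_eq_square mult.assoc)
    then have "g * norm u \<le> norm (B u)" using nu by simp
    then have "norm (B u) * (g * norm u) \<le> norm (B u) * norm (B u)" by (intro mult_left_mono) auto
    moreover have "g * (B u \<bullet> u) \<le> g * (norm (B u) * norm u)" using cs g by simp
    ultimately show ?thesis by (simp add: power2_eq_square mult_ac)
  qed
  then show "g * (B v \<bullet> v) \<le> (norm (B v))\<^sup>2" by (simp add: Bv Bvv[unfolded Bv])
qed

text \<open>For a normalised \<open>\<Psi>\<close> with residual \<open>B = mu \<Psi> - ham \<Psi>\<close> and defect \<open>a\<close>, the Rayleigh quotient \<open>R\<close> satisfies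
\<open>R' = \<langle>D \<Psi>, \<Psi>\<rangle> + (2 \<kappa> / t) (\<parallel>B\<parallel>\<^sup>2 - a\<^sup>2)\<close>. With \<open>\<parallel>B\<parallel>\<^sup>2 \<ge> g a\<close> the bracket is at least \<open>g e / 2\<close> when
\<open>a = e \<le> g / 2\<close>, so \<open>R' > M\<close>, whereas the largest eigenvalue moves with speed at most \<open>M\<close>: the defect
cannot rise above \<open>e\<close>.\<close>

lemma rayleigh_defect_small:
  assumes gap: "\<And>d v. norm d \<le> M \<Longrightarrow> v \<bullet> perron d = 0 \<Longrightarrow> g * (norm v)\<^sup>2 \<le> mu d * (norm v)\<^sup>2 - ham d v \<bullet> v"
    and g: "g > 0" and e: "0 < e" "e \<le> g / 2" and \<kappa>: "\<kappa> > 0" "\<kappa> * g * e > 2 * M" and M: "norm d \<le> M"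
    and sol: "radial_solution \<kappa> d \<Psi>" and t: "t \<in> {0..1}"
  shows "mu (t *\<^sub>R d) - (ham (t *\<^sub>R d) (\<Psi> t) \<bullet> \<Psi> t) / (\<Psi> t \<bullet> \<Psi> t) \<le> e"
proof -
  have nz: "\<Psi> t \<bullet> \<Psi> t \<noteq> 0" if "t \<in> {0..1}" for t
    using radial_solution_nonzero[OF sol that] \<kappa>(1) by simp
  have cont: "continuous_on {0..1} \<Psi>" using sol by (simp add: radial_solution_def)
  define R where "R t = (ham (t *\<^sub>R d) (\<Psi> t) \<bullet> \<Psi> t) / (\<Psi> t \<bullet> \<Psi> t)" for t
  define a where "a t = mu (t *\<^sub>R d) - R t" for t
  have "a t \<le> e"
  proof (rule trapped_below[OF _ _ _ t])
    show "continuous_on {0..1} a"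
      unfolding a_def R_def
      by (intro continuous_intros cont continuous_on_compose2[OF continuous_on_mu]) (use nz in auto)
    \<comment> \<open>the Laplacian is nonnegative and annihilates constants\<close>
    have "mu 0 = 0"
    proof -
      obtain v where v: "norm v = 1" "ham 0 v \<bullet> v = mu 0" using mu_attained[of 0] by auto
      then have "mu 0 \<le> 0" using lap_nonneg[of v] by (simp add: ham_inner)
      moreover have "mu 0 \<ge> 0"
      proof -
        have "ham 0 ((\<chi> i. 1) :: real^'n) \<bullet> (\<chi> i. 1) = 0" by (simp add: ham_inner lap_one)
        with mu_upper[of 0 "(\<chi> i. 1) :: real^'n"] have "0 \<le> mu 0 * (norm ((\<chi> i. 1) :: real^'n))\<^sup>2" by simp
        moreover have "(norm ((\<chi> i. 1) :: real^'n))\<^sup>2 > 0" by (simp add: vec_eq_iff)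
        ultimately show ?thesis by (simp add: zero_le_mult_iff)
      qed
      ultimately show ?thesis by simp
    qed
    moreover have "R 0 = 0" using sol by (simp add: R_def radial_solution_def ham_inner lap_one)
    ultimately show "a 0 < e" using e by (simp add: a_def)
    fix s :: real assume s: "0 < s" "s < 1" and as: "a s = e"
    define n where "n = \<Psi> s \<bullet> \<Psi> s"
    define H where "H = ham (s *\<^sub>R d) (\<Psi> s)"
    have n: "n > 0" using nz[of s] s by (simp add: n_def less_le)
    have dPsi: "(\<Psi> has_derivative (\<lambda>h. h *\<^sub>R ((\<kappa> / s) *\<^sub>R H))) (at s)"
      using sol s by (auto simp: radial_solution_def has_vector_derivative_def H_def)
    have dq: "((\<lambda>t. t * (\<Sum>i\<in>UNIV. d $ i * (v t $ i)\<^sup>2)) has_derivative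
         (\<lambda>h. h * (\<Sum>i\<in>UNIV. d $ i * (v s $ i)\<^sup>2) + s * (\<Sum>i\<in>UNIV. d $ i * (2 * v s $ i * v' h $ i)))) (at s)"
      if "(v has_derivative v') (at s)" for v v' :: "real \<Rightarrow> real^'n"
      using that by (auto intro!: derivative_eq_intros bounded_linear.has_derivative[OF bounded_linear_vec_nth] simp: fun_eq_iff algebra_simps)
    have dl: "((\<lambda>t. lap (\<Psi> t) \<bullet> \<Psi> t) has_derivative (\<lambda>h. 2 * (lap (\<Psi> s) \<bullet> (h *\<^sub>R ((\<kappa> / s) *\<^sub>R H))))) (at s)"
    proof -
      have "bounded_linear lap" using linear_lap by (rule linear_conv_bounded_linear[THEN iffD1])
      from bounded_linear.has_derivative[OF this dPsi]
      have "((\<lambda>t. lap (\<Psi> t)) has_derivative (\<lambda>h. lap (h *\<^sub>R ((\<kappa> / s) *\<^sub>R H)))) (at s)" .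
      note d1 = has_derivative_inner[OF this dPsi]
      have c: "lap w \<bullet> \<Psi> s = lap (\<Psi> s) \<bullet> w" for w by (metis lap_sym inner_commute)
      show ?thesis by (rule has_derivative_eq_rhs[OF d1]) (simp only: c fun_eq_iff, simp)
    qed
    define D where "D = (\<Sum>i\<in>UNIV. d $ i * (\<Psi> s $ i)\<^sup>2)"
    have H_in: "w \<bullet> H = s * (\<Sum>i\<in>UNIV. d $ i * (w $ i * \<Psi> s $ i)) - lap (\<Psi> s) \<bullet> w" for w
      by (simp add: H_def ham_def inner_diff_right inner_commute) (simp add: inner_vec_def sum_distrib_left mult_ac)
    have dnum: "((\<lambda>t. ham (t *\<^sub>R d) (\<Psi> t) \<bullet> \<Psi> t) has_real_derivative D + (2 * \<kappa> / s) * (H \<bullet> H)) (at s)"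
    proof -
      have eq: "(\<lambda>t. ham (t *\<^sub>R d) (\<Psi> t) \<bullet> \<Psi> t) = (\<lambda>t. t * (\<Sum>i\<in>UNIV. d $ i * (\<Psi> t $ i)\<^sup>2) - lap (\<Psi> t) \<bullet> \<Psi> t)"
        by (simp add: ham_inner sum_distrib_left mult.assoc)
      show ?thesis unfolding eq has_field_derivative_def
        by (rule has_derivative_eq_rhs[OF has_derivative_diff[OF dq[OF dPsi] dl]])
          (use s in \<open>auto simp: fun_eq_iff D_def H_in[of H] sum_distrib_left algebra_simps\<close>)
    qed
    have dden: "((\<lambda>t. \<Psi> t \<bullet> \<Psi> t) has_real_derivative (2 * \<kappa> / s) * (H \<bullet> \<Psi> s)) (at s)"
      using norm_sq_derivative[OF radial_solutionD[OF sol s(1)]] by (simp add: H_def)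
    define R' where "R' = ((D + (2 * \<kappa> / s) * (H \<bullet> H)) * n - (H \<bullet> \<Psi> s) * ((2 * \<kappa> / s) * (H \<bullet> \<Psi> s))) / (n * n)"
    have dR: "(R has_real_derivative R') (at s)"
      unfolding R_def R'_def n_def H_def
      by (rule DERIV_divide[OF dnum[unfolded H_def] dden[unfolded H_def]]) (use nz[of s] s in auto)
    define B where "B = mu (s *\<^sub>R d) *\<^sub>R \<Psi> s - H"
    have ns: "norm (s *\<^sub>R d) \<le> M" using s M by (smt (verit) norm_scaleR mult_left_le_one_le norm_ge_zero abs_of_pos)
    have BB: "g * (B \<bullet> \<Psi> s) \<le> B \<bullet> B"
      using orthogonal_part(2)[OF gap[OF ns] g, of "\<Psi> s"] by (simp add: B_def H_def power2_norm_eq_inner)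
    have BPsi: "B \<bullet> \<Psi> s = e * n"
      using as n by (simp add: B_def inner_diff_left a_def R_def n_def[symmetric] H_def[symmetric] field_simps)
    have HPsi: "H \<bullet> \<Psi> s = (mu (s *\<^sub>R d) - e) * n"
      using BPsi by (simp add: B_def inner_diff_left n_def[symmetric] algebra_simps)
    have "B \<bullet> B = (mu (s *\<^sub>R d))\<^sup>2 * n - 2 * mu (s *\<^sub>R d) * (H \<bullet> \<Psi> s) + H \<bullet> H"
      by (simp add: B_def inner_diff_left inner_diff_right n_def inner_commute power2_eq_square algebra_simps)
    then have "H \<bullet> H = (mu (s *\<^sub>R d))\<^sup>2 * n - 2 * mu (s *\<^sub>R d) * (B \<bullet> \<Psi> s) + B \<bullet> B"
      unfolding HPsi BPsi by (simp add: power2_eq_square algebra_simps)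
    \<comment> \<open>Pythagoras: the squared residual minus the squared defect, before normalisation\<close>
    then have HH: "H \<bullet> H * n - (H \<bullet> \<Psi> s)\<^sup>2 = (B \<bullet> B - e\<^sup>2 * n) * n"
      unfolding HPsi BPsi by algebra
    have "R' = D / n + (2 * \<kappa> / s) * ((H \<bullet> H * n - (H \<bullet> \<Psi> s)\<^sup>2) / (n * n))"
    proof -
      have "((D + c * h) * n - p * (c * p)) / (n * n) = D / n + c * ((h * n - p\<^sup>2) / (n * n))" for c h p :: real
        using n by (simp add: divide_simps) algebra
      then show ?thesis unfolding R'_def .
    qed
    also have "\<dots> = D / n + (2 * \<kappa> / s) * ((B \<bullet> B) / n - e\<^sup>2)"
    proof -
      have "(b - e\<^sup>2 * n) * n / (n * n) = b / n - e\<^sup>2" for b using n by (simp add: field_simps)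
      then show ?thesis unfolding HH by simp
    qed
    finally have R'eq: "R' = D / n + (2 * \<kappa> / s) * ((B \<bullet> B) / n - e\<^sup>2)" .
    have "norm d * n \<le> M * n" using M n by (intro mult_right_mono) auto
    then have "\<bar>D\<bar> \<le> M * n"
      using diag_bound[of d "\<Psi> s"] unfolding D_def n_def power2_norm_eq_inner by linarith
    then have Dn: "D / n \<ge> - M" using n by (simp add: field_simps abs_le_iff)
    have "(B \<bullet> B) / n \<ge> g * e" using BB n by (simp add: BPsi field_simps)
    moreover have "e\<^sup>2 \<le> g * e / 2" using e by (simp add: power2_eq_square)
    ultimately have q: "(B \<bullet> B) / n - e\<^sup>2 \<ge> g * e / 2" by linarith
    have "2 * \<kappa> \<le> 2 * \<kappa> / s" using s \<kappa> by (simp add: field_simps)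
    then have "2 * \<kappa> * (g * e / 2) \<le> (2 * \<kappa> / s) * ((B \<bullet> B) / n - e\<^sup>2)"
      using q g e \<kappa> s by (intro mult_mono) auto
    then have "R' > M" using R'eq Dn \<kappa>(2) by (simp add: mult_ac)
    then have "((\<lambda>t. R t - M * t) has_real_derivative R' - M) (at s)" "R' - M > 0"
      using dR by (auto intro!: derivative_eq_intros)
    from DERIV_pos_inc_right[OF this]
    obtain \<delta> where \<delta>: "\<delta> > 0" "\<And>h. h > 0 \<Longrightarrow> h < \<delta> \<Longrightarrow> R s - M * s < R (s + h) - M * (s + h)" by auto
    show "\<exists>\<delta>>0. \<forall>t. s < t \<longrightarrow> t < s + \<delta> \<longrightarrow> a t \<le> e"
    proof (intro exI[of _ \<delta>] conjI allI impI \<delta>)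
      fix t assume st: "s < t" "t < s + \<delta>"
      then have "R s - M * s < R t - M * t" using \<delta>(2)[of "t - s"] by simp
      moreover have "mu (t *\<^sub>R d) \<le> mu (s *\<^sub>R d) + M * (t - s)"
      proof -
        have "norm (t *\<^sub>R d - s *\<^sub>R d) = (t - s) * norm d"
          using st by (simp add: scaleR_left_diff_distrib[symmetric])
        also have "\<dots> \<le> (t - s) * M" using st M by (intro mult_left_mono) auto
        finally show ?thesis using mu_lipschitz[of "t *\<^sub>R d" "s *\<^sub>R d"] by (simp add: mult.commute)
      qed
      ultimately show "a t \<le> e" using as by (simp add: a_def algebra_simps)
    qed
  qed
  then show ?thesis by (simp add: a_def R_def)
qed

text \<open>The sum of the components never vanishes, as \<open>\<Psi>\<close> stays close to the line of a positive vector; being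
positive at \<open>0\<close> it stays positive.\<close>

proposition radial_asymptotics:
  assumes "M \<ge> 0" "\<epsilon> > 0"
  shows "\<exists>\<kappa>0>0. \<forall>\<kappa>\<ge>\<kappa>0. \<forall>d l \<Psi>. norm d \<le> M \<longrightarrow> norm l \<le> M \<longrightarrow> radial_solution \<kappa> d \<Psi> \<longrightarrow>
    (\<forall>t\<in>{0..1}. mass (\<Psi> t) > 0 \<and>
      \<bar>wmean l (\<Psi> t) - wmean l (perron (t *\<^sub>R d))\<bar> \<le> \<epsilon>)"
proof -
  define c where "c = sqrt CARD('n)"
  have c: "c \<ge> 1" by (simp add: c_def Suc_leI)
  obtain g where g: "g > 0" and gap: "\<And>d v. norm d \<le> M \<Longrightarrow> v \<bullet> perron d = 0 \<Longrightarrow> g * (norm v)\<^sup>2 \<le> mu d * (norm v)\<^sup>2 - ham d v \<bullet> v"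
    using spectral_gap_compact[of M] by blast
  define \<delta> where "\<delta> = min (1 / (4 * c)) (\<epsilon> / (4 * c * (M + 1)))"
  have \<delta>: "\<delta> > 0" using c assms by (simp add: \<delta>_def)
  have \<delta>c: "c * \<delta> \<le> 1/4"
    using mult_left_mono[of \<delta> "1 / (4 * c)" c] c by (simp add: \<delta>_def)
  have \<delta>e: "4 * c * \<delta> * M \<le> \<epsilon>"
  proof -
    have "4 * c * \<delta> * M \<le> 4 * c * (\<epsilon> / (4 * c * (M + 1))) * (M + 1)"
      using c assms \<delta> by (intro mult_mono) (auto simp: \<delta>_def)
    also have "4 * c * (M + 1) \<noteq> 0" using c assms by simp
    then have "4 * c * (\<epsilon> / (4 * c * (M + 1))) * (M + 1) = \<epsilon>" by simp
    finally show ?thesis .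
  qed
  define e where "e = min (g / 2) (g * \<delta>\<^sup>2)"
  have e: "0 < e" "e \<le> g / 2" "e \<le> g * \<delta>\<^sup>2" using g \<delta> by (auto simp: e_def)
  \<comment> \<open>makes kappa * g * e exceed 2 * M, as the trapping argument requires\<close>
  define \<kappa>0 where "\<kappa>0 = (2 * M + 1) / (g * e)"
  show ?thesis
  proof (intro exI[of _ \<kappa>0] conjI allI impI ballI)
    show "\<kappa>0 > 0" using assms g e by (simp add: \<kappa>0_def)
    fix \<kappa> t :: real and d l :: "real^'n" and \<Psi>
    assume \<kappa>: "\<kappa>0 \<le> \<kappa>" and d: "norm d \<le> M" and l: "norm l \<le> M" and sol: "radial_solution \<kappa> d \<Psi>"
      and t: "t \<in> {0..1}"
    have \<kappa>_pos: "\<kappa> > 0" using \<kappa> \<open>\<kappa>0 > 0\<close> by simp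
    have "2 * M + 1 \<le> \<kappa> * (g * e)" using \<kappa> g e by (simp add: \<kappa>0_def divide_le_eq)
    then have \<kappa>ge: "\<kappa> * g * e > 2 * M" by (simp add: mult.assoc)
    have near: "norm (\<Psi> s - (\<Psi> s \<bullet> perron (s *\<^sub>R d)) *\<^sub>R perron (s *\<^sub>R d)) \<le> \<delta> * norm (\<Psi> s)" (is "norm ?u \<le> _")
      if s: "s \<in> {0..1}" for s
    proof -
      have sd: "norm (s *\<^sub>R d) \<le> M" using s d by (simp add: order_trans[OF mult_left_le_one_le])
      have n: "\<Psi> s \<bullet> \<Psi> s > 0" using radial_solution_nonzero[OF sol s] \<kappa>_pos by simp
      have "mu (s *\<^sub>R d) - (ham (s *\<^sub>R d) (\<Psi> s) \<bullet> \<Psi> s) / (\<Psi> s \<bullet> \<Psi> s) \<le> e"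
        by (rule rayleigh_defect_small[OF gap g e(1,2) \<kappa>_pos \<kappa>ge d sol s])
      then have "mu (s *\<^sub>R d) * (\<Psi> s \<bullet> \<Psi> s) - ham (s *\<^sub>R d) (\<Psi> s) \<bullet> \<Psi> s \<le> e * (\<Psi> s \<bullet> \<Psi> s)"
        using n by (simp add: field_simps)
      then have "g * (norm ?u)\<^sup>2 \<le> e * (\<Psi> s \<bullet> \<Psi> s)"
        using orthogonal_part(1)[OF gap[OF sd] g, of "\<Psi> s"] by (simp add: inner_diff_left)
      also have "\<dots> \<le> (g * \<delta>\<^sup>2) * (\<Psi> s \<bullet> \<Psi> s)" using e by (intro mult_right_mono) auto
      also have "\<dots> = g * (\<delta> * norm (\<Psi> s))\<^sup>2" unfolding power_mult_distrib power2_norm_eq_inner by (simp only: mult.assoc)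
      finally have "(norm ?u)\<^sup>2 \<le> (\<delta> * norm (\<Psi> s))\<^sup>2" by (simp only: mult_le_cancel_left_pos[OF g])
      then show ?thesis by (rule power2_le_imp_le) (use \<delta> in simp)
    qed
    have nz: "mass (\<Psi> s) \<noteq> 0" if "s \<in> {0..1}" for s
      using ratio_near_direction(1)[OF perron(1,2) _ near[OF that]] radial_solution_nonzero[OF sol that] \<kappa>_pos \<delta>c
      by (simp add: c_def)
    show "mass (\<Psi> t) > 0"
    proof (rule ccontr)
      assume "\<not> mass (\<Psi> t) > 0"
      moreover have "mass (\<Psi> 0) \<ge> 0" using sol by (simp add: radial_solution_def)
      moreover have "continuous_on {0..t} (\<lambda>s. \<Sum>i\<in>UNIV. \<Psi> s $ i)"
        using sol t unfolding radial_solution_def by (intro continuous_intros) (auto elim: continuous_on_subset)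
      ultimately obtain s where "0 \<le> s" "s \<le> t" "mass (\<Psi> s) = 0"
        using IVT2'[of "\<lambda>s. \<Sum>i\<in>UNIV. \<Psi> s $ i" t 0 0] t by auto
      with nz[of s] t show False by auto
    qed
    have "\<bar>wmean l (\<Psi> t) - wmean l (perron (t *\<^sub>R d))\<bar> \<le> 4 * c * \<delta> * norm l"
      using ratio_near_direction(2)[OF perron(1,2) _ near[OF t]] radial_solution_nonzero[OF sol t] \<kappa>_pos \<delta>c
      by (simp add: c_def)
    also have "\<dots> \<le> 4 * c * \<delta> * M" using l c \<delta> by (intro mult_left_mono) auto
    finally show "\<bar>wmean l (\<Psi> t) - wmean l (perron (t *\<^sub>R d))\<bar> \<le> \<epsilon>" using \<delta>e by simp
  qed
qed

text \<open>The Laplacian is symmetric and annihilates constants, so it drops out of the derivative of the total mass.\<close>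

lemma sum_lap: "mass (lap v) = 0"
proof -
  have "mass (lap v) = lap v \<bullet> (\<chi> i. 1)" by (simp add: inner_vec_def)
  also have "\<dots> = 0" by (simp add: lap_sym lap_one)
  finally show ?thesis .
qed

lemma perron_average_bound:
  "\<bar>wmean l (perron d)\<bar> \<le> norm l"
proof -
  have pos: "perron d $ i > 0" for i by (rule perron(2))
  then have s: "mass (perron d) > 0" by (intro sum_pos) auto
  have "\<bar>\<Sum>i\<in>UNIV. l $ i * perron d $ i\<bar> \<le> (\<Sum>i\<in>UNIV. \<bar>l $ i * perron d $ i\<bar>)" by (rule sum_abs)
  also have "\<dots> \<le> (\<Sum>i\<in>UNIV. norm l * perron d $ i)"
    using pos by (intro sum_mono) (auto simp: abs_mult component_le_norm_cart less_imp_le intro!: mult_mono)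
  also have "\<dots> = norm l * mass (perron d)" by (simp add: sum_distrib_left)
  finally show ?thesis using s by (simp add: divide_le_eq)
qed

lemma log_mass_derivative:
  assumes sol: "radial_solution \<kappa> d \<Psi>" and \<kappa>: "\<kappa> > 0" and t: "t > 0" and c: "c > 0"
    and pos: "mass (\<Psi> t) > 0"
  shows "((\<lambda>t. ln (mass (\<Psi> t) / c) / \<kappa>) has_real_derivative wmean d (\<Psi> t)) (at t)"
proof -
  have "((\<lambda>t. \<Sum>i\<in>UNIV. \<Psi> t $ i) has_real_derivative mass ((\<kappa> / t) *\<^sub>R ham (t *\<^sub>R d) (\<Psi> t))) (at t)"
  proof (rule DERIV_sum)
    fix i
    from bounded_linear.has_vector_derivative[OF bounded_linear_vec_nth radial_solutionD[OF sol t]]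
    show "((\<lambda>t. \<Psi> t $ i) has_real_derivative ((\<kappa> / t) *\<^sub>R ham (t *\<^sub>R d) (\<Psi> t)) $ i) (at t)"
      by (simp only: has_real_derivative_iff_has_vector_derivative)
  qed
  also have "mass ((\<kappa> / t) *\<^sub>R ham (t *\<^sub>R d) (\<Psi> t)) = \<kappa> * (\<Sum>i\<in>UNIV. d $ i * \<Psi> t $ i)"
  proof -
    have "mass (ham (t *\<^sub>R d) (\<Psi> t)) = t * (\<Sum>i\<in>UNIV. d $ i * \<Psi> t $ i)"
      using sum_lap[of "\<Psi> t"] by (simp add: ham_def sum_subtractf sum_distrib_left mult.assoc)
    moreover have "mass ((\<kappa> / t) *\<^sub>R v) = (\<kappa> / t) * mass v" for v :: "real^'n"
      by (simp only: vector_scaleR_component real_scaleR_def sum_distrib_left)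
    ultimately show ?thesis using t by simp
  qed
  finally have D: "((\<lambda>t. \<Sum>i\<in>UNIV. \<Psi> t $ i) has_real_derivative \<kappa> * (\<Sum>i\<in>UNIV. d $ i * \<Psi> t $ i)) (at t)" .
  have p: "mass (\<Psi> t) / c > 0" using pos c by simp
  show ?thesis
    by (rule DERIV_cong[OF DERIV_cdivide[OF DERIV_chain2[OF DERIV_ln_divide[OF p] DERIV_cdivide[OF D]]]])
      (use \<kappa> c pos in \<open>simp add: field_simps\<close>)
qed

lemma continuous_log_mass:
  assumes sol: "radial_solution \<kappa> d \<Psi>" and c: "c > 0"
    and pos: "\<And>t. t \<in> {0..1} \<Longrightarrow> mass (\<Psi> t) > 0"
  shows "continuous_on {0..1} (\<lambda>t. ln (mass (\<Psi> t) / c) / \<kappa>)"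
proof -
  have "continuous_on {0..1} \<Psi>" using sol by (simp add: radial_solution_def)
  then have A: "continuous_on {0..1} (\<lambda>t. \<Sum>i\<in>UNIV. \<Psi> t $ i)" by (intro continuous_intros)
  show ?thesis unfolding divide_inverse
  proof (intro continuous_on_mult continuous_on_ln continuous_on_const A ballI)
    fix t :: real assume "t \<in> {0..1}"
    then show "mass (\<Psi> t) * inverse c \<noteq> 0" using pos[of t] c by simp
  qed
qed

lemma log_mass_zero: "radial_solution \<kappa> d \<Psi> \<Longrightarrow> ln (mass (\<Psi> 0) / c) / \<kappa> = ln (CARD('n) / c) / \<kappa>"
  by (simp add: radial_solution_def)

lemma mean_value_bound:
  fixes h h' :: "real \<Rightarrow> real"
  assumes "continuous_on {0..1} h" "\<And>t. 0 < t \<Longrightarrow> t < 1 \<Longrightarrow> (h has_real_derivative h' t) (at t)"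
    and "\<And>t. 0 < t \<Longrightarrow> t < 1 \<Longrightarrow> \<bar>h' t\<bar> \<le> B"
  shows "\<bar>h 1 - h 0\<bar> \<le> B"
proof -
  obtain z where "0 < z" "z < 1" "h 1 - h 0 = (1 - 0) * h' z"
  proof -
    have "\<exists>l z. 0 < z \<and> z < 1 \<and> (h has_real_derivative l) (at z) \<and> h 1 - h 0 = (1 - 0) * l"
      using assms(1,2) by (intro MVT) (auto simp: real_differentiable_def)
    then show ?thesis using that assms(2) DERIV_unique by blast
  qed
  then show ?thesis using assms(3) by simp
qed

text \<open>The derivative of \<open>ln (\<Sum>\<^sub>i \<Psi>\<^sub>i) / \<kappa>\<close> is the weighted mean with weights \<open>d\<close>, without singularity at \<open>0\<close>. For two
large parameters these derivatives are uniformly close, and so are the logarithms by the mean value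
theorem; they are bounded by \<open>M + 2\<close>, where the exponential is Lipschitz. The constant \<open>c\<close> only changes
the initial value by \<open>O(1/\<kappa>)\<close>.\<close>

proposition radial_growth_cauchy:
  assumes "M \<ge> 0" "\<epsilon> > 0" "c > 0"
  shows "\<exists>\<kappa>0>0. \<forall>\<kappa>\<ge>\<kappa>0. \<forall>\<kappa>'\<ge>\<kappa>0. \<forall>d \<Psi> \<Psi>'. norm d \<le> M \<longrightarrow> radial_solution \<kappa> d \<Psi> \<longrightarrow> radial_solution \<kappa>' d \<Psi>' \<longrightarrow>
    \<bar>(mass (\<Psi> 1) / c) powr (1 / \<kappa>) - (mass (\<Psi>' 1) / c) powr (1 / \<kappa>')\<bar> \<le> \<epsilon>"
proof -
  define \<eta> where "\<eta> = min 1 (\<epsilon> / (4 * exp (M + 2)))"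
  have \<eta>: "0 < \<eta>" "\<eta> \<le> 1" using assms by (simp_all add: \<eta>_def)
  have \<eta>e: "exp (M + 2) * (4 * \<eta>) \<le> \<epsilon>"
  proof -
    have "\<eta> \<le> \<epsilon> / (4 * exp (M + 2))" by (simp add: \<eta>_def)
    then show ?thesis by (simp add: field_simps)
  qed
  obtain \<kappa>1 where \<kappa>1: "\<kappa>1 > 0" and asym: "\<And>\<kappa> d l \<Psi> t. \<kappa>1 \<le> \<kappa> \<Longrightarrow> norm d \<le> M \<Longrightarrow> norm l \<le> M \<Longrightarrow> radial_solution \<kappa> d \<Psi> \<Longrightarrow> t \<in> {0..1} \<Longrightarrow>
      mass (\<Psi> t) > 0 \<and>
      \<bar>wmean l (\<Psi> t) - wmean l (perron (t *\<^sub>R d))\<bar> \<le> \<eta>"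
    using radial_asymptotics[OF assms(1) \<eta>(1)] by blast
  define C where "C = \<bar>ln (CARD('n) / c)\<bar>"
  define \<kappa>0 where "\<kappa>0 = max \<kappa>1 (C / \<eta>)"
  have C: "C / \<kappa> \<le> \<eta>" if "\<kappa> \<ge> \<kappa>0" for \<kappa>
  proof -
    have "\<kappa> > 0" using that \<kappa>1 by (simp add: \<kappa>0_def)
    moreover have "C / \<eta> \<le> \<kappa>" using that by (simp add: \<kappa>0_def)
    ultimately show ?thesis using \<eta> by (simp add: field_simps)
  qed
  define G :: "real \<Rightarrow> (real \<Rightarrow> real^'n) \<Rightarrow> real \<Rightarrow> real"
    where "G = (\<lambda>\<kappa> \<Psi> t. ln (mass (\<Psi> t) / c) / \<kappa>)"
  define \<rho> :: "real^'n \<Rightarrow> (real \<Rightarrow> real^'n) \<Rightarrow> real \<Rightarrow> real"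
    where "\<rho> = (\<lambda>d \<Psi> t. wmean d (\<Psi> t))"
  have G0: "\<bar>G \<kappa> \<Psi> 0\<bar> \<le> \<eta>" if "\<kappa> \<ge> \<kappa>0" "radial_solution \<kappa> d \<Psi>" for \<kappa> d \<Psi>
  proof -
    have "\<kappa> > 0" using that \<kappa>1 by (simp add: \<kappa>0_def)
    then show ?thesis using C[OF that(1)] log_mass_zero[OF that(2), of c] by (simp add: G_def C_def abs_divide)
  qed
  have Gd: "(G \<kappa> \<Psi> has_real_derivative \<rho> d \<Psi> t) (at t)" and Gc: "continuous_on {0..1} (G \<kappa> \<Psi>)" and pos: "mass (\<Psi> 1) > 0"
    and near: "\<bar>\<rho> d \<Psi> t - \<rho> d (\<lambda>t. perron (t *\<^sub>R d)) t\<bar> \<le> \<eta>"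
    if "\<kappa> \<ge> \<kappa>0" "radial_solution \<kappa> d \<Psi>" "norm d \<le> M" "0 < t" "t < 1" for \<kappa> d \<Psi> t
  proof -
    have \<kappa>: "\<kappa> > 0" "\<kappa> \<ge> \<kappa>1" using that \<kappa>1 by (simp_all add: \<kappa>0_def)
    note a = asym[OF \<kappa>(2) that(3) that(3) that(2)]
    show "(G \<kappa> \<Psi> has_real_derivative \<rho> d \<Psi> t) (at t)"
      unfolding G_def \<rho>_def using that a[of t] by (intro log_mass_derivative[OF that(2) \<kappa>(1) that(4) assms(3)]) auto
    show "continuous_on {0..1} (G \<kappa> \<Psi>)"
      unfolding G_def using a by (intro continuous_log_mass[OF that(2) assms(3)]) auto
    show "mass (\<Psi> 1) > 0" using a[of 1] by simp
    show "\<bar>\<rho> d \<Psi> t - \<rho> d (\<lambda>t. perron (t *\<^sub>R d)) t\<bar> \<le> \<eta>"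
      unfolding \<rho>_def using a[of t] that by simp
  qed
  have G1: "G \<kappa> \<Psi> 1 \<le> M + 2" if *: "\<kappa> \<ge> \<kappa>0" "radial_solution \<kappa> d \<Psi>" "norm d \<le> M" for \<kappa> d \<Psi>
  proof -
    have "\<bar>G \<kappa> \<Psi> 1 - G \<kappa> \<Psi> 0\<bar> \<le> M + 1"
    proof (rule mean_value_bound)
      show "continuous_on {0..1} (G \<kappa> \<Psi>)" using Gc[OF *, of "1/2"] by simp
      fix t :: real assume t: "0 < t" "t < 1"
      show "(G \<kappa> \<Psi> has_real_derivative \<rho> d \<Psi> t) (at t)" by (rule Gd[OF * t])
      have "\<bar>\<rho> d (\<lambda>t. perron (t *\<^sub>R d)) t\<bar> \<le> norm d" unfolding \<rho>_def by (rule perron_average_bound)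
      then show "\<bar>\<rho> d \<Psi> t\<bar> \<le> M + 1" using near[OF * t] \<eta> * by linarith
    qed
    then show ?thesis using G0[OF *(1,2)] \<eta> by linarith
  qed
  show ?thesis
  proof (intro exI[of _ \<kappa>0] conjI allI impI)
    show "\<kappa>0 > 0" using \<kappa>1 by (simp add: \<kappa>0_def)
    fix \<kappa> \<kappa>' :: real and d and \<Psi> \<Psi>' :: "real \<Rightarrow> real^'n"
    assume k: "\<kappa>0 \<le> \<kappa>" "\<kappa>0 \<le> \<kappa>'" and d: "norm d \<le> M" and sol: "radial_solution \<kappa> d \<Psi>" "radial_solution \<kappa>' d \<Psi>'"
    note s1 = k(1) sol(1) d and s2 = k(2) sol(2) d
    define H where "H = (\<lambda>t. G \<kappa> \<Psi> t - G \<kappa>' \<Psi>' t)"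
    have "\<bar>H 1 - H 0\<bar> \<le> 2 * \<eta>"
    proof (rule mean_value_bound)
      show "continuous_on {0..1} H" unfolding H_def
        using Gc[OF s1, of "1/2"] Gc[OF s2, of "1/2"] by (intro continuous_intros) auto
      fix t :: real assume t: "0 < t" "t < 1"
      show "(H has_real_derivative \<rho> d \<Psi> t - \<rho> d \<Psi>' t) (at t)"
        unfolding H_def by (rule DERIV_diff[OF Gd[OF s1 t] Gd[OF s2 t]])
      show "\<bar>\<rho> d \<Psi> t - \<rho> d \<Psi>' t\<bar> \<le> 2 * \<eta>" using near[OF s1 t] near[OF s2 t] by linarith
    qed
    moreover have "\<bar>H 0\<bar> \<le> 2 * \<eta>" using G0[OF s1(1,2)] G0[OF s2(1,2)] unfolding H_def by linarith
    ultimately have H1: "\<bar>G \<kappa> \<Psi> 1 - G \<kappa>' \<Psi>' 1\<bar> \<le> 4 * \<eta>" unfolding H_def by linarith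
    have powr_eq: "(mass (\<Phi> 1) / c) powr (1 / r) = exp (G r \<Phi> 1)" if "mass (\<Phi> 1) > 0" for \<Phi> r
      using that assms(3) by (simp add: G_def powr_def)
    have exp_lip: "\<bar>exp a - exp b\<bar> \<le> exp (M + 2) * \<bar>a - b\<bar>" if "a \<le> M + 2" "b \<le> M + 2" for a b :: real
    proof -
      have "exp a - exp b \<le> exp (M + 2) * (a - b)" if "b \<le> a" "a \<le> M + 2" for a b :: real
      proof -
        have "exp a - exp b = exp a * (1 - exp (b - a))" by (simp add: algebra_simps mult_exp_exp)
        also have "\<dots> \<le> exp a * (a - b)" proof (rule mult_left_mono)
          show "1 - exp (b - a) \<le> a - b" using exp_ge_add_one_self[of "b - a"] by linarith
        qed simp
        also have "\<dots> \<le> exp (M + 2) * (a - b)" using that by (intro mult_right_mono) auto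
        finally show ?thesis .
      qed
      from this[of a b] this[of b a] that show ?thesis by (cases "a \<le> b") (auto simp: abs_if)
    qed
    have "\<bar>exp (G \<kappa> \<Psi> 1) - exp (G \<kappa>' \<Psi>' 1)\<bar> \<le> exp (M + 2) * \<bar>G \<kappa> \<Psi> 1 - G \<kappa>' \<Psi>' 1\<bar>"
      by (rule exp_lip[OF G1[OF s1] G1[OF s2]])
    also have "\<dots> \<le> exp (M + 2) * (4 * \<eta>)" using H1 by (intro mult_left_mono) auto
    finally show "\<bar>(mass (\<Psi> 1) / c) powr (1 / \<kappa>) - (mass (\<Psi>' 1) / c) powr (1 / \<kappa>')\<bar> \<le> \<epsilon>"
      using \<eta>e powr_eq[of \<Psi> \<kappa>] powr_eq[of \<Psi>' \<kappa>'] pos[OF s1, of "1/2"] pos[OF s2, of "1/2"] by simp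
  qed
qed

end

lemma uniform_limit_at_top_Cauchy:
  fixes f :: "real \<Rightarrow> 'a \<Rightarrow> real"
  assumes "\<And>e. e > 0 \<Longrightarrow> \<exists>\<kappa>0. \<forall>\<kappa>\<ge>\<kappa>0. \<forall>\<kappa>'\<ge>\<kappa>0. \<forall>z\<in>S. \<bar>f \<kappa> z - f \<kappa>' z\<bar> \<le> e"
  shows "uniform_limit S f (\<lambda>z. lim (\<lambda>n. f (real n) z)) at_top"
  unfolding uniform_limit_iff
proof (intro allI impI)
  fix e :: real assume e: "e > 0"
  obtain \<kappa>0 where \<kappa>0: "\<And>\<kappa> \<kappa>' z. \<kappa> \<ge> \<kappa>0 \<Longrightarrow> \<kappa>' \<ge> \<kappa>0 \<Longrightarrow> z \<in> S \<Longrightarrow> \<bar>f \<kappa> z - f \<kappa>' z\<bar> \<le> e / 2"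
    using assms[of "e / 2"] e by auto
  have "dist (f \<kappa> z) (lim (\<lambda>n. f (real n) z)) < e" if \<kappa>: "\<kappa> \<ge> \<kappa>0" and z: "z \<in> S" for \<kappa> z
  proof -
    have "Cauchy (\<lambda>n. f (real n) z)"
    proof (rule metric_CauchyI)
      fix r :: real assume "r > 0"
      then obtain \<kappa>1 where \<kappa>1: "\<And>\<kappa> \<kappa>'. \<kappa> \<ge> \<kappa>1 \<Longrightarrow> \<kappa>' \<ge> \<kappa>1 \<Longrightarrow> \<bar>f \<kappa> z - f \<kappa>' z\<bar> \<le> r / 2"
        using assms[of "r / 2"] z by auto
      show "\<exists>M. \<forall>m\<ge>M. \<forall>n\<ge>M. dist (f (real m) z) (f (real n) z) < r"
      proof (intro exI[of _ "nat \<lceil>\<kappa>1\<rceil>"] allI impI)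
        fix m n assume "nat \<lceil>\<kappa>1\<rceil> \<le> m" "nat \<lceil>\<kappa>1\<rceil> \<le> n"
        then have "\<kappa>1 \<le> real m" "\<kappa>1 \<le> real n" by linarith+
        from \<kappa>1[OF this] show "dist (f (real m) z) (f (real n) z) < r" using \<open>r > 0\<close> by (simp add: dist_real_def)
      qed
    qed
    then have l: "(\<lambda>n. f (real n) z) \<longlonglongrightarrow> lim (\<lambda>n. f (real n) z)"
      by (simp add: Cauchy_convergent_iff convergent_LIMSEQ_iff)
    have "(\<lambda>n. \<bar>f \<kappa> z - f (real n) z\<bar>) \<longlonglongrightarrow> \<bar>f \<kappa> z - lim (\<lambda>n. f (real n) z)\<bar>"
      by (intro tendsto_intros l)
    moreover have "eventually (\<lambda>n. \<bar>f \<kappa> z - f (real n) z\<bar> \<le> e / 2) sequentially"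
      unfolding eventually_sequentially
    proof (intro exI[of _ "nat \<lceil>\<kappa>0\<rceil>"] allI impI)
      fix n assume "nat \<lceil>\<kappa>0\<rceil> \<le> n"
      then have "\<kappa>0 \<le> real n" by linarith
      then show "\<bar>f \<kappa> z - f (real n) z\<bar> \<le> e / 2" using \<kappa>0 \<kappa> z by simp
    qed
    ultimately have "\<bar>f \<kappa> z - lim (\<lambda>n. f (real n) z)\<bar> \<le> e / 2"
      by (rule tendsto_upperbound) simp
    then show ?thesis using e by (simp add: dist_real_def)
  qed
  then show "\<forall>\<^sub>F \<kappa> in at_top. \<forall>z\<in>S. dist (f \<kappa> z) (lim (\<lambda>n. f (real n) z)) < e"
    unfolding eventually_at_top_linorder by blast
qed

section \<open>Entire double power series\<close>

lemma real_summable_abs: "(f summable_on A) \<longleftrightarrow> (\<lambda>x. \<bar>f x :: real\<bar>) summable_on A"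
  using summable_on_iff_abs_summable_on_real[of f A] by simp

lemma real_summable_comparison:
  fixes f g :: "'a \<Rightarrow> real"
  assumes "g summable_on A" "\<And>x. x \<in> A \<Longrightarrow> \<bar>f x\<bar> \<le> g x"
  shows "f summable_on A"
  using Infinite_Sum.abs_summable_on_comparison_test'[of g A f, OF assms(1)] assms(2) unfolding real_norm_def real_summable_abs[of f] .

text \<open>At the corner point at distance \<open>r/2\<close> in both coordinates the series converges absolutely, which bounds the sum
of all terms of degree at least two by a multiple of the squared distance.\<close>

lemma expansion_has_derivative:
  fixes f :: "real^2 \<Rightarrow> real" and c :: "nat \<times> nat \<Rightarrow> real"
  assumes r: "r > 0" and sum: "\<And>x. x \<in> ball a r \<Longrightarrow>
     ((\<lambda>(m, n). c (m, n) * (x $ 1 - a $ 1) ^ m * (x $ 2 - a $ 2) ^ n) has_sum f x) UNIV"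
  shows "(f has_derivative (\<lambda>h. c (1,0) * h $ 1 + c (0,1) * h $ 2)) (at a)"
proof -
  define \<rho> where "\<rho> = r / 2"
  have \<rho>: "\<rho> > 0" using r by (simp add: \<rho>_def)
  define x where "x = a + (\<chi> i. \<rho>)"
  have "norm (\<chi> i::2. \<rho>) = sqrt 2 * \<rho>" using \<rho> by (simp add: norm_eq_sqrt_inner inner_vec_def sum_2 real_sqrt_mult power2_eq_square[symmetric])
  moreover have "sqrt 2 * \<rho> < 2 * \<rho>" using \<rho> sqrt2_less_2 by simp
  ultimately have "x \<in> ball a r" by (simp add: x_def dist_norm \<rho>_def)
  from sum[OF this] have "(\<lambda>(m, n). c (m, n) * \<rho> ^ m * \<rho> ^ n) summable_on UNIV"
    by (auto simp: x_def summable_on_def)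
  then have sm: "(\<lambda>(m, n). \<bar>c (m, n)\<bar> * \<rho> ^ m * \<rho> ^ n) summable_on UNIV"
    using \<rho> by (subst (asm) real_summable_abs) (simp add: case_prod_unfold abs_mult)
  define S where "S = (\<Sum>\<^sub>\<infinity>(m, n). \<bar>c (m, n)\<bar> * \<rho> ^ m * \<rho> ^ n)"
  have hS: "((\<lambda>(m, n). \<bar>c (m, n)\<bar> * \<rho> ^ m * \<rho> ^ n) has_sum S) UNIV"
    unfolding S_def using sm by (rule has_sum_infsum)
  have fa: "f a = c (0,0)"
  proof -
    have "((\<lambda>(m, n). c (m, n) * 0 ^ m * 0 ^ n) has_sum f a) UNIV" using sum[of a] r by simp
    moreover have "((\<lambda>(m, n). c (m, n) * 0 ^ m * 0 ^ n) has_sum c (0,0)) {(0,0)}"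
      by (rule has_sum_finiteI) auto
    then have "((\<lambda>(m, n). c (m, n) * 0 ^ m * 0 ^ n) has_sum c (0,0)) UNIV"
      by (subst has_sum_cong_neutral[where T = "{(0,0)}" and g = "(\<lambda>(m, n). c (m, n) * 0 ^ m * 0 ^ n)"])
         (auto simp: power_0_left split: if_splits)
    ultimately show ?thesis by (rule has_sum_unique)
  qed
  show ?thesis
  proof (rule has_derivativeI_sandwich[where H = "\<lambda>y. S / \<rho>\<^sup>2 * norm (y - a)" and e = \<rho>])
    show "\<rho> > 0" by fact
    show "bounded_linear (\<lambda>h::real^2. c (1,0) * h $ 1 + c (0,1) * h $ 2)"
      by (intro bounded_linear_add bounded_linear_const_mult bounded_linear_vec_nth)
    have "((\<lambda>y. S / \<rho>\<^sup>2 * norm (y - a)) \<longlongrightarrow> S / \<rho>\<^sup>2 * norm (a - a)) (at a)"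
      by (intro tendsto_intros)
    then show "((\<lambda>y. S / \<rho>\<^sup>2 * norm (y - a)) \<longlongrightarrow> 0) (at a)" by simp
    fix y assume ya: "y \<noteq> a" and d: "dist y a < \<rho>"
    define h where "h = y - a"
    define \<eta> where "\<eta> = norm h"
    have \<eta>: "0 < \<eta>" "\<eta> < \<rho>" using ya d by (auto simp: \<eta>_def h_def dist_norm)
    have hi: "\<bar>h $ i\<bar> \<le> \<eta>" for i by (simp add: \<eta>_def component_le_norm_cart)
    have yb: "y \<in> ball a r" using d \<rho> by (simp add: dist_commute \<rho>_def)
    define T where "T = (\<lambda>(m, n). c (m, n) * h $ 1 ^ m * h $ 2 ^ n)"
    have T: "(T has_sum f y) UNIV" using sum[OF yb] by (simp add: T_def h_def)
    define A :: "(nat \<times> nat) set" where "A = {(0,0), (1,0), (0,1)}"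
    have "(T has_sum (\<Sum>p\<in>A. T p)) A" by (rule has_sum_finite) (simp add: A_def)
    from has_sum_Diff[OF T this] have "(T has_sum (f y - (\<Sum>p\<in>A. T p))) (UNIV - A)" by simp
    moreover have "(\<Sum>p\<in>A. T p) = f a + (c (1,0) * h $ 1 + c (0,1) * h $ 2)"
      by (simp add: A_def T_def fa)
    ultimately have R: "(T has_sum (f y - f a - (c (1,0) * h $ 1 + c (0,1) * h $ 2))) (UNIV - A)"
      by (simp add: diff_diff_eq)
    define U where "U = (\<lambda>(m, n). (\<eta> / \<rho>)\<^sup>2 * (\<bar>c (m, n)\<bar> * \<rho> ^ m * \<rho> ^ n))"
    have U: "(U has_sum ((\<eta> / \<rho>)\<^sup>2 * S)) UNIV"
      using has_sum_cmult_right[OF hS, of "(\<eta> / \<rho>)\<^sup>2"] by (simp add: U_def case_prod_unfold)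
    have TU: "\<bar>T p\<bar> \<le> U p" if "p \<in> UNIV - A" for p
    proof -
      obtain m n where p: "p = (m, n)" by force
      have mn: "m + n \<ge> 2" proof -
        have "\<not> (m = 0 \<and> n = 0)" "\<not> (m = 1 \<and> n = 0)" "\<not> (m = 0 \<and> n = 1)" using that by (auto simp: p A_def)
        then show ?thesis by linarith
      qed
      have "\<bar>T p\<bar> = \<bar>c (m, n)\<bar> * \<bar>h $ 1\<bar> ^ m * \<bar>h $ 2\<bar> ^ n" by (simp add: T_def p abs_mult power_abs)
      also have "\<dots> \<le> \<bar>c (m, n)\<bar> * \<eta> ^ m * \<eta> ^ n"
        using hi \<eta> by (intro mult_mono power_mono) auto
      also have "\<dots> = (\<eta> / \<rho>) ^ (m + n) * (\<bar>c (m, n)\<bar> * \<rho> ^ m * \<rho> ^ n)"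
        using \<rho> by (simp add: power_add power_divide)
      also have "\<dots> \<le> (\<eta> / \<rho>)\<^sup>2 * (\<bar>c (m, n)\<bar> * \<rho> ^ m * \<rho> ^ n)"
        using \<eta> \<rho> mn by (intro mult_right_mono power_decreasing) auto
      finally show ?thesis by (simp add: U_def p)
    qed
    have "(U summable_on UNIV - A)" using U summable_on_subset[of U UNIV "UNIV - A"] by (auto simp: summable_on_def)
    then obtain s where s: "(U has_sum s) (UNIV - A)" by (auto simp: summable_on_def)
    have "s \<le> (\<eta> / \<rho>)\<^sup>2 * S"
      using s U by (rule has_sum_mono_neutral) (use \<rho> in \<open>auto simp: U_def\<close>)
    moreover have "f y - f a - (c (1,0) * h $ 1 + c (0,1) * h $ 2) \<le> s"
      using R s by (rule has_sum_mono) (use TU in \<open>auto simp: abs_le_iff\<close>)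
    moreover have "- s \<le> f y - f a - (c (1,0) * h $ 1 + c (0,1) * h $ 2)"
      proof (rule has_sum_mono[OF _ R])
      show "((\<lambda>p. - U p) has_sum - s) (UNIV - A)" using s by (simp add: has_sum_uminus)
    qed (use TU in \<open>force simp: abs_le_iff\<close>)
    ultimately have "\<bar>f y - f a - (c (1,0) * h $ 1 + c (0,1) * h $ 2)\<bar> \<le> (\<eta> / \<rho>)\<^sup>2 * S" by simp
    then show "norm (f y - f a - (c (1,0) * (y - a) $ 1 + c (0,1) * (y - a) $ 2)) / norm (y - a) \<le> S / \<rho>\<^sup>2 * norm (y - a)"
      using \<eta> \<rho> by (simp add: h_def[symmetric] \<eta>_def[symmetric] divide_le_eq power2_eq_square field_simps)
  qed
qed

definition entire_coeffs :: "(nat \<Rightarrow> nat \<Rightarrow> real) \<Rightarrow> bool" where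
  "entire_coeffs c \<longleftrightarrow> (\<forall>R>0. (\<lambda>(i, j). \<bar>c i j\<bar> * R ^ (i + j)) summable_on UNIV)"

definition double_series :: "(nat \<Rightarrow> nat \<Rightarrow> real) \<Rightarrow> real^2 \<Rightarrow> real" where
  "double_series c x = (\<Sum>\<^sub>\<infinity>(i, j). c i j * x $ 1 ^ i * x $ 2 ^ j)"

definition partial_coeffs1 :: "(nat \<Rightarrow> nat \<Rightarrow> real) \<Rightarrow> nat \<Rightarrow> nat \<Rightarrow> real" where
  "partial_coeffs1 c i j = (1 + real i) * c (Suc i) j"

definition partial_coeffs2 :: "(nat \<Rightarrow> nat \<Rightarrow> real) \<Rightarrow> nat \<Rightarrow> nat \<Rightarrow> real" where
  "partial_coeffs2 c i j = (1 + real j) * c i (Suc j)"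

lemma entire_summable:
  assumes "entire_coeffs c"
  shows "(\<lambda>(i, j). \<bar>c i j\<bar> * u ^ i * v ^ j) summable_on UNIV"
proof -
  define R where "R = max \<bar>u\<bar> \<bar>v\<bar> + 1"
  have R: "\<bar>u\<bar> \<le> R" "\<bar>v\<bar> \<le> R" "R > 0" by (auto simp: R_def)
  have "(\<lambda>(i, j). \<bar>c i j\<bar> * R ^ (i + j)) summable_on UNIV"
    using assms R by (auto simp: entire_coeffs_def)
  then show ?thesis
  proof (rule real_summable_comparison)
    fix p :: "nat \<times> nat"
    obtain i j where p: "p = (i, j)" by force
    have "\<bar>u\<bar> ^ i * \<bar>v\<bar> ^ j \<le> R ^ i * R ^ j" using R by (intro mult_mono power_mono) auto
    then show "\<bar>case p of (i, j) \<Rightarrow> \<bar>c i j\<bar> * u ^ i * v ^ j\<bar> \<le> (case p of (i, j) \<Rightarrow> \<bar>c i j\<bar> * R ^ (i + j))"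
      by (simp add: p abs_mult power_abs power_add mult.assoc mult_left_mono)
  qed
qed

lemma entire_has_sum:
  assumes "entire_coeffs c"
  shows "((\<lambda>(i, j). c i j * x $ 1 ^ i * x $ 2 ^ j) has_sum double_series c x) UNIV"
proof -
  have "(\<lambda>(i, j). c i j * x $ 1 ^ i * x $ 2 ^ j) summable_on UNIV"
    by (rule real_summable_comparison[OF entire_summable[OF assms, of "\<bar>x $ 1\<bar>" "\<bar>x $ 2\<bar>"]])
       (auto simp: abs_mult power_abs)
  then show ?thesis unfolding double_series_def by (rule has_sum_infsum)
qed

lemma has_sum_Suc1:
  fixes f :: "nat \<times> nat \<Rightarrow> real"
  assumes "\<And>j. f (0, j) = 0"
  shows "((\<lambda>(i, j). f (Suc i, j)) has_sum s) UNIV \<longleftrightarrow> (f has_sum s) UNIV"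
proof -
  have "((\<lambda>(i, j). f (Suc i, j)) has_sum s) UNIV \<longleftrightarrow> (f has_sum s) {p. fst p \<noteq> 0}"
    by (rule has_sum_reindex_bij_witness[where j = "\<lambda>(i, j). (Suc i, j)" and i = "\<lambda>(i, j). (i - 1, j)"]) auto
  also have "\<dots> \<longleftrightarrow> (f has_sum s) UNIV"
    by (rule has_sum_cong_neutral) (auto simp: assms)
  finally show ?thesis .
qed

lemma has_sum_Suc2:
  fixes f :: "nat \<times> nat \<Rightarrow> real"
  assumes "\<And>i. f (i, 0) = 0"
  shows "((\<lambda>(i, j). f (i, Suc j)) has_sum s) UNIV \<longleftrightarrow> (f has_sum s) UNIV"
proof -
  have "((\<lambda>(i, j). f (i, Suc j)) has_sum s) UNIV \<longleftrightarrow> (f has_sum s) {p. snd p \<noteq> 0}"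
    by (rule has_sum_reindex_bij_witness[where j = "\<lambda>(i, j). (i, Suc j)" and i = "\<lambda>(i, j). (i, j - 1)"]) auto
  also have "\<dots> \<longleftrightarrow> (f has_sum s) UNIV"
    by (rule has_sum_cong_neutral) (auto simp: assms)
  finally show ?thesis .
qed

lemma entire_swap: "entire_coeffs (\<lambda>i j. c j i) \<longleftrightarrow> entire_coeffs c"
proof -
  have "((\<lambda>(i, j). \<bar>c j i\<bar> * R ^ (i + j)) summable_on UNIV) \<longleftrightarrow> ((\<lambda>(i, j). \<bar>c i j\<bar> * R ^ (i + j)) summable_on UNIV)" for R
    using summable_on_swap[of "\<lambda>(i, j). \<bar>c j i\<bar> * R ^ (i + j)" UNIV UNIV] by (simp add: add.commute)
  then show ?thesis by (simp add: entire_coeffs_def)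
qed

lemma entire_partial_coeffs1:
  assumes "entire_coeffs c" shows "entire_coeffs (partial_coeffs1 c)"
  unfolding entire_coeffs_def
proof (intro allI impI)
  fix R :: real assume R: "R > 0"
  define f where "f = (\<lambda>(i, j). \<bar>c i j\<bar> * (2 * R) ^ (i + j))"
  have "f summable_on UNIV" using assms R unfolding entire_coeffs_def f_def by (meson mult_pos_pos zero_less_numeral)
  then have "f summable_on range (\<lambda>(i, j). (Suc i, j))" by (rule summable_on_subset) auto
  then have "(f \<circ> (\<lambda>(i, j). (Suc i, j))) summable_on UNIV"
    by (subst (asm) summable_on_reindex) (auto simp: inj_on_def)
  then have "(\<lambda>p. (f \<circ> (\<lambda>(i, j). (Suc i, j))) p * (1 / R)) summable_on UNIV" by (rule summable_on_cmult_left)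
  then show "(\<lambda>(i, j). \<bar>partial_coeffs1 c i j\<bar> * R ^ (i + j)) summable_on UNIV"
  proof (rule real_summable_comparison)
    fix p :: "nat \<times> nat"
    obtain i j where p: "p = (i, j)" by force
    have "1 + real i \<le> 2 ^ Suc i" using of_nat_less_two_power[of "Suc i", where ?'a = real] by (simp add: less_imp_le)
    also have "\<dots> \<le> 2 ^ (Suc i + j)" by (intro power_increasing) auto
    finally have *: "(1 + real i) * (\<bar>c (Suc i) j\<bar> * R ^ (i + j)) \<le> 2 ^ (Suc i + j) * (\<bar>c (Suc i) j\<bar> * R ^ (i + j))"
      using R by (intro mult_right_mono) auto
    show "\<bar>case p of (i, j) \<Rightarrow> \<bar>partial_coeffs1 c i j\<bar> * R ^ (i + j)\<bar> \<le> (f \<circ> (\<lambda>(i, j). (Suc i, j))) p * (1 / R)"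
    proof -
      have "\<bar>partial_coeffs1 c i j * R ^ (i + j)\<bar> = (1 + real i) * (\<bar>c (Suc i) j\<bar> * R ^ (i + j))"
        using R by (simp add: partial_coeffs1_def abs_mult)
      moreover have "2 ^ (Suc i + j) * (\<bar>c (Suc i) j\<bar> * R ^ (i + j)) = \<bar>c (Suc i) j\<bar> * (2 * R) ^ (Suc i + j) * (1 / R)"
        using R by (simp add: power_mult_distrib)
      ultimately show ?thesis using * unfolding p f_def by simp
    qed
  qed
qed

lemma partial_coeffs2_swap: "partial_coeffs2 c = (\<lambda>i j. partial_coeffs1 (\<lambda>i j. c j i) j i)"
  by (simp add: partial_coeffs1_def partial_coeffs2_def fun_eq_iff)

lemma entire_partial_coeffs2:
  assumes "entire_coeffs c" shows "entire_coeffs (partial_coeffs2 c)"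
  unfolding partial_coeffs2_swap by (rule entire_swap[THEN iffD2], rule entire_partial_coeffs1, rule entire_swap[THEN iffD2], fact assms)

lemma has_sum_binomial2:
  fixes a b h k :: real
  shows "((\<lambda>(m, n). (real (i choose m) * h ^ m * a ^ (i - m)) * (real (j choose n) * k ^ n * b ^ (j - n))) has_sum ((h + a) ^ i * (k + b) ^ j)) UNIV"
proof -
  let ?f = "\<lambda>(m, n). (real (i choose m) * h ^ m * a ^ (i - m)) * (real (j choose n) * k ^ n * b ^ (j - n))"
  have "(?f has_sum ((h + a) ^ i * (k + b) ^ j)) ({..i} \<times> {..j})"
    by (rule has_sum_finiteI) (auto simp: binomial_ring sum_product sum.cartesian_product)
  then show ?thesis
    by (subst has_sum_cong_neutral[where T = "{..i} \<times> {..j}" and g = ?f]) (auto simp: binomial_eq_0)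
qed

text \<open>Binomial expansion around \<open>a\<close> and an interchange of summation. The two linear coefficients are again
values of entire series, which later gives derivatives of every order.\<close>

lemma entire_reexpansion:
  assumes c: "entire_coeffs c"
  shows "\<exists>d. d (1, 0) = double_series (partial_coeffs1 c) a \<and> d (0, 1) = double_series (partial_coeffs2 c) a \<and>
    (\<forall>x. ((\<lambda>(m, n). d (m, n) * (x $ 1 - a $ 1) ^ m * (x $ 2 - a $ 2) ^ n) has_sum double_series c x) UNIV)"
proof -
  define G where "G = (\<lambda>(m, n) (i, j). c i j * (real (i choose m) * a $ 1 ^ (i - m)) * (real (j choose n) * a $ 2 ^ (j - n)))"
  define d where "d = (\<lambda>p. \<Sum>\<^sub>\<infinity>q. G p q)"
  have main: "((\<lambda>(m, n). d (m, n) * (x $ 1 - a $ 1) ^ m * (x $ 2 - a $ 2) ^ n) has_sum double_series c x) UNIV \<and>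
     (\<forall>p. (\<lambda>q. G p q * (x $ 1 - a $ 1) ^ fst p * (x $ 2 - a $ 2) ^ snd p) summable_on UNIV)" for x
  proof -
    define h k where "h = x $ 1 - a $ 1" and "k = x $ 2 - a $ 2"
    define f where "f = (\<lambda>((i, j), (m, n)). c i j * ((real (i choose m) * h ^ m * a $ 1 ^ (i - m)) * (real (j choose n) * k ^ n * a $ 2 ^ (j - n))))"
    have f1: "((\<lambda>q. f (p, q)) has_sum (case p of (i, j) \<Rightarrow> c i j * (x $ 1 ^ i * x $ 2 ^ j))) UNIV" for p
    proof -
      obtain i j where p: "p = (i, j)" by force
      show ?thesis using has_sum_cmult_right[OF has_sum_binomial2[of i h "a $ 1" j k "a $ 2"], of "c i j"]
        by (simp add: p f_def case_prod_beta h_def k_def)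
    qed
    have abs_f1: "((\<lambda>q. \<bar>f (p, q)\<bar>) has_sum (case p of (i, j) \<Rightarrow> \<bar>c i j\<bar> * ((\<bar>a $ 1\<bar> + \<bar>h\<bar>) ^ i * (\<bar>a $ 2\<bar> + \<bar>k\<bar>) ^ j))) UNIV" for p
    proof -
      obtain i j where p: "p = (i, j)" by force
      show ?thesis using has_sum_cmult_right[OF has_sum_binomial2[of i "\<bar>h\<bar>" "\<bar>a $ 1\<bar>" j "\<bar>k\<bar>" "\<bar>a $ 2\<bar>"], of "\<bar>c i j\<bar>"]
        by (simp add: p f_def case_prod_beta abs_mult power_abs add.commute)
    qed
    have "(\<lambda>p. \<bar>f p\<bar>) summable_on (SIGMA p:UNIV. UNIV)"
      by (rule summable_on_SigmaI[where g = "\<lambda>(i, j). \<bar>c i j\<bar> * ((\<bar>a $ 1\<bar> + \<bar>h\<bar>) ^ i * (\<bar>a $ 2\<bar> + \<bar>k\<bar>) ^ j)"])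
         (use abs_f1 entire_summable[OF c] in \<open>auto simp: mult.assoc[symmetric]\<close>)
    then have fs: "f summable_on (UNIV \<times> UNIV)" by (simp add: real_summable_abs[of f])
    have "((\<lambda>(i, j). c i j * (x $ 1 ^ i * x $ 2 ^ j)) has_sum double_series c x) UNIV"
      using entire_has_sum[OF c, of x] by (simp add: mult.assoc)
    with f1 have "(f has_sum double_series c x) (UNIV \<times> UNIV)" by (rule has_sum_SigmaI[OF _ _ fs])
    then have sw: "((\<lambda>(q, p). f (p, q)) has_sum double_series c x) (UNIV \<times> UNIV)" by (subst (asm) has_sum_swap)
    have eq: "f (q, p) = G p q * h ^ fst p * k ^ snd p" for p q
      by (auto simp: f_def G_def case_prod_beta)
    have sq: "(\<lambda>q. f (q, p)) summable_on UNIV" for p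
      using sw summable_on_SigmaD1[of "\<lambda>q p. f (p, q)" UNIV "\<lambda>_. UNIV" p] by (auto simp: summable_on_def)
    have "((\<lambda>p. \<Sum>\<^sub>\<infinity>q. f (q, p)) has_sum double_series c x) UNIV"
      by (rule has_sum_SigmaD[OF sw]) (use sq in \<open>auto intro: has_sum_infsum\<close>)
    moreover have "(\<Sum>\<^sub>\<infinity>q. f (q, p)) = d p * h ^ fst p * k ^ snd p" for p
      unfolding eq d_def by (simp add: infsum_cmult_left')
    ultimately show ?thesis using sq unfolding eq by (simp add: h_def k_def case_prod_unfold)
  qed
  have Gs: "(\<lambda>q. G p q) summable_on UNIV" for p
    using conjunct2[OF main[of "a + (\<chi> i. 1)"], rule_format, of p] by simp
  then have Gd: "((\<lambda>q. G p q) has_sum d p) UNIV" for p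
    unfolding d_def by (rule has_sum_infsum)
  have "d (1, 0) = double_series (partial_coeffs1 c) a"
  proof -
    have "((\<lambda>(i, j). G (1, 0) (Suc i, j)) has_sum d (1, 0)) UNIV"
      by (subst has_sum_Suc1) (use Gd[of "(1, 0)"] in \<open>auto simp: G_def\<close>)
    moreover have "(\<lambda>(i, j). G (1, 0) (Suc i, j)) = (\<lambda>(i, j). partial_coeffs1 c i j * a $ 1 ^ i * a $ 2 ^ j)"
      by (auto simp: G_def partial_coeffs1_def fun_eq_iff)
    ultimately have "((\<lambda>(i, j). partial_coeffs1 c i j * a $ 1 ^ i * a $ 2 ^ j) has_sum d (1, 0)) UNIV" by metis
    then show ?thesis using entire_has_sum[OF entire_partial_coeffs1[OF c]] by (rule has_sum_unique)
  qed
  moreover have "d (0, 1) = double_series (partial_coeffs2 c) a"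
  proof -
    have "((\<lambda>(i, j). G (0, 1) (i, Suc j)) has_sum d (0, 1)) UNIV"
      by (subst has_sum_Suc2) (use Gd[of "(0, 1)"] in \<open>auto simp: G_def\<close>)
    moreover have "(\<lambda>(i, j). G (0, 1) (i, Suc j)) = (\<lambda>(i, j). partial_coeffs2 c i j * a $ 1 ^ i * a $ 2 ^ j)"
      by (auto simp: G_def partial_coeffs2_def fun_eq_iff)
    ultimately have "((\<lambda>(i, j). partial_coeffs2 c i j * a $ 1 ^ i * a $ 2 ^ j) has_sum d (0, 1)) UNIV" by metis
    then show ?thesis using entire_has_sum[OF entire_partial_coeffs2[OF c]] by (rule has_sum_unique)
  qed
  ultimately show ?thesis
    by (intro exI[of _ d] conjI allI conjunct1[OF main])
qed

lemma double_series_real_analytic: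
  assumes "entire_coeffs c" shows "real_analytic (double_series c)"
  unfolding real_analytic_def
proof
  fix a :: "real^2"
  obtain d where "\<And>x. ((\<lambda>(m, n). d (m, n) * (x $ 1 - a $ 1) ^ m * (x $ 2 - a $ 2) ^ n) has_sum double_series c x) UNIV"
    using entire_reexpansion[OF assms, of a] by blast
  then show "\<exists>r>0. \<exists>d. \<forall>x\<in>ball a r. ((\<lambda>(m, n). d (m, n) * (x $ 1 - a $ 1) ^ m * (x $ 2 - a $ 2) ^ n) has_sum double_series c x) UNIV"
    using zero_less_one by blast
qed

lemma double_series_has_derivative:
  assumes "entire_coeffs c"
  shows "(double_series c has_derivative (\<lambda>h. double_series (partial_coeffs1 c) a * h $ 1 + double_series (partial_coeffs2 c) a * h $ 2)) (at a)"
proof -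
  obtain d where d: "d (1, 0) = double_series (partial_coeffs1 c) a" "d (0, 1) = double_series (partial_coeffs2 c) a"
    "\<And>x. ((\<lambda>(m, n). d (m, n) * (x $ 1 - a $ 1) ^ m * (x $ 2 - a $ 2) ^ n) has_sum double_series c x) UNIV"
    using entire_reexpansion[OF assms, of a] by auto
  from expansion_has_derivative[OF zero_less_one d(3)] show ?thesis unfolding d(1,2) .
qed

lemma real_analytic_differentiable:
  assumes "real_analytic f" shows "f differentiable (at a)"
proof -
  obtain r c where "r > 0" "\<And>x. x \<in> ball a r \<Longrightarrow>
      ((\<lambda>(m, n). c (m, n) * (x $ 1 - a $ 1) ^ m * (x $ 2 - a $ 2) ^ n) has_sum f x) UNIV"
    using assms unfolding real_analytic_def by blast
  from expansion_has_derivative[OF this] show ?thesis by (rule differentiableI)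
qed

section \<open>Reflections and the Weyl group of type B2\<close>

lemma refl_along_simps [simp]:
  "refl_along e1 x $ 1 = - x $ 1" "refl_along e1 x $ 2 = x $ 2"
  "refl_along e2 x $ 1 = x $ 1" "refl_along e2 x $ 2 = - x $ 2"
  "refl_along (e1 + e2) x $ 1 = - x $ 2" "refl_along (e1 + e2) x $ 2 = - x $ 1"
  "refl_along (e1 - e2) x $ 1 = x $ 2" "refl_along (e1 - e2) x $ 2 = x $ 1"
  by (simp_all add: refl_along_def inner_vec_def sum_2 axis_def field_simps)

lemma inner_root_simps:
  "e1 \<bullet> x = x $ 1" "e2 \<bullet> x = x $ 2" "(e1 + e2) \<bullet> x = x $ 1 + x $ 2" "(e1 - e2) \<bullet> x = x $ 1 - x $ 2"
  by (simp_all add: inner_vec_def sum_2 axis_def)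

lemma inner_2: "x \<bullet> y = x $ 1 * y $ 1 + x $ 2 * (y $ 2 :: real)" for x y :: "real^2"
  by (simp add: inner_vec_def sum_2)

lemma roots_neq:
  "e1 \<noteq> e2" "e1 \<noteq> e1 + e2" "e1 \<noteq> e1 - e2" "e2 \<noteq> e1 + e2" "e2 \<noteq> e1 - e2" "e1 + e2 \<noteq> e1 - e2"
  by (auto simp: vec_eq_iff axis_def forall_2)

lemma sum_pos_roots: "(\<Sum>\<alpha>\<in>pos_roots. f \<alpha>) = f e1 + f e2 + f (e1 + e2) + (f (e1 - e2) :: real)"
  using roots_neq unfolding pos_roots_def by (simp add: add.assoc)

lemma root_mult_simps:
  "root_mult k e1 = fst k" "root_mult k e2 = fst k"
  "root_mult k (e1 + e2) = snd k" "root_mult k (e1 - e2) = snd k"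
  by (auto simp: root_mult_def short_roots_def long_roots_def vec_eq_iff axis_def forall_2)

lemma axis_components: "e1 $ 1 = 1" "e1 $ 2 = 0" "e2 $ 1 = 0" "e2 $ 2 = 1"
  by (simp_all add: axis_def)

lemma linear_refl: "linear (refl_along \<alpha>)"
  unfolding refl_along_def by (rule linearI) (simp_all add: inner_add_right algebra_simps add_divide_distrib)

lemma refl_scaleR: "refl_along \<alpha> (c *\<^sub>R x) = c *\<^sub>R refl_along \<alpha> x"
  by (rule linear_scale[OF linear_refl])

lemma refl_invol: "refl_along \<alpha> (refl_along \<alpha> x) = x" if "\<alpha> \<noteq> 0"
  using that by (simp add: refl_along_def inner_diff_right)

lemma norm_refl: "norm (refl_along \<alpha> x) = norm x"
proof (cases "\<alpha> = 0")
  case True then show ?thesis by (simp add: refl_along_def)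
next
  case False
  then have "refl_along \<alpha> x \<bullet> refl_along \<alpha> x = x \<bullet> x"
    by (simp add: refl_along_def inner_diff_left inner_diff_right inner_commute field_simps)
  then show ?thesis by (simp add: norm_eq_sqrt_inner)
qed

lemma root_nonzero: "\<alpha> \<in> pos_roots \<Longrightarrow> \<alpha> \<noteq> 0"
  by (auto simp: pos_roots_def vec_eq_iff axis_def forall_2)

lemma finite_pos_roots: "finite pos_roots"
  by (simp add: pos_roots_def)

lemma refl_vector [simp]:
  "refl_along e1 (vector [a, b]) = vector [- a, b]"
  "refl_along e2 (vector [a, b]) = vector [a, - b]"
  "refl_along (e1 - e2) (vector [a, b]) = vector [b, a]"
  "refl_along (e1 + e2) (vector [a, b]) = vector [- b, - a]"
  by (simp_all add: vec_eq_iff forall_2)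

definition signed_perm :: "bool \<times> real \<times> real \<Rightarrow> real^2 \<Rightarrow> real^2" where
  "signed_perm p x = (case p of (b, s, t) \<Rightarrow> if b then vector [s * x $ 2, t * x $ 1] else vector [s * x $ 1, t * x $ 2])"

lemma finite_weyl_group: "finite weyl_group"
proof (rule finite_subset)
  let ?P = "UNIV \<times> {1, -1} \<times> {1, -1} :: (bool \<times> real \<times> real) set"
  show "finite (signed_perm ` ?P)" by simp
  show "weyl_group \<subseteq> signed_perm ` ?P"
  proof
    fix g assume "g \<in> weyl_group"
    then show "g \<in> signed_perm ` ?P"
    proof induction
      case weyl_id
      have "id = signed_perm (False, 1, 1)"
        by (simp add: signed_perm_def fun_eq_iff vec_eq_iff forall_2)
      then show ?case by blast
    next
      case (weyl_refl g \<alpha>)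
      then obtain b s t where g: "g = signed_perm (b, s, t)" and st: "s \<in> {1, -1}" "t \<in> {1, -1}" by auto
      consider "\<alpha> = e1" | "\<alpha> = e2" | "\<alpha> = e1 + e2" | "\<alpha> = e1 - e2" using weyl_refl by (auto simp: pos_roots_def)
      then have "refl_along \<alpha> \<circ> g \<in> {signed_perm (b, -s, t), signed_perm (b, s, -t), signed_perm (\<not> b, -t, -s), signed_perm (\<not> b, t, s)}"
      proof cases
        case 1
        then have "refl_along \<alpha> \<circ> g = signed_perm (b, -s, t)" by (simp add: g signed_perm_def fun_eq_iff)
        then show ?thesis by simp
      next
        case 2
        then have "refl_along \<alpha> \<circ> g = signed_perm (b, s, -t)" by (simp add: g signed_perm_def fun_eq_iff)
        then show ?thesis by simp
      next
        case 3
        then have "refl_along \<alpha> \<circ> g = signed_perm (\<not> b, -t, -s)" by (simp add: g signed_perm_def fun_eq_iff)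
        then show ?thesis by simp
      next
        case 4
        then have "refl_along \<alpha> \<circ> g = signed_perm (\<not> b, t, s)" by (simp add: g signed_perm_def fun_eq_iff)
        then show ?thesis by simp
      qed
      moreover have "{signed_perm (b, -s, t), signed_perm (b, s, -t), signed_perm (\<not> b, -t, -s), signed_perm (\<not> b, t, s)} \<subseteq> signed_perm ` ?P"
        using st by auto
      ultimately show ?case by blast
    qed
  qed
qed

text \<open>The group as a finite type, so that families indexed by it form a Euclidean space.\<close>

typedef weyl = weyl_group
  using weyl_id by blast

instance weyl :: finite
proof
  have "finite (Rep_weyl -` weyl_group)"
    using finite_weyl_group by (rule finite_vimageI) (simp add: inj_on_def Rep_weyl_inject)
  then show "finite (UNIV :: weyl set)" using Rep_weyl by (simp add: vimage_def)
qed

definition weyl_one :: weyl where "weyl_one = Abs_weyl id"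

definition lmult_refl :: "real^2 \<Rightarrow> weyl \<Rightarrow> weyl" where
  "lmult_refl \<alpha> w = Abs_weyl (refl_along \<alpha> \<circ> Rep_weyl w)"

lemma Rep_weyl_one: "Rep_weyl weyl_one x = x"
  by (simp add: weyl_one_def Abs_weyl_inverse weyl_id)

lemma Rep_lmult_refl: "\<alpha> \<in> pos_roots \<Longrightarrow> Rep_weyl (lmult_refl \<alpha> w) x = refl_along \<alpha> (Rep_weyl w x)"
  by (simp add: lmult_refl_def Abs_weyl_inverse weyl_refl Rep_weyl)

lemma lmult_refl_invol: "\<alpha> \<in> pos_roots \<Longrightarrow> lmult_refl \<alpha> (lmult_refl \<alpha> w) = w"
  by (intro iffD1[OF Rep_weyl_inject] ext) (simp add: Rep_lmult_refl refl_invol root_nonzero)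

lemma weyl_induct:
  assumes "P weyl_one" "\<And>\<alpha> w. \<alpha> \<in> pos_roots \<Longrightarrow> P w \<Longrightarrow> P (lmult_refl \<alpha> w)"
  shows "P w"
proof -
  have "g \<in> weyl_group \<and> P (Abs_weyl g)" if "g \<in> weyl_group" for g
    using that
  proof (induction rule: weyl_group.induct)
    case weyl_id
    then show ?case using assms(1) weyl_group.weyl_id by (simp only: weyl_one_def simp_thms)
  next
    case (weyl_refl g \<alpha>)
    then have "lmult_refl \<alpha> (Abs_weyl g) = Abs_weyl (refl_along \<alpha> \<circ> g)"
      by (simp add: lmult_refl_def Abs_weyl_inverse)
    then have "P (Abs_weyl (refl_along \<alpha> \<circ> g))"
      using weyl_refl assms(2)[of \<alpha> "Abs_weyl g"] by metis
    with weyl_group.weyl_refl[of g \<alpha>] weyl_refl show ?case by metis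
  qed
  from this[OF Rep_weyl[of w]] show ?thesis by (simp add: Rep_weyl_inverse)
qed

lemma linear_weyl: "linear (Rep_weyl w)"
proof (induction w rule: weyl_induct)
  case 1
  have "Rep_weyl weyl_one = id" by (simp add: fun_eq_iff Rep_weyl_one)
  then show ?case by (simp only: linear_id)
next
  case (2 \<alpha> w)
  have "Rep_weyl (lmult_refl \<alpha> w) = refl_along \<alpha> \<circ> Rep_weyl w" using 2 by (simp add: fun_eq_iff Rep_lmult_refl)
  then show ?case using 2 linear_refl by (simp only: linear_compose)
qed

lemma weyl_scaleR: "Rep_weyl w (c *\<^sub>R x) = c *\<^sub>R Rep_weyl w x"
  by (rule linear_scale[OF linear_weyl])

lemma norm_weyl: "norm (Rep_weyl w x) = norm x"
  by (induction w rule: weyl_induct) (simp_all add: Rep_weyl_one Rep_lmult_refl norm_refl)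

lemma sum_weyl_group: "(\<Sum>g\<in>weyl_group. f g) = (\<Sum>w\<in>UNIV. f (Rep_weyl w))"
  by (rule sum.reindex_bij_witness[of _ Rep_weyl Abs_weyl]) (auto simp: Rep_weyl Rep_weyl_inverse Abs_weyl_inverse)

lemma weyl_reflection_system:
  assumes "fst k \<ge> 0" "snd k \<ge> 0"
  shows "reflection_system pos_roots (root_mult k) lmult_refl"
proof
  show "finite pos_roots" by (rule finite_pos_roots)
  show "root_mult k \<alpha> \<ge> 0" for \<alpha> using assms by (simp add: root_mult_def)
  show "lmult_refl \<alpha> (lmult_refl \<alpha> w) = w" if "\<alpha> \<in> pos_roots" for \<alpha> w using that by (rule lmult_refl_invol)
qed

lemma weyl_connected_reflection_system:
  assumes "fst k > 0" "snd k > 0"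
  shows "connected_reflection_system pos_roots (root_mult k) lmult_refl"
proof (intro connected_reflection_system.intro connected_reflection_system_axioms.intro)
  show "reflection_system pos_roots (root_mult k) lmult_refl" using assms by (simp add: weyl_reflection_system)
  show "root_mult k \<alpha> > 0" if "\<alpha> \<in> pos_roots" for \<alpha>
    using that assms by (auto simp: pos_roots_def root_mult_simps)
  fix S :: "weyl set" assume S: "S \<noteq> {}" and closed: "\<And>\<alpha> w. \<alpha> \<in> pos_roots \<Longrightarrow> w \<in> S \<Longrightarrow> lmult_refl \<alpha> w \<in> S"
  have iff: "w \<in> S \<longleftrightarrow> weyl_one \<in> S" for w
  proof (induction w rule: weyl_induct)
    case (2 \<alpha> w)
    then show ?case using closed lmult_refl_invol by metis
  qed simp
  then show "S = UNIV" using S by blast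
qed

lemma has_vector_derivative_vec:
  fixes f :: "real \<Rightarrow> real^'n"
  assumes "\<And>i. ((\<lambda>t. f t $ i) has_real_derivative d $ i) (at t)"
  shows "(f has_vector_derivative d) (at t)"
  unfolding has_vector_derivative_def has_derivative_componentwise_within[of f]
  using assms by (auto simp: Basis_vec_def inner_axis has_real_derivative_iff_has_vector_derivative has_vector_derivative_def)

section \<open>The power series of the Dunkl kernel\<close>

text \<open>The operator \<open>x \<bullet> \<nabla> + \<Sum>\<^sub>\<alpha> k\<^sub>\<alpha> (1 - \<sigma>\<^sub>\<alpha>)\<close> maps \<open>x\<^sub>1\<^sup>i x\<^sub>2\<^sup>j\<close> to
\<open>diag_coeff k i j\<close> times itself minus \<open>swap_coeff k i j\<close> times \<open>x\<^sub>1\<^sup>j x\<^sub>2\<^sup>i\<close>.\<close>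

definition diag_coeff :: "real \<times> real \<Rightarrow> nat \<Rightarrow> nat \<Rightarrow> real" where
  "diag_coeff k i j = real (i + j) + fst k * (2 - (- 1) ^ i - (- 1) ^ j) + 2 * snd k"

definition swap_coeff :: "real \<times> real \<Rightarrow> nat \<Rightarrow> nat \<Rightarrow> real" where
  "swap_coeff k i j = snd k * (1 + (- 1) ^ (i + j))"

definition times_linear :: "real^2 \<Rightarrow> (nat \<Rightarrow> nat \<Rightarrow> real) \<Rightarrow> nat \<Rightarrow> nat \<Rightarrow> real" where
  "times_linear y c i j = y $ 1 * (if i = 0 then 0 else c (i - 1) j) + y $ 2 * (if j = 0 then 0 else c i (j - 1))"

text \<open>Solution of the \<open>2 \<times> 2\<close> system for the monomials with exponents \<open>(i, j)\<close> and \<open>(j, i)\<close>, with right-hand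
side from degree \<open>n\<close>. At level \<open>n\<close> only the entries with \<open>i + j = n\<close> are meaningful.\<close>

primrec graded_coeff :: "real \<times> real \<Rightarrow> real^2 \<Rightarrow> nat \<Rightarrow> nat \<Rightarrow> nat \<Rightarrow> real" where
  "graded_coeff k y 0 = (\<lambda>i j. 1)"
| "graded_coeff k y (Suc n) = (\<lambda>i j.
     (diag_coeff k i j * times_linear y (graded_coeff k y n) i j + swap_coeff k i j * times_linear y (graded_coeff k y n) j i)
     / ((diag_coeff k i j)\<^sup>2 - (swap_coeff k i j)\<^sup>2))"

definition kernel_coeff :: "real \<times> real \<Rightarrow> real^2 \<Rightarrow> nat \<Rightarrow> nat \<Rightarrow> real" where
  "kernel_coeff k y i j = graded_coeff k y (i + j) i j"

text \<open>This is why the \<open>2 \<times> 2\<close> systems are solvable and why the solution gains a factor \<open>1 / n\<close> in degree \<open>n\<close>.\<close>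

lemma coeff_gap:
  assumes "fst k \<ge> 0" "snd k \<ge> 0"
  shows "real (i + j) \<le> diag_coeff k i j - swap_coeff k i j" "0 \<le> swap_coeff k i j" "swap_coeff k i j \<le> diag_coeff k i j"
proof -
  have s: "-1 \<le> (- 1 :: real) ^ n" "(- 1 :: real) ^ n \<le> 1" for n by (cases "even n"; simp)+
  have "0 \<le> fst k * (2 - (- 1) ^ i - (- 1) ^ j)"
    using assms s(2)[of i] s(2)[of j] by (intro mult_nonneg_nonneg) linarith+
  moreover have "snd k * (1 + (- 1) ^ (i + j)) \<le> snd k * 2"
    using assms s(2)[of "i + j"] by (intro mult_left_mono) linarith+
  ultimately show 1: "real (i + j) \<le> diag_coeff k i j - swap_coeff k i j"
    by (simp add: diag_coeff_def swap_coeff_def)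
  show "0 \<le> swap_coeff k i j"
    using assms s(1)[of "i + j"] unfolding swap_coeff_def by (intro mult_nonneg_nonneg) linarith+
  show "swap_coeff k i j \<le> diag_coeff k i j" using 1 by linarith
qed

lemma coeff_sym: "diag_coeff k j i = diag_coeff k i j" "swap_coeff k j i = swap_coeff k i j"
  by (simp_all add: diag_coeff_def swap_coeff_def add.commute algebra_simps)

lemma times_linear_kernel:
  assumes "i + j = Suc n"
  shows "times_linear y (graded_coeff k y n) i j = times_linear y (kernel_coeff k y) i j"
  using assms by (cases i; cases j) (auto simp: times_linear_def kernel_coeff_def)

lemma kernel_coeff_recurrence:
  assumes k: "fst k \<ge> 0" "snd k \<ge> 0"
  shows "diag_coeff k i j * kernel_coeff k y i j - swap_coeff k i j * kernel_coeff k y j i = times_linear y (kernel_coeff k y) i j"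
proof (cases "i + j")
  case 0
  then show ?thesis by (simp add: kernel_coeff_def times_linear_def diag_coeff_def swap_coeff_def)
next
  case (Suc n)
  define a b p q where "a = diag_coeff k i j" and "b = swap_coeff k i j"
    and "p = times_linear y (kernel_coeff k y) i j" and "q = times_linear y (kernel_coeff k y) j i"
  have "0 < a - b" "0 < a + b" using coeff_gap[OF k, of i j] Suc by (auto simp: a_def b_def)
  then have D: "a\<^sup>2 - b\<^sup>2 \<noteq> 0" by (simp add: power2_eq_square square_diff_square_factored)
  have Suc': "j + i = Suc n" using Suc by simp
  have c1: "kernel_coeff k y i j = (a * p + b * q) / (a\<^sup>2 - b\<^sup>2)"
    unfolding kernel_coeff_def[of k y i j] Suc
    by (simp add: times_linear_kernel[OF Suc] times_linear_kernel[OF Suc'] a_def b_def p_def q_def)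
  have c2: "kernel_coeff k y j i = (a * q + b * p) / (a\<^sup>2 - b\<^sup>2)"
    unfolding kernel_coeff_def[of k y j i] Suc'
    by (simp add: times_linear_kernel[OF Suc] times_linear_kernel[OF Suc'] a_def b_def p_def q_def coeff_sym)
  have "a * kernel_coeff k y i j - b * kernel_coeff k y j i = (a\<^sup>2 - b\<^sup>2) * p / (a\<^sup>2 - b\<^sup>2)"
    unfolding c1 c2 by (simp add: power2_eq_square diff_divide_distrib[symmetric] algebra_simps)
  then show ?thesis using D by (simp add: a_def b_def p_def)
qed

lemma kernel_coeff_bound:
  assumes k: "fst k \<ge> 0" "snd k \<ge> 0"
  shows "i + j = n \<Longrightarrow> \<bar>kernel_coeff k y i j\<bar> \<le> (\<bar>y $ 1\<bar> + \<bar>y $ 2\<bar>) ^ n / fact n"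
proof (induction n arbitrary: i j)
  case 0
  then show ?case by (simp add: kernel_coeff_def)
next
  case (Suc n)
  define Y where "Y = \<bar>y $ 1\<bar> + \<bar>y $ 2\<bar>"
  define m where "m = Y ^ Suc n / fact n"
  have tl: "\<bar>times_linear y (kernel_coeff k y) i j\<bar> \<le> m" if "i + j = Suc n" for i j
  proof -
    have Y0: "Y \<ge> 0" by (simp add: Y_def)
    have "\<bar>if i = 0 then 0 else kernel_coeff k y (i - 1) j\<bar> \<le> Y ^ n / fact n"
      using Suc.IH[of "i - 1" j] that Y0 by (auto simp: Y_def)
    moreover have "\<bar>if j = 0 then 0 else kernel_coeff k y i (j - 1)\<bar> \<le> Y ^ n / fact n"
      using Suc.IH[of i "j - 1"] that Y0 by (auto simp: Y_def)
    ultimately have "\<bar>times_linear y (kernel_coeff k y) i j\<bar> \<le> \<bar>y $ 1\<bar> * (Y ^ n / fact n) + \<bar>y $ 2\<bar> * (Y ^ n / fact n)"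
      unfolding times_linear_def
      by (intro order_trans[OF abs_triangle_ineq] add_mono) (auto simp only: abs_mult intro!: mult_left_mono)
    also have "\<dots> = m" by (simp add: m_def Y_def algebra_simps add_divide_distrib)
    finally show ?thesis .
  qed
  define a b where "a = diag_coeff k i j" and "b = swap_coeff k i j"
  define p q where "p = kernel_coeff k y i j" and "q = kernel_coeff k y j i"
  have g: "real (Suc n) \<le> a - b" "0 \<le> b" using coeff_gap[OF k, of i j] Suc.prems by (auto simp: a_def b_def)
  have r: "\<bar>a * p - b * q\<bar> \<le> m" "\<bar>a * q - b * p\<bar> \<le> m"
    using tl[of i j] tl[of j i] Suc.prems kernel_coeff_recurrence[OF k, of i j y] kernel_coeff_recurrence[OF k, of j i y]
    by (simp_all add: a_def b_def p_def q_def coeff_sym add.commute)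
  have "(a + b) * ((a - b) * p) = a * (a * p - b * q) + b * (a * q - b * p)" by (simp add: algebra_simps)
  also have "\<bar>\<dots>\<bar> \<le> a * m + b * m"
    using r g by (intro order_trans[OF abs_triangle_ineq] add_mono) (auto simp: abs_mult intro!: mult_left_mono)
  finally have "(a + b) * \<bar>(a - b) * p\<bar> \<le> (a + b) * m" using g by (simp add: abs_mult distrib_right)
  then have "(a - b) * \<bar>p\<bar> \<le> m" using g by (simp add: abs_mult)
  moreover have "real (Suc n) * \<bar>p\<bar> \<le> (a - b) * \<bar>p\<bar>" using g by (intro mult_right_mono) auto
  ultimately have "real (Suc n) * \<bar>p\<bar> \<le> m" by linarith
  then have "\<bar>kernel_coeff k y i j\<bar> \<le> m / real (Suc n)" by (simp add: p_def le_divide_eq mult.commute del: of_nat_Suc)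
  also have "\<dots> = Y ^ Suc n / fact (Suc n)" by (simp add: m_def mult.commute del: of_nat_Suc power_Suc)
  finally show ?case by (simp add: Y_def)
qed

lemma exp_has_sum: "((\<lambda>i. x ^ i / fact i) has_sum exp x) (UNIV :: nat set)" if "x \<ge> 0" for x :: real
proof -
  have "(\<lambda>i. x ^ i / fact i) sums exp x" using exp_converges[of x] by (simp add: divide_inverse mult.commute)
  then show ?thesis using that by (intro sums_nonneg_imp_has_sum) auto
qed

lemma dunkl_series_entire:
  assumes k: "fst k \<ge> 0" "snd k \<ge> 0"
  shows "entire_coeffs (kernel_coeff k y)"
  unfolding entire_coeffs_def
proof (intro allI impI)
  fix R :: real assume R: "R > 0"
  define Z where "Z = (\<bar>y $ 1\<bar> + \<bar>y $ 2\<bar>) * R"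
  have Z: "Z \<ge> 0" using R by (simp add: Z_def)
  note e = exp_has_sum[OF Z]
  have "(\<lambda>(i, j). (Z ^ i / fact i) * (Z ^ j / fact j)) summable_on (SIGMA i:UNIV. UNIV)"
  proof (rule summable_on_SigmaI[where g = "\<lambda>i. (Z ^ i / fact i) * exp Z"])
    show "((\<lambda>j. case (i, j) of (i, j) \<Rightarrow> (Z ^ i / fact i) * (Z ^ j / fact j)) has_sum (Z ^ i / fact i) * exp Z) UNIV" for i
      unfolding prod.case by (rule has_sum_cmult_right[OF e])
    show "(\<lambda>i. (Z ^ i / fact i) * exp Z) summable_on UNIV"
      by (rule summable_on_cmult_left[OF has_sum_imp_summable[OF e]])
    show "0 \<le> (case (i, j) of (i, j) \<Rightarrow> (Z ^ i / fact i) * (Z ^ j / fact j))" for i j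
      using Z by simp
  qed
  then have "(\<lambda>(i, j). (Z ^ i / fact i) * (Z ^ j / fact j)) summable_on UNIV" by simp
  then show "(\<lambda>(i, j). \<bar>kernel_coeff k y i j\<bar> * R ^ (i + j)) summable_on UNIV"
  proof (rule real_summable_comparison)
    fix p :: "nat \<times> nat"
    obtain i j where p: "p = (i, j)" by force
    have "fact i * fact j \<le> (fact (i + j) :: nat)" by (simp add: dvd_imp_le fact_fact_dvd_fact)
    then have f: "fact i * fact j \<le> (fact (i + j) :: real)" by (metis of_nat_fact of_nat_le_iff of_nat_mult)
    have "\<bar>kernel_coeff k y i j\<bar> * R ^ (i + j) \<le> (\<bar>y $ 1\<bar> + \<bar>y $ 2\<bar>) ^ (i + j) / fact (i + j) * R ^ (i + j)"
      using kernel_coeff_bound[OF k refl] R by (intro mult_right_mono) auto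
    also have "\<dots> = Z ^ (i + j) / fact (i + j)" by (simp add: Z_def power_mult_distrib)
    also have "\<dots> \<le> Z ^ (i + j) / (fact i * fact j)" using f Z by (intro divide_left_mono) auto
    also have "\<dots> = (Z ^ i / fact i) * (Z ^ j / fact j)" by (simp add: power_add)
    finally show "\<bar>case p of (i, j) \<Rightarrow> \<bar>kernel_coeff k y i j\<bar> * R ^ (i + j)\<bar> \<le> (case p of (i, j) \<Rightarrow> (Z ^ i / fact i) * (Z ^ j / fact j))"
      using R by (simp add: p)
  qed
qed

definition dunkl_series :: "real \<times> real \<Rightarrow> real^2 \<Rightarrow> real^2 \<Rightarrow> real" where
  "dunkl_series k y = double_series (kernel_coeff k y)"

definition dunkl_partial1 :: "real \<times> real \<Rightarrow> real^2 \<Rightarrow> real^2 \<Rightarrow> real" where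
  "dunkl_partial1 k y = double_series (partial_coeffs1 (kernel_coeff k y))"

definition dunkl_partial2 :: "real \<times> real \<Rightarrow> real^2 \<Rightarrow> real^2 \<Rightarrow> real" where
  "dunkl_partial2 k y = double_series (partial_coeffs2 (kernel_coeff k y))"

lemma dunkl_series_zero:
  assumes k: "fst k \<ge> 0" "snd k \<ge> 0"
  shows "dunkl_series k y 0 = 1"
proof -
  have "((\<lambda>(i, j). kernel_coeff k y i j * 0 ^ i * 0 ^ j) has_sum 1) {(0,0)}"
    by (rule has_sum_finiteI) (auto simp: kernel_coeff_def)
  then have "((\<lambda>(i, j). kernel_coeff k y i j * 0 ^ i * 0 ^ j) has_sum 1) UNIV"
    by (subst has_sum_cong_neutral[where T = "{(0,0)}" and g = "(\<lambda>(i, j). kernel_coeff k y i j * 0 ^ i * 0 ^ j)"])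
       (auto simp: power_0_left split: if_splits)
  moreover have "((\<lambda>(i, j). kernel_coeff k y i j * 0 ^ i * 0 ^ j) has_sum dunkl_series k y 0) UNIV"
    using entire_has_sum[OF dunkl_series_entire[OF k], of y 0] by (simp add: dunkl_series_def)
  ultimately show ?thesis by (simp only: has_sum_unique)
qed

lemma has_sum_double_series_swap:
  fixes u v s :: real
  assumes "((\<lambda>(i, j). c i j * v ^ i * u ^ j) has_sum s) UNIV"
  shows "((\<lambda>(i, j). c j i * u ^ i * v ^ j) has_sum s) UNIV"
  using assms has_sum_swap[of "\<lambda>(i, j). c i j * v ^ i * u ^ j" UNIV UNIV s] by (simp add: mult_ac)

text \<open>The Dunkl equation in the direction of \<open>x\<close>, read off from the coefficient recurrence.\<close>

lemma dunkl_series_radial: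
  assumes k: "fst k \<ge> 0" "snd k \<ge> 0"
  shows "x $ 1 * dunkl_partial1 k y x + x $ 2 * dunkl_partial2 k y x
    + (\<Sum>\<alpha>\<in>pos_roots. root_mult k \<alpha> * (dunkl_series k y x - dunkl_series k y (refl_along \<alpha> x))) = (x \<bullet> y) * dunkl_series k y x"
proof -
  define c where "c = kernel_coeff k y"
  define u v where "u = x $ 1" and "v = x $ 2"
  have ent: "entire_coeffs c" unfolding c_def by (rule dunkl_series_entire[OF k])
  have h: "((\<lambda>(i, j). c i j * z $ 1 ^ i * z $ 2 ^ j) has_sum dunkl_series k y z) UNIV" for z
    unfolding dunkl_series_def c_def[symmetric] by (rule entire_has_sum[OF ent])
  define m where "m = (\<lambda>(i, j). u ^ i * v ^ j)"
  have h0: "((\<lambda>(i, j). c i j * m (i, j)) has_sum dunkl_series k y x) UNIV"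
    using h[of x] by (simp add: m_def u_def v_def mult.assoc)
  have h1: "((\<lambda>(i, j). ((- 1) ^ i * c i j) * m (i, j)) has_sum dunkl_series k y (refl_along e1 x)) UNIV"
    using h[of "refl_along e1 x"] by (simp add: m_def u_def v_def power_minus[of "x $ 1"] mult_ac)
  have h2: "((\<lambda>(i, j). ((- 1) ^ j * c i j) * m (i, j)) has_sum dunkl_series k y (refl_along e2 x)) UNIV"
    using h[of "refl_along e2 x"] by (simp add: m_def u_def v_def power_minus[of "x $ 2"] mult_ac)
  have h3: "((\<lambda>(i, j). c j i * m (i, j)) has_sum dunkl_series k y (refl_along (e1 - e2) x)) UNIV"
    using has_sum_double_series_swap[of c v u] h[of "refl_along (e1 - e2) x"] by (simp add: m_def u_def v_def mult_ac)
  have h4: "((\<lambda>(i, j). ((- 1) ^ (i + j) * c j i) * m (i, j)) has_sum dunkl_series k y (refl_along (e1 + e2) x)) UNIV"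
    using has_sum_double_series_swap[of c "- v" "- u"] h[of "refl_along (e1 + e2) x"]
    by (simp add: m_def u_def v_def power_minus[of "x $ 1"] power_minus[of "x $ 2"] power_add mult_ac)
  have d1: "((\<lambda>(i, j). (real i * c i j) * m (i, j)) has_sum (u * dunkl_partial1 k y x)) UNIV"
  proof -
    have "((\<lambda>(i, j). partial_coeffs1 c i j * u ^ i * v ^ j) has_sum dunkl_partial1 k y x) UNIV"
      using entire_has_sum[OF entire_partial_coeffs1[OF ent], of x] by (simp add: dunkl_partial1_def c_def u_def v_def)
    from has_sum_cmult_right[OF this, of u]
    show ?thesis by (subst has_sum_Suc1[symmetric]) (simp_all add: case_prod_unfold m_def partial_coeffs1_def mult_ac)
  qed
  have d2: "((\<lambda>(i, j). (real j * c i j) * m (i, j)) has_sum (v * dunkl_partial2 k y x)) UNIV"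
  proof -
    have "((\<lambda>(i, j). partial_coeffs2 c i j * u ^ i * v ^ j) has_sum dunkl_partial2 k y x) UNIV"
      using entire_has_sum[OF entire_partial_coeffs2[OF ent], of x] by (simp add: dunkl_partial2_def c_def u_def v_def)
    from has_sum_cmult_right[OF this, of v]
    show ?thesis by (subst has_sum_Suc2[symmetric]) (simp_all add: case_prod_unfold m_def partial_coeffs2_def mult_ac)
  qed
  have t1: "((\<lambda>(i, j). (if i = 0 then 0 else c (i - 1) j) * m (i, j)) has_sum (u * dunkl_series k y x)) UNIV"
    using has_sum_cmult_right[OF h0, of u]
    by (subst has_sum_Suc1[symmetric]) (simp_all add: case_prod_unfold m_def mult_ac)
  have t2: "((\<lambda>(i, j). (if j = 0 then 0 else c i (j - 1)) * m (i, j)) has_sum (v * dunkl_series k y x)) UNIV"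
    using has_sum_cmult_right[OF h0, of v]
    by (subst has_sum_Suc2[symmetric]) (simp_all add: case_prod_unfold m_def mult_ac)
  have R: "((\<lambda>(i, j). times_linear y c i j * m (i, j)) has_sum (y $ 1 * (u * dunkl_series k y x) + y $ 2 * (v * dunkl_series k y x))) UNIV"
    using has_sum_add[OF has_sum_cmult_right[OF t1, of "y $ 1"] has_sum_cmult_right[OF t2, of "y $ 2"]]
    by (simp add: times_linear_def case_prod_unfold distrib_right mult.assoc)
  define S where "S = u * dunkl_partial1 k y x + v * dunkl_partial2 k y x +
      ((2 * fst k + 2 * snd k) * dunkl_series k y x + (- fst k) * dunkl_series k y (refl_along e1 x) + (- fst k) * dunkl_series k y (refl_along e2 x)
        + (- snd k) * dunkl_series k y (refl_along (e1 + e2) x) + (- snd k) * dunkl_series k y (refl_along (e1 - e2) x))"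
  define F where "F = (\<lambda>p. (case p of (i, j) \<Rightarrow> (real i * c i j) * m (i, j)) + (case p of (i, j) \<Rightarrow> (real j * c i j) * m (i, j)) +
     ((2 * fst k + 2 * snd k) * (case p of (i, j) \<Rightarrow> c i j * m (i, j))
       + (- fst k) * (case p of (i, j) \<Rightarrow> ((- 1) ^ i * c i j) * m (i, j)) + (- fst k) * (case p of (i, j) \<Rightarrow> ((- 1) ^ j * c i j) * m (i, j))
       + (- snd k) * (case p of (i, j) \<Rightarrow> ((- 1) ^ (i + j) * c j i) * m (i, j)) + (- snd k) * (case p of (i, j) \<Rightarrow> c j i * m (i, j))))"
  have L: "(F has_sum S) UNIV"
    unfolding S_def F_def
    by (rule has_sum_add[OF has_sum_add[OF d1 d2] has_sum_add[OF has_sum_add[OF has_sum_add[OF has_sum_add[OF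
          has_sum_cmult_right[OF h0] has_sum_cmult_right[OF h1]] has_sum_cmult_right[OF h2]] has_sum_cmult_right[OF h4]] has_sum_cmult_right[OF h3]]])
  have "F = (\<lambda>(i, j). times_linear y c i j * m (i, j))" (is "_ = ?G")
  proof
    fix p :: "nat \<times> nat"
    obtain i j where p: "p = (i, j)" by force
    show "F p = ?G p"
      unfolding F_def p prod.case kernel_coeff_recurrence[OF k, of i j y, folded c_def, symmetric]
      by (simp add: diag_coeff_def swap_coeff_def algebra_simps)
  qed
  then have "S = y $ 1 * (u * dunkl_series k y x) + y $ 2 * (v * dunkl_series k y x)" using L R by (simp only: has_sum_unique)
  then show ?thesis
    by (simp add: S_def sum_pos_roots root_mult_simps inner_2 u_def v_def algebra_simps)
qed

text \<open>For the sign changes the two terms of the numerator acquire different signs in general, but only when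
\<open>i + j\<close> is odd, and then the swap coefficient vanishes.\<close>

lemma graded_coeff_refl_all:
  "i + j = n \<Longrightarrow>
     graded_coeff k (refl_along e1 y) n i j = (- 1) ^ i * graded_coeff k y n i j \<and>
     graded_coeff k (refl_along e2 y) n i j = (- 1) ^ j * graded_coeff k y n i j \<and>
     graded_coeff k (refl_along (e1 - e2) y) n i j = graded_coeff k y n j i \<and>
     graded_coeff k (refl_along (e1 + e2) y) n i j = (- 1) ^ n * graded_coeff k y n j i"
proof (induction n arbitrary: i j)
  case (Suc n)
  have tl: "times_linear (refl_along e1 y) (graded_coeff k (refl_along e1 y) n) a b = (- 1) ^ a * times_linear y (graded_coeff k y n) a b"
    "times_linear (refl_along e2 y) (graded_coeff k (refl_along e2 y) n) a b = (- 1) ^ b * times_linear y (graded_coeff k y n) a b"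
    "times_linear (refl_along (e1 - e2) y) (graded_coeff k (refl_along (e1 - e2) y) n) a b = times_linear y (graded_coeff k y n) b a"
    "times_linear (refl_along (e1 + e2) y) (graded_coeff k (refl_along (e1 + e2) y) n) a b = (- 1) ^ Suc n * times_linear y (graded_coeff k y n) b a"
    if "a + b = Suc n" for a b
    using that by (cases a; cases b; simp add: times_linear_def Suc.IH algebra_simps)+
  have ji: "j + i = Suc n" using Suc.prems by simp
  have par: "swap_coeff k i j * (- 1) ^ j = swap_coeff k i j * (- 1) ^ i"
    by (cases "even i"; cases "even j") (simp_all add: swap_coeff_def)
  have par': "swap_coeff k i j * ((- 1) ^ j * r) = (- 1) ^ i * (swap_coeff k i j * r)"
      "swap_coeff k i j * ((- 1) ^ i * r) = (- 1) ^ j * (swap_coeff k i j * r)" for r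
    using par by auto
  show ?case
  proof (intro conjI)
    show "graded_coeff k (refl_along e1 y) (Suc n) i j = (- 1) ^ i * graded_coeff k y (Suc n) i j"
      unfolding graded_coeff.simps tl(1)[OF Suc.prems] tl(1)[OF ji] par' by (simp add: algebra_simps)
    show "graded_coeff k (refl_along e2 y) (Suc n) i j = (- 1) ^ j * graded_coeff k y (Suc n) i j"
      unfolding graded_coeff.simps tl(2)[OF Suc.prems] tl(2)[OF ji] par' by (simp add: algebra_simps)
    show "graded_coeff k (refl_along (e1 - e2) y) (Suc n) i j = graded_coeff k y (Suc n) j i"
      unfolding graded_coeff.simps tl(3)[OF Suc.prems] tl(3)[OF ji] by (simp add: coeff_sym)
    show "graded_coeff k (refl_along (e1 + e2) y) (Suc n) i j = (- 1) ^ Suc n * graded_coeff k y (Suc n) j i"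
      unfolding graded_coeff.simps tl(4)[OF Suc.prems] tl(4)[OF ji] by (simp add: coeff_sym algebra_simps diff_divide_distrib)
  qed
qed simp

lemmas graded_coeff_refl = graded_coeff_refl_all[THEN conjunct1] graded_coeff_refl_all[THEN conjunct2, THEN conjunct1]
  graded_coeff_refl_all[THEN conjunct2, THEN conjunct2, THEN conjunct1] graded_coeff_refl_all[THEN conjunct2, THEN conjunct2, THEN conjunct2]

lemma dunkl_series_equivariant:
  assumes k: "fst k \<ge> 0" "snd k \<ge> 0" and \<alpha>: "\<alpha> \<in> pos_roots"
  shows "dunkl_series k (refl_along \<alpha> y) (refl_along \<alpha> x) = dunkl_series k y x"
proof -
  have h: "((\<lambda>(i, j). kernel_coeff k z i j * w $ 1 ^ i * w $ 2 ^ j) has_sum dunkl_series k z w) UNIV" for z w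
    unfolding dunkl_series_def by (rule entire_has_sum[OF dunkl_series_entire[OF k]])
  consider "\<alpha> = e1" | "\<alpha> = e2" | "\<alpha> = e1 - e2" | "\<alpha> = e1 + e2" using \<alpha> by (auto simp: pos_roots_def)
  then have "((\<lambda>(i, j). kernel_coeff k y i j * x $ 1 ^ i * x $ 2 ^ j) has_sum dunkl_series k (refl_along \<alpha> y) (refl_along \<alpha> x)) UNIV"
  proof cases
    case 1
    show ?thesis using h[of "refl_along \<alpha> y" "refl_along \<alpha> x"]
      by (simp add: 1 kernel_coeff_def graded_coeff_refl power_minus[of "x $ 1"] mult_ac)
  next
    case 2
    show ?thesis using h[of "refl_along \<alpha> y" "refl_along \<alpha> x"]
      by (simp add: 2 kernel_coeff_def graded_coeff_refl power_minus[of "x $ 2"] mult_ac)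
  next
    case 3
    show ?thesis using has_sum_double_series_swap[OF h[of "refl_along \<alpha> y" "refl_along \<alpha> x", unfolded 3 refl_along_simps]]
      by (simp add: 3 kernel_coeff_def graded_coeff_refl add.commute)
  next
    case 4
    show ?thesis using has_sum_double_series_swap[OF h[of "refl_along \<alpha> y" "refl_along \<alpha> x", unfolded 4 refl_along_simps]]
      by (simp add: 4 kernel_coeff_def graded_coeff_refl add.commute power_minus[of "x $ 1"] power_minus[of "x $ 2"] power_add mult_ac)
  qed
  then show ?thesis using h by (rule has_sum_unique)
qed

section \<open>The series solves the Dunkl equations off the walls\<close>

text \<open>The algebraic core of the commutativity of the Dunkl operators. The letters stand for values at the
orbit of \<open>(u, v)\<close> under the group: \<open>E0\<close> at \<open>(u, v)\<close>, \<open>Ea\<close> at \<open>(-u, v)\<close>, \<open>Eb\<close> at \<open>(u, -v)\<close>, \<open>Ec\<close> at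
\<open>(-u, -v)\<close>, \<open>Ed\<close> at \<open>(v, u)\<close>, \<open>Ee\<close> at \<open>(-v, -u)\<close>, \<open>Ef\<close> at \<open>(v, -u)\<close> and \<open>Eg\<close> at \<open>(-v, u)\<close>. \<open>G\<close> and
\<open>H\<close> are the partial derivatives, \<open>R\<close> the radial derivatives of the kernel, \<open>S\<close> that of \<open>G\<close> or \<open>H\<close>, and \<open>q\<close>
the defects. The reciprocals \<open>a\<close>, \<open>b\<close>, \<open>c\<close>, \<open>d\<close> of the linear forms keep the identities polynomial.\<close>

lemma defect1_identity:
  fixes u v a c d y1 y2 k1 k2 E0 Ea Eb Ec Ed Ee Ef Eg G0 Ga Gb Hd He :: real
  assumes "a * u = 1" "c * (u - v) = 1" "d * (u + v) = 1"
    and "R0 = (u * y1 + v * y2) * E0 - k1 * (2 * E0 - Ea - Eb) - k2 * (2 * E0 - Ed - Ee)"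
    and "Ra = (-u * y1 + v * y2) * Ea - k1 * (2 * Ea - E0 - Ec) - k2 * (2 * Ea - Ef - Eg)"
    and "Rd = (v * y1 + u * y2) * Ed - k1 * (2 * Ed - Eg - Ef) - k2 * (2 * Ed - E0 - Ec)"
    and "Rr = (-v * y1 - u * y2) * Ee - k1 * (2 * Ee - Ef - Eg) - k2 * (2 * Ee - Ec - E0)"
    and "S = y1 * E0 + (u * y1 + v * y2) * G0 - G0 - k1 * (2 * G0 + Ga - Gb) - k2 * (2 * G0 - Hd + He)"
    and "q = G0 - y1 * E0 + k1 * ((E0 - Ea) * a) + k2 * ((E0 - Ed) * c + (E0 - Ee) * d)"
    and "qa = Ga - y1 * Ea + k1 * ((Ea - E0) * (-a)) + k2 * ((Ea - Ef) * (-d) + (Ea - Eg) * (-c))"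
    and "qb = Gb - y1 * Eb + k1 * ((Eb - Ec) * a) + k2 * ((Eb - Eg) * d + (Eb - Ef) * c)"
    and "qd = Hd - y2 * Ed + k1 * ((Ed - Ef) * a) + k2 * ((Ed - Ec) * d - (Ed - E0) * (-c))"
    and "qe = He - y2 * Ee + k1 * ((Ee - Eg) * (-a)) + k2 * ((Ee - E0) * (-d) - (Ee - Ec) * c)"
  shows "S - y1 * R0 + k1 * (((R0 - Ra) - (E0 - Ea)) * a) + k2 * (((R0 - Rd) - (E0 - Ed)) * c + ((R0 - Rr) - (E0 - Ee)) * d)
     = (u * y1 + v * y2 - 1) * q - k1 * (2 * q + qa - qb) - k2 * (2 * q - qd + qe)"
  unfolding assms(4-) using assms(1-3) by algebra

lemma defect2_identity:
  fixes u v b c d y1 y2 k1 k2 E0 Ea Eb Ec Ed Ee Ef Eg H0 Ha Hb Gd Ge :: real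
  assumes "b * v = 1" "c * (u - v) = 1" "d * (u + v) = 1"
    and "R0 = (u * y1 + v * y2) * E0 - k1 * (2 * E0 - Ea - Eb) - k2 * (2 * E0 - Ed - Ee)"
    and "Rb = (u * y1 - v * y2) * Eb - k1 * (2 * Eb - Ec - E0) - k2 * (2 * Eb - Ef - Eg)"
    and "Rd = (v * y1 + u * y2) * Ed - k1 * (2 * Ed - Eg - Ef) - k2 * (2 * Ed - E0 - Ec)"
    and "Rr = (-v * y1 - u * y2) * Ee - k1 * (2 * Ee - Ef - Eg) - k2 * (2 * Ee - Ec - E0)"
    and "S = y2 * E0 + (u * y1 + v * y2) * H0 - H0 - k1 * (2 * H0 - Ha + Hb) - k2 * (2 * H0 - Gd + Ge)"
    and "q = H0 - y2 * E0 + k1 * ((E0 - Eb) * b) + k2 * ((E0 - Ee) * d - (E0 - Ed) * c)"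
    and "qa = Ha - y2 * Ea + k1 * ((Ea - Ec) * b) + k2 * ((Ea - Eg) * (-c) - (Ea - Ef) * (-d))"
    and "qb = Hb - y2 * Eb + k1 * ((Eb - E0) * (-b)) + k2 * ((Eb - Ef) * c - (Eb - Eg) * d)"
    and "qd = Gd - y1 * Ed + k1 * ((Ed - Eg) * b) + k2 * ((Ed - E0) * (-c) + (Ed - Ec) * d)"
    and "qe = Ge - y1 * Ee + k1 * ((Ee - Ef) * (-b)) + k2 * ((Ee - Ec) * c + (Ee - E0) * (-d))"
  shows "S - y2 * R0 + k1 * (((R0 - Rb) - (E0 - Eb)) * b) + k2 * (((R0 - Rr) - (E0 - Ee)) * d - ((R0 - Rd) - (E0 - Ed)) * c)
     = (u * y1 + v * y2 - 1) * q - k1 * (2 * q - qa + qb) - k2 * (2 * q - qd + qe)"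
  unfolding assms(4-) using assms(1-3) by algebra

context
  fixes k :: "real \<times> real" and y :: "real^2"
  assumes k: "fst k \<ge> 0" "snd k \<ge> 0"
begin

abbreviation "E \<equiv> dunkl_series k y"
abbreviation "E1 \<equiv> dunkl_partial1 k y"
abbreviation "E2 \<equiv> dunkl_partial2 k y"

lemma dunkl_series_has_derivative:
  "(E has_derivative (\<lambda>h. E1 x * h $ 1 + E2 x * h $ 2)) (at x)"
  unfolding dunkl_series_def dunkl_partial1_def dunkl_partial2_def
  by (rule double_series_has_derivative[OF dunkl_series_entire[OF k]])

text \<open>The amount by which the Dunkl equation in a coordinate direction fails, off the walls. On a wall
the inverse of the vanishing linear form is \<open>0\<close> by convention, and the value carries no meaning.\<close>

definition defect1 :: "real^2 \<Rightarrow> real" where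
  "defect1 x = E1 x - y $ 1 * E x
    + fst k * ((E x - E (refl_along e1 x)) * inverse (x $ 1))
    + snd k * ((E x - E (refl_along (e1 - e2) x)) * inverse (x $ 1 - x $ 2)
             + (E x - E (refl_along (e1 + e2) x)) * inverse (x $ 1 + x $ 2))"

definition defect2 :: "real^2 \<Rightarrow> real" where
  "defect2 x = E2 x - y $ 2 * E x
    + fst k * ((E x - E (refl_along e2 x)) * inverse (x $ 2))
    + snd k * ((E x - E (refl_along (e1 + e2) x)) * inverse (x $ 1 + x $ 2)
             - (E x - E (refl_along (e1 - e2) x)) * inverse (x $ 1 - x $ 2))"

definition radial_rhs :: "real^2 \<Rightarrow> real" where
  "radial_rhs x = (x \<bullet> y) * E x
    - fst k * (2 * E x - E (refl_along e1 x) - E (refl_along e2 x))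
    - snd k * (2 * E x - E (refl_along (e1 - e2) x) - E (refl_along (e1 + e2) x))"

lemma radial_rhs: "x $ 1 * E1 x + x $ 2 * E2 x = radial_rhs x"
  using dunkl_series_radial[OF k, of x y] by (simp add: sum_pos_roots root_mult_simps radial_rhs_def algebra_simps)

lemma ray_derivative:
  assumes "(F has_derivative (\<lambda>h. F1 * h $ 1 + F2 * h $ 2)) (at (x :: real^2))"
  shows "((\<lambda>t. F (t *\<^sub>R x)) has_real_derivative x $ 1 * F1 + x $ 2 * F2) (at 1)"
proof -
  have "((\<lambda>t. t *\<^sub>R x) has_derivative (\<lambda>h. h *\<^sub>R x)) (at (1::real))"
    by (auto intro!: derivative_eq_intros)
  then have "((\<lambda>t. F (t *\<^sub>R x)) has_derivative (\<lambda>h. F1 * (h *\<^sub>R x) $ 1 + F2 * (h *\<^sub>R x) $ 2)) (at 1)"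
    by (rule has_derivative_compose[where g = F]) (simp add: assms)
  then show ?thesis unfolding has_field_derivative_def
    by (rule has_derivative_eq_rhs) (simp add: fun_eq_iff algebra_simps)
qed

lemma ray_series: "((\<lambda>t. E (t *\<^sub>R x)) has_real_derivative radial_rhs x) (at 1)"
  using ray_derivative[OF dunkl_series_has_derivative] by (simp add: radial_rhs)

lemma second_derivatives:
  obtains a b c where
    "(E1 has_derivative (\<lambda>h. a * h $ 1 + b * h $ 2)) (at x)"
    "(E2 has_derivative (\<lambda>h. b * h $ 1 + c * h $ 2)) (at x)"
proof -
  have comm: "partial_coeffs1 (partial_coeffs2 c) = partial_coeffs2 (partial_coeffs1 c)" for c
    by (simp add: partial_coeffs1_def partial_coeffs2_def fun_eq_iff)
  note ent = dunkl_series_entire[OF k, of y]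
  show ?thesis
    using double_series_has_derivative[OF entire_partial_coeffs1[OF ent], of x] double_series_has_derivative[OF entire_partial_coeffs2[OF ent], of x]
    unfolding comm dunkl_partial1_def[symmetric] dunkl_partial2_def[symmetric] by (rule that)
qed

text \<open>Differentiating the radial equation in the two coordinates; the mixed second derivatives agree.\<close>

lemma ray_series_derivatives:
  "((\<lambda>t. E1 (t *\<^sub>R x)) has_real_derivative
      y $ 1 * E x + (x \<bullet> y) * E1 x - E1 x
      - fst k * (2 * E1 x + E1 (refl_along e1 x) - E1 (refl_along e2 x))
      - snd k * (2 * E1 x - E2 (refl_along (e1 - e2) x) + E2 (refl_along (e1 + e2) x))) (at 1)" (is ?A)
  "((\<lambda>t. E2 (t *\<^sub>R x)) has_real_derivative
      y $ 2 * E x + (x \<bullet> y) * E2 x - E2 x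
      - fst k * (2 * E2 x - E2 (refl_along e1 x) + E2 (refl_along e2 x))
      - snd k * (2 * E2 x - E1 (refl_along (e1 - e2) x) + E1 (refl_along (e1 + e2) x))) (at 1)" (is ?B)
proof -
  obtain a b c where
    d1: "(E1 has_derivative (\<lambda>h. a * h $ 1 + b * h $ 2)) (at x)" and
    d2: "(E2 has_derivative (\<lambda>h. b * h $ 1 + c * h $ 2)) (at x)"
    by (rule second_derivatives)
  note d0 = dunkl_series_has_derivative
  have dr: "((\<lambda>x. E (refl_along \<alpha> x)) has_derivative
      (\<lambda>h. E1 (refl_along \<alpha> x) * refl_along \<alpha> h $ 1 + E2 (refl_along \<alpha> x) * refl_along \<alpha> h $ 2)) (at x)" for \<alpha>
    by (rule has_derivative_compose[OF linear_imp_has_derivative[OF linear_refl] d0])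
  have v: "((\<lambda>x. x $ i) has_derivative (\<lambda>h. h $ i)) (at x)" for i and x :: "real^2"
    by (rule bounded_linear_imp_has_derivative[OF bounded_linear_vec_nth])
  define P where "P = (\<lambda>x :: real^2. x $ 1 * E1 x + x $ 2 * E2 x)"
  define P' where "P' = (\<lambda>h :: real^2. x $ 1 * (a * h $ 1 + b * h $ 2) + h $ 1 * E1 x
       + (x $ 2 * (b * h $ 1 + c * h $ 2) + h $ 2 * E2 x))"
  have DP: "(P has_derivative P') (at x)"
    unfolding P_def P'_def by (intro has_derivative_add has_derivative_mult v d1 d2)
  define D where "D = (\<lambda>h :: real^2. E1 x * h $ 1 + E2 x * h $ 2)"
  define D' where "D' = (\<lambda>\<alpha> (h :: real^2). E1 (refl_along \<alpha> x) * refl_along \<alpha> h $ 1 + E2 (refl_along \<alpha> x) * refl_along \<alpha> h $ 2)"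
  have "(radial_rhs has_derivative (\<lambda>h. (x \<bullet> y) * D h + (h \<bullet> y) * E x
      - fst k * (2 * D h - D' e1 h - D' e2 h) - snd k * (2 * D h - D' (e1 - e2) h - D' (e1 + e2) h))) (at x)"
    unfolding radial_rhs_def[abs_def] D_def D'_def
    by (intro has_derivative_diff has_derivative_mult has_derivative_mult_right d0 dr
        bounded_linear_imp_has_derivative[OF bounded_linear_inner_left])
  moreover have "P = radial_rhs" by (simp add: P_def fun_eq_iff radial_rhs)
  ultimately have eq: "P' = (\<lambda>h. (x \<bullet> y) * D h + (h \<bullet> y) * E x
      - fst k * (2 * D h - D' e1 h - D' e2 h) - snd k * (2 * D h - D' (e1 - e2) h - D' (e1 + e2) h))"
    using DP has_derivative_unique by blast
  show ?A
    by (rule DERIV_cong[OF ray_derivative[OF d1]])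
      (use fun_cong[OF eq, of e1] in \<open>simp add: P'_def D_def D'_def inner_root_simps axis_components algebra_simps\<close>)
  show ?B
    by (rule DERIV_cong[OF ray_derivative[OF d2]])
      (use fun_cong[OF eq, of e2] in \<open>simp add: P'_def D_def D'_def inner_root_simps axis_components algebra_simps\<close>)
qed

text \<open>Scaling \<open>x\<close> by \<open>t\<close> and differentiating at \<open>t = 1\<close> gives the radial derivative. The relation reflects
\<open>T\<^sub>x T\<^sub>\<xi> E = T\<^sub>\<xi> T\<^sub>x E\<close>, with \<open>T\<^sub>x\<close> the operator in the direction of the variable, up to the commutator of
\<open>T\<^sub>\<xi>\<close> with multiplication by coordinates, which contributes the \<open>- 1\<close> and the reflected directions.\<close>

lemma defect_ray:
  assumes reg: "x $ 1 \<noteq> 0" "x $ 2 \<noteq> 0" "x $ 1 - x $ 2 \<noteq> 0" "x $ 1 + x $ 2 \<noteq> 0"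
  shows "((\<lambda>t. defect1 (t *\<^sub>R x)) has_real_derivative (x \<bullet> y - 1) * defect1 x
      - fst k * (2 * defect1 x + defect1 (refl_along e1 x) - defect1 (refl_along e2 x))
      - snd k * (2 * defect1 x - defect2 (refl_along (e1 - e2) x) + defect2 (refl_along (e1 + e2) x))) (at 1)" (is ?A)
    and "((\<lambda>t. defect2 (t *\<^sub>R x)) has_real_derivative (x \<bullet> y - 1) * defect2 x
      - fst k * (2 * defect2 x - defect2 (refl_along e1 x) + defect2 (refl_along e2 x))
      - snd k * (2 * defect2 x - defect1 (refl_along (e1 - e2) x) + defect1 (refl_along (e1 + e2) x))) (at 1)" (is ?B)
proof -
  define u v where "u = x $ 1" and "v = x $ 2"
  have x: "x = vector [u, v]" by (simp add: u_def v_def vec_eq_iff forall_2)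
  have neg: "- u - v = - (u + v)" "v - u = - (u - v)" "v + u = u + v" "- u + v = - (u - v)" "- v - u = - (u + v)" "- v + u = u - v"
    by simp_all
  have inv: "inverse (- u - v) = - inverse (u + v)" "inverse (v - u) = - inverse (u - v)" "inverse (v + u) = inverse (u + v)"
    "inverse (- u + v) = - inverse (u - v)" "inverse (- v - u) = - inverse (u + v)" "inverse (- v + u) = inverse (u - v)"
    by (simp_all only: neg inverse_minus_eq)
  have i: "((\<lambda>t. inverse (t * r)) has_real_derivative - inverse r) (at 1)" if "r \<noteq> 0" for r :: real
    using that by (auto intro!: derivative_eq_intros simp: power2_eq_square field_simps)
  have diff: "((\<lambda>t. (E (t *\<^sub>R x) - E (t *\<^sub>R z)) * inverse (t * r)) has_real_derivative
      ((radial_rhs x - radial_rhs z) - (E x - E z)) * inverse r) (at 1)" if "r \<noteq> 0" for r z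
    by (rule DERIV_cong[OF DERIV_mult[OF DERIV_diff[OF ray_series ray_series] i[OF that]]]) (simp add: algebra_simps)
  note R = radial_rhs_def[unfolded inner_2]
  have inverses: "inverse u * u = 1" "inverse v * v = 1" "inverse (u - v) * (u - v) = 1" "inverse (u + v) * (u + v) = 1"
    unfolding u_def v_def by (rule left_inverse, fact)+
  show ?A
  proof -
    have eq: "(\<lambda>t. defect1 (t *\<^sub>R x)) = (\<lambda>t. E1 (t *\<^sub>R x) - y $ 1 * E (t *\<^sub>R x)
      + fst k * ((E (t *\<^sub>R x) - E (t *\<^sub>R refl_along e1 x)) * inverse (t * u))
      + snd k * ((E (t *\<^sub>R x) - E (t *\<^sub>R refl_along (e1 - e2) x)) * inverse (t * (u - v))
               + (E (t *\<^sub>R x) - E (t *\<^sub>R refl_along (e1 + e2) x)) * inverse (t * (u + v))))"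
      by (simp add: defect1_def refl_scaleR u_def v_def right_diff_distrib distrib_left)
    note D = DERIV_add[OF DERIV_add[OF DERIV_diff[OF ray_series_derivatives(1) DERIV_cmult[OF ray_series]] DERIV_cmult[OF diff]]
        DERIV_cmult[OF DERIV_add[OF diff diff]]]
    show ?thesis unfolding eq
    proof (rule DERIV_cong[OF D], goal_cases)
      case 4
      show ?case unfolding inner_2 u_def[symmetric] v_def[symmetric]
        by (rule defect1_identity[OF inverses(1,3,4), where Eb = "E (vector [u, -v])"
           and Ec = "E (vector [-u, -v])" and Ef = "E (vector [v, -u])" and Eg = "E (vector [-v, u])"])
          (simp_all add: x R defect1_def defect2_def inv)
    qed (use reg in \<open>simp_all only: u_def v_def, simp_all\<close>)
  qed
  show ?B
  proof -
    have eq: "(\<lambda>t. defect2 (t *\<^sub>R x)) = (\<lambda>t. E2 (t *\<^sub>R x) - y $ 2 * E (t *\<^sub>R x)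
      + fst k * ((E (t *\<^sub>R x) - E (t *\<^sub>R refl_along e2 x)) * inverse (t * v))
      + snd k * ((E (t *\<^sub>R x) - E (t *\<^sub>R refl_along (e1 + e2) x)) * inverse (t * (u + v))
               - (E (t *\<^sub>R x) - E (t *\<^sub>R refl_along (e1 - e2) x)) * inverse (t * (u - v))))"
      by (simp add: defect2_def refl_scaleR u_def v_def right_diff_distrib distrib_left)
    note D = DERIV_add[OF DERIV_add[OF DERIV_diff[OF ray_series_derivatives(2) DERIV_cmult[OF ray_series]] DERIV_cmult[OF diff]]
        DERIV_cmult[OF DERIV_diff[OF diff diff]]]
    show ?thesis unfolding eq
    proof (rule DERIV_cong[OF D], goal_cases)
      case 4
      show ?case unfolding inner_2 u_def[symmetric] v_def[symmetric]
        by (rule defect2_identity[OF inverses(2,3,4), where Ea = "E (vector [-u, v])"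
           and Ec = "E (vector [-u, -v])" and Ef = "E (vector [v, -u])" and Eg = "E (vector [-v, u])"])
          (simp_all add: x R defect1_def defect2_def inv)
    qed (use reg in \<open>simp_all only: u_def v_def, simp_all\<close>)
  qed
qed

end

text \<open>The right-hand side of the radial system on the orbit of \<open>x\<close>, multiplied by \<open>t\<close> and written for functions on
the group; the states are the points \<open>w x\<close> and \<open>y\<close> is fixed.\<close>

definition weyl_ray_op :: "real \<times> real \<Rightarrow> real^2 \<Rightarrow> real^2 \<Rightarrow> real \<Rightarrow> (weyl \<Rightarrow> real) \<Rightarrow> weyl \<Rightarrow> real" where
  "weyl_ray_op k x y t F w = t * (Rep_weyl w x \<bullet> y) * F w
     - (\<Sum>\<alpha>\<in>pos_roots. root_mult k \<alpha> * (F w - F (lmult_refl \<alpha> w)))"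

lemma weyl_ray_zero:
  assumes k: "fst k \<ge> 0" "snd k \<ge> 0"
    and der: "\<And>w t. t > 0 \<Longrightarrow> ((\<lambda>t. F t w) has_real_derivative (1 / t) * weyl_ray_op k x y t (F t) w) (at t)"
    and lim: "\<And>w. ((\<lambda>t. F t w) \<longlongrightarrow> 0) (at_right 0)" and t: "t > 0"
  shows "F t w = 0"
proof -
  interpret W: reflection_system pos_roots "root_mult k" lmult_refl by (rule weyl_reflection_system[OF k])
  define d where "d = (\<chi> w. Rep_weyl w x \<bullet> y)"
  define U where "U = (\<lambda>t. \<chi> w. F t w)"
  have "U t = 0"
  proof (rule W.radial_zero[of U d])
    fix t :: real assume t: "t > 0"
    show "(U has_vector_derivative (1 / t) *\<^sub>R W.ham (t *\<^sub>R d) (U t)) (at t)"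
      by (rule has_vector_derivative_vec) (use der[OF t] in \<open>simp add: U_def W.ham_def W.lap_def d_def weyl_ray_op_def mult.assoc\<close>)
  next
    have "(U \<longlongrightarrow> (\<chi> w. 0)) (at_right 0)" unfolding U_def by (intro tendsto_vec_lambda lim)
    moreover have "(\<chi> w. 0) = (0 :: real^weyl)" by (simp add: vec_eq_iff)
    ultimately show "(U \<longlongrightarrow> 0) (at_right 0)" by simp
  qed (fact t)
  then show ?thesis by (simp add: U_def vec_eq_iff)
qed

definition regular :: "real^2 \<Rightarrow> bool" where
  "regular x \<longleftrightarrow> (\<forall>\<alpha>\<in>pos_roots. \<alpha> \<bullet> x \<noteq> 0)"

lemma regular_iff: "regular x \<longleftrightarrow> x $ 1 \<noteq> 0 \<and> x $ 2 \<noteq> 0 \<and> x $ 1 + x $ 2 \<noteq> 0 \<and> x $ 1 - x $ 2 \<noteq> 0"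
  by (auto simp: regular_def pos_roots_def inner_root_simps)

lemma regular_refl: "\<alpha> \<in> pos_roots \<Longrightarrow> regular x \<Longrightarrow> regular (refl_along \<alpha> x)"
  by (auto simp: regular_iff pos_roots_def)

lemma regular_weyl: "regular x \<Longrightarrow> regular (Rep_weyl w x)"
  by (induction w rule: weyl_induct) (auto simp: Rep_weyl_one Rep_lmult_refl regular_refl)

lemma regular_scaleR: "t \<noteq> 0 \<Longrightarrow> regular x \<Longrightarrow> regular (t *\<^sub>R x)"
  by (auto simp: regular_def)

lemma ray_rescale:
  fixes x :: "real^2"
  assumes "((\<lambda>s. f (s *\<^sub>R (t *\<^sub>R x))) has_real_derivative D) (at 1)" "t > 0"
  shows "((\<lambda>s. f (s *\<^sub>R x)) has_real_derivative D / t) (at t)"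
proof -
  have "((\<lambda>s. s / t) has_real_derivative 1 / t) (at t)"
    by (rule DERIV_cdivide[OF DERIV_ident])
  then have "((\<lambda>s. f ((s / t) *\<^sub>R (t *\<^sub>R x))) has_real_derivative D * (1 / t)) (at t)"
    using DERIV_chain2[of "\<lambda>s. f (s *\<^sub>R (t *\<^sub>R x))" D "\<lambda>s. s / t" t "1 / t" UNIV] assms by simp
  moreover have eq: "(s / t) *\<^sub>R (t *\<^sub>R x) = s *\<^sub>R x" for s using assms(2) by simp
  ultimately show ?thesis unfolding eq by simp
qed

context
  fixes k :: "real \<times> real" and y :: "real^2"
  assumes k: "fst k \<ge> 0" "snd k \<ge> 0"
begin

lemma continuous_dunkl_series:
  "isCont (dunkl_series k y) x" "isCont (dunkl_partial1 k y) x" "isCont (dunkl_partial2 k y) x"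
  using double_series_has_derivative[OF dunkl_series_entire[OF k, of y]]
    double_series_has_derivative[OF entire_partial_coeffs1[OF dunkl_series_entire[OF k, of y]]]
    double_series_has_derivative[OF entire_partial_coeffs2[OF dunkl_series_entire[OF k, of y]]]
  unfolding dunkl_series_def dunkl_partial1_def dunkl_partial2_def
  by (blast intro: has_derivative_continuous)+

definition defect :: "real^2 \<Rightarrow> real^2 \<Rightarrow> real" where
  "defect \<xi> x = \<xi> $ 1 * defect1 k y x + \<xi> $ 2 * defect2 k y x"

text \<open>Letting the direction be reflected together with the point removes all signs: the family
\<open>w \<mapsto> defect (w \<xi>) (w x)\<close> satisfies a radial system on the group.\<close>

lemma defect_ray_vector:
  assumes "regular x"
  shows "((\<lambda>t. defect \<xi> (t *\<^sub>R x)) has_real_derivative (x \<bullet> y - 1) * defect \<xi> x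
     - (\<Sum>\<alpha>\<in>pos_roots. root_mult k \<alpha> * (defect \<xi> x - defect (refl_along \<alpha> \<xi>) (refl_along \<alpha> x)))) (at 1)"
proof -
  have reg: "x $ 1 \<noteq> 0" "x $ 2 \<noteq> 0" "x $ 1 - x $ 2 \<noteq> 0" "x $ 1 + x $ 2 \<noteq> 0"
    using assms by (auto simp: regular_iff)
  show ?thesis
    unfolding defect_def
    by (rule DERIV_cong[OF DERIV_add[OF DERIV_cmult[OF defect_ray(1)[OF k reg]] DERIV_cmult[OF defect_ray(2)[OF k reg]]]])
      (simp add: sum_pos_roots root_mult_simps algebra_simps)
qed

text \<open>The quotients in the defect have a denominator of order \<open>t\<close>, while their numerators tend to \<open>0\<close>.\<close>

lemma scaled_defect_tendsto:
  assumes "regular x"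
  shows "((\<lambda>t. t * defect \<xi> (t *\<^sub>R x)) \<longlongrightarrow> 0) (at_right 0)"
proof -
  have tx: "((\<lambda>t. t *\<^sub>R z) \<longlongrightarrow> 0 *\<^sub>R z) (at_right (0::real))" for z :: "real^2" by (intro tendsto_intros)
  have c0: "((\<lambda>t. dunkl_series k y (t *\<^sub>R z)) \<longlongrightarrow> dunkl_series k y 0) (at_right 0)"
    and c1: "((\<lambda>t. dunkl_partial1 k y (t *\<^sub>R z)) \<longlongrightarrow> dunkl_partial1 k y 0) (at_right 0)"
    and c2: "((\<lambda>t. dunkl_partial2 k y (t *\<^sub>R z)) \<longlongrightarrow> dunkl_partial2 k y 0) (at_right 0)" for z
    using continuous_dunkl_series[of 0, THEN isCont_tendsto_compose, OF tx[of z, simplified]] by auto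
  have q: "((\<lambda>t. (dunkl_series k y (t *\<^sub>R x) - dunkl_series k y (t *\<^sub>R z)) * inverse r) \<longlongrightarrow> 0) (at_right 0)" for z r
    using tendsto_mult[OF tendsto_diff[OF c0[of x] c0[of z]] tendsto_const[of "inverse r"]] by simp
  have t0: "((\<lambda>t. t) \<longlongrightarrow> 0) (at_right (0::real))" by (rule tendsto_ident_at)
  let ?E = "\<lambda>t z. dunkl_series k y (t *\<^sub>R z)"
  define n1 where "n1 = (\<lambda>t. t * (dunkl_partial1 k y (t *\<^sub>R x) - y $ 1 * ?E t x)
       + fst k * ((?E t x - ?E t (refl_along e1 x)) * inverse (x $ 1))
       + snd k * ((?E t x - ?E t (refl_along (e1 - e2) x)) * inverse (x $ 1 - x $ 2)
                + (?E t x - ?E t (refl_along (e1 + e2) x)) * inverse (x $ 1 + x $ 2)))"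
  define n2 where "n2 = (\<lambda>t. t * (dunkl_partial2 k y (t *\<^sub>R x) - y $ 2 * ?E t x)
       + fst k * ((?E t x - ?E t (refl_along e2 x)) * inverse (x $ 2))
       + snd k * ((?E t x - ?E t (refl_along (e1 + e2) x)) * inverse (x $ 1 + x $ 2)
                - (?E t x - ?E t (refl_along (e1 - e2) x)) * inverse (x $ 1 - x $ 2)))"
  have "(n1 \<longlongrightarrow> 0 * (dunkl_partial1 k y 0 - y $ 1 * dunkl_series k y 0) + fst k * 0 + snd k * (0 + 0)) (at_right 0)"
    unfolding n1_def by (intro tendsto_add tendsto_diff[OF c1 tendsto_mult[OF tendsto_const c0]] tendsto_mult tendsto_const q t0)
  moreover have "(n2 \<longlongrightarrow> 0 * (dunkl_partial2 k y 0 - y $ 2 * dunkl_series k y 0) + fst k * 0 + snd k * (0 - 0)) (at_right 0)"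
    unfolding n2_def by (intro tendsto_add tendsto_diff[OF c2 tendsto_mult[OF tendsto_const c0]] tendsto_diff[OF q q] tendsto_mult[OF t0] tendsto_mult[OF tendsto_const] q)
  ultimately have "((\<lambda>t. \<xi> $ 1 * n1 t + \<xi> $ 2 * n2 t) \<longlongrightarrow> \<xi> $ 1 * 0 + \<xi> $ 2 * 0) (at_right 0)"
    by (intro tendsto_add tendsto_mult tendsto_const) simp_all
  then have lim: "((\<lambda>t. \<xi> $ 1 * n1 t + \<xi> $ 2 * n2 t) \<longlongrightarrow> 0) (at_right 0)" by simp
  show ?thesis
  proof (rule Lim_transform_eventually[OF lim])
    show "eventually (\<lambda>t. \<xi> $ 1 * n1 t + \<xi> $ 2 * n2 t = t * defect \<xi> (t *\<^sub>R x)) (at_right 0)"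
      unfolding eventually_at_right_field
    proof (intro exI[of _ 1] conjI allI impI)
      fix t :: real assume t: "0 < t" "t < 1"
      have i: "inverse ((t *\<^sub>R x) $ 1) = inverse (x $ 1) / t" "inverse ((t *\<^sub>R x) $ 2) = inverse (x $ 2) / t"
        "inverse ((t *\<^sub>R x) $ 1 - (t *\<^sub>R x) $ 2) = inverse (x $ 1 - x $ 2) / t"
        "inverse ((t *\<^sub>R x) $ 1 + (t *\<^sub>R x) $ 2) = inverse (x $ 1 + x $ 2) / t"
        by (simp_all add: right_diff_distrib[symmetric] distrib_left[symmetric] divide_inverse mult.commute)
      have r1: "t * (a + p * (b * (i / t)) + q * (c * (j / t) + d * (l / t))) = t * a + p * (b * i) + q * (c * j + d * l)"
        and r2: "t * (a + p * (b * (i / t)) + q * (c * (j / t) - d * (l / t))) = t * a + p * (b * i) + q * (c * j - d * l)"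
        for a b c d i j l p q :: real using t by (simp_all add: field_simps)
      have "t * defect1 k y (t *\<^sub>R x) = n1 t" "t * defect2 k y (t *\<^sub>R x) = n2 t"
        unfolding n1_def n2_def defect1_def[OF k] defect2_def[OF k] refl_scaleR i r1 r2 by (rule refl)+
      then show "\<xi> $ 1 * n1 t + \<xi> $ 2 * n2 t = t * defect \<xi> (t *\<^sub>R x)"
        unfolding defect_def by (simp only: distrib_left mult.left_commute[of t])
    qed simp
  qed
qed

text \<open>The factor \<open>t\<close> absorbs the \<open>- 1\<close> in the radial equation of the defect and makes the initial value \<open>0\<close>, so
that the energy estimate applies.\<close>

lemma defect_zero:
  assumes x: "regular x"
  shows "defect \<xi> x = 0"
proof -
  define F where "F = (\<lambda>t w. t * defect (Rep_weyl w \<xi>) (t *\<^sub>R Rep_weyl w x))"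
  have "F 1 weyl_one = 0"
  proof (rule weyl_ray_zero[OF k, of F x y])
    fix w and t :: real assume t: "t > 0"
    define z \<zeta> where "z = Rep_weyl w x" and "\<zeta> = Rep_weyl w \<xi>"
    define S where "S = (\<Sum>\<alpha>\<in>pos_roots. root_mult k \<alpha> * (defect \<zeta> (t *\<^sub>R z) - defect (refl_along \<alpha> \<zeta>) (refl_along \<alpha> (t *\<^sub>R z))))"
    define D where "D = ((t *\<^sub>R z) \<bullet> y - 1) * defect \<zeta> (t *\<^sub>R z) - S"
    have "((\<lambda>s. defect \<zeta> (s *\<^sub>R z)) has_real_derivative D / t) (at t)"
      unfolding D_def S_def using x t by (intro ray_rescale defect_ray_vector) (auto simp: z_def regular_weyl regular_scaleR)
    from DERIV_mult[OF DERIV_ident this]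
    have "((\<lambda>t. F t w) has_real_derivative 1 * defect \<zeta> (t *\<^sub>R z) + D / t * t) (at t)"
      by (simp add: F_def z_def \<zeta>_def)
    moreover have "1 * defect \<zeta> (t *\<^sub>R z) + D / t * t = (1 / t) * weyl_ray_op k x y t (F t) w"
    proof -
      have "(\<Sum>\<alpha>\<in>pos_roots. root_mult k \<alpha> * (F t w - F t (lmult_refl \<alpha> w))) = t * S"
        unfolding sum_distrib_left S_def
        by (rule sum.cong[OF refl]) (simp add: F_def Rep_lmult_refl z_def \<zeta>_def refl_scaleR algebra_simps)
      moreover have "F t w = t * defect \<zeta> (t *\<^sub>R z)" by (simp add: F_def z_def \<zeta>_def)
      ultimately have "weyl_ray_op k x y t (F t) w = t * (z \<bullet> y) * (t * defect \<zeta> (t *\<^sub>R z)) - t * S"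
        unfolding weyl_ray_op_def z_def by simp
      then show ?thesis using t by (simp add: D_def field_simps)
    qed
    ultimately show "((\<lambda>t. F t w) has_real_derivative (1 / t) * weyl_ray_op k x y t (F t) w) (at t)" by simp
  next
    show "((\<lambda>t. F t w) \<longlongrightarrow> 0) (at_right 0)" for w
      unfolding F_def by (rule scaled_defect_tendsto[OF regular_weyl[OF x]])
  qed simp
  then show ?thesis by (simp add: F_def Rep_weyl_one)
qed

end

section \<open>Existence and uniqueness of the Dunkl kernel\<close>

lemma islimpt_regular: "x islimpt {z. regular z}"
  unfolding islimpt_approachable
proof (intro allI impI)
  fix e :: real assume e: "e > 0"
  \<comment> \<open>a direction off all four walls, so that each wall excludes a single step length\<close>
  define v :: "real^2" where "v = vector [2, 1]"
  have v: "v $ 1 = 2" "v $ 2 = 1" by (simp_all add: v_def)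
  have nv: "norm v > 0" by (metis v(2) zero_index zero_less_norm_iff zero_neq_one)
  define B where "B = {- (x $ 1) / 2, - (x $ 2), - (x $ 1 + x $ 2) / 3, - (x $ 1 - x $ 2)}"
  have "infinite ({0<..<e / norm v} - B)" using e nv by (intro Diff_infinite_finite) (auto simp: B_def)
  then obtain s where s: "s \<in> {0<..<e / norm v}" "s \<notin> B" by (metis DiffE ex_in_conv finite.emptyI)
  have "regular (x + s *\<^sub>R v)" using s(2) by (auto simp: regular_iff v B_def)
  moreover have "x + s *\<^sub>R v \<noteq> x" using s(1) nv by auto
  moreover have "dist (x + s *\<^sub>R v) x < e" using s(1) nv by (simp add: dist_norm pos_less_divide_eq)
  ultimately show "\<exists>x'\<in>{z. regular z}. x' \<noteq> x \<and> dist x' x < e" by blast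
qed

lemma refl_diff: "x - refl_along \<alpha> x = (\<alpha> \<bullet> x) *\<^sub>R ((2 / (\<alpha> \<bullet> \<alpha>)) *\<^sub>R \<alpha>)"
  by (simp add: refl_along_def)

text \<open>By the mean value theorem the quotient equals the derivative of \<open>f\<close> in the direction of the coroot at a
point between \<open>z\<close> and its mirror image, both of which tend to \<open>x\<close>.\<close>

lemma wall_quotient_tendsto:
  fixes f :: "real^2 \<Rightarrow> real"
  assumes f: "\<And>z. (f has_derivative D z) (at z)" and \<alpha>: "\<alpha> \<noteq> 0" and wall: "\<alpha> \<bullet> x = 0"
    and cont: "isCont (\<lambda>z. D z ((2 / (\<alpha> \<bullet> \<alpha>)) *\<^sub>R \<alpha>)) x"
  shows "((\<lambda>z. (f z - f (refl_along \<alpha> z)) / (\<alpha> \<bullet> z)) \<longlongrightarrow> D x ((2 / (\<alpha> \<bullet> \<alpha>)) *\<^sub>R \<alpha>)) (at x within {z. \<alpha> \<bullet> z \<noteq> 0})"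
proof -
  define v where "v = (2 / (\<alpha> \<bullet> \<alpha>)) *\<^sub>R \<alpha>"
  have mv: "\<exists>w. dist w x \<le> dist z x \<and> (f z - f (refl_along \<alpha> z)) / (\<alpha> \<bullet> z) = D w v" if z: "\<alpha> \<bullet> z \<noteq> 0" for z
  proof -
    define p where "p = (\<lambda>s::real. refl_along \<alpha> z + s *\<^sub>R (z - refl_along \<alpha> z))"
    have "((\<lambda>s. f (p s)) has_real_derivative D (p s) (z - refl_along \<alpha> z)) (at s)" for s
    proof -
      have "(p has_derivative (\<lambda>h. h *\<^sub>R (z - refl_along \<alpha> z))) (at s)"
        unfolding p_def by (auto intro!: derivative_eq_intros)
      from has_derivative_compose[OF this f]
      have "((\<lambda>s. f (p s)) has_derivative (\<lambda>h. D (p s) (h *\<^sub>R (z - refl_along \<alpha> z)))) (at s)" .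
      then show ?thesis unfolding has_field_derivative_def
        by (rule has_derivative_eq_rhs) (simp add: fun_eq_iff linear_scale[OF has_derivative_linear[OF f]])
    qed
    then obtain s :: real where s: "0 < s" "s < 1" "f (p 1) - f (p 0) = (1 - 0) * D (p s) (z - refl_along \<alpha> z)"
      using MVT2[of 0 1 "\<lambda>s. f (p s)" "\<lambda>s. D (p s) (z - refl_along \<alpha> z)"] by auto
    have "f z - f (refl_along \<alpha> z) = (\<alpha> \<bullet> z) * D (p s) v"
    proof -
      have "p 1 = z" "p 0 = refl_along \<alpha> z" by (simp_all add: p_def)
      with s(3) show ?thesis
        unfolding refl_diff v_def[symmetric] linear_scale[OF has_derivative_linear[OF f]] by simp
    qed
    moreover have "dist (p s) x \<le> dist z x"
    proof -
      have "refl_along \<alpha> x = x" using wall by (simp add: refl_along_def)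
      then have "refl_along \<alpha> z - x = refl_along \<alpha> (z - x)" by (simp add: linear_diff[OF linear_refl])
      then have r: "norm (refl_along \<alpha> z - x) = norm (z - x)" by (simp add: norm_refl)
      have "p s - x = (1 - s) *\<^sub>R (refl_along \<alpha> z - x) + s *\<^sub>R (z - x)" by (simp add: p_def algebra_simps)
      then have "norm (p s - x) \<le> (1 - s) * norm (z - x) + s * norm (z - x)"
        using s r norm_triangle_ineq[of "(1 - s) *\<^sub>R (refl_along \<alpha> z - x)" "s *\<^sub>R (z - x)"] by simp
      then show ?thesis by (simp add: dist_norm algebra_simps)
    qed
    ultimately show ?thesis using z by (intro exI[of _ "p s"]) simp
  qed
  show ?thesis unfolding v_def[symmetric]
  proof (rule tendstoI)
    fix e :: real assume "e > 0"
    then obtain d where d: "d > 0" "\<And>w. dist w x < d \<Longrightarrow> dist (D w v) (D x v) < e"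
      using cont unfolding v_def[symmetric] continuous_at_eps_delta by blast
    have "dist ((f z - f (refl_along \<alpha> z)) / (\<alpha> \<bullet> z)) (D x v) < e" if "\<alpha> \<bullet> z \<noteq> 0" "dist z x < d" for z
      using mv[OF that(1)] d(2) that(2) by (metis le_less_trans)
    then show "eventually (\<lambda>z. dist ((f z - f (refl_along \<alpha> z)) / (\<alpha> \<bullet> z)) (D x v) < e) (at x within {z. \<alpha> \<bullet> z \<noteq> 0})"
      unfolding eventually_at using d(1) by blast
  qed
qed

lemma diff_quot_tendsto_regular:
  fixes f :: "real^2 \<Rightarrow> real"
  assumes f: "\<And>z. (f has_derivative D z) (at z)" and \<alpha>: "\<alpha> \<in> pos_roots"
    and cont: "\<And>v. isCont (\<lambda>z. D z v) x"
  shows "((\<lambda>z. (f z - f (refl_along \<alpha> z)) / (\<alpha> \<bullet> z)) \<longlongrightarrow> diff_quot \<alpha> f x) (at x within {z. regular z})"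
proof (cases "\<alpha> \<bullet> x = 0")
  case True
  have \<alpha>0: "\<alpha> \<noteq> 0" using \<alpha> by (rule root_nonzero)
  note lim = wall_quotient_tendsto[OF f \<alpha>0 True cont]
  have sub: "{z. regular z} \<subseteq> {z. \<alpha> \<bullet> z \<noteq> 0}" using \<alpha> by (auto simp: regular_def)
  then have "x islimpt {z. \<alpha> \<bullet> z \<noteq> 0}" using islimpt_regular islimpt_subset by blast
  then have "diff_quot \<alpha> f x = D x ((2 / (\<alpha> \<bullet> \<alpha>)) *\<^sub>R \<alpha>)"
    using True tendsto_Lim[OF _ lim] by (simp add: diff_quot_def trivial_limit_within)
  then show ?thesis using tendsto_within_subset[OF lim sub] by simp
next
  case False
  have c: "isCont f x" for x using f has_derivative_continuous by blast
  have "isCont (refl_along \<alpha>) x" using linear_refl linear_continuous_at linear_conv_bounded_linear by blast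
  then have "isCont (\<lambda>z. f (refl_along \<alpha> z)) x" by (rule isCont_o2) (rule c)
  then have "isCont (\<lambda>z. (f z - f (refl_along \<alpha> z)) / (\<alpha> \<bullet> z)) x" using False c by (intro continuous_intros) auto
  then have "((\<lambda>z. (f z - f (refl_along \<alpha> z)) / (\<alpha> \<bullet> z)) \<longlongrightarrow> diff_quot \<alpha> f x) (at x)"
    using False by (simp add: isCont_def diff_quot_def)
  then show ?thesis using tendsto_within_subset by blast
qed

context
  fixes k :: "real \<times> real" and y :: "real^2"
  assumes k: "fst k \<ge> 0" "snd k \<ge> 0"
begin

text \<open>Off the walls this is the vanishing of the defect; both sides extend continuously to the walls.\<close>

lemma dunkl_series_eigen:
  "dunkl_op k \<xi> (dunkl_series k y) x = (\<xi> \<bullet> y) * dunkl_series k y x"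
proof -
  define D where "D = (\<lambda>z h :: real^2. dunkl_partial1 k y z * h $ 1 + dunkl_partial2 k y z * h $ 2)"
  define E where "E = dunkl_series k y"
  have der: "(E has_derivative D z) (at z)" for z
    unfolding D_def E_def by (rule dunkl_series_has_derivative[OF k])
  have dd: "dir_deriv \<xi> E z = D z \<xi>" for z
    using frechet_derivative_at[OF der[of z]] by (simp add: dir_deriv_def)
  have cD: "isCont (\<lambda>z. D z h) z" for h z
    unfolding D_def by (intro continuous_intros continuous_dunkl_series[OF k])
  define Q where "Q = (\<lambda>z. \<Sum>\<alpha>\<in>pos_roots. root_mult k \<alpha> * (\<alpha> \<bullet> \<xi>) * ((E z - E (refl_along \<alpha> z)) / (\<alpha> \<bullet> z)))"
  have reg: "D z \<xi> + Q z = (\<xi> \<bullet> y) * E z"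
    if "regular z" for z
    using defect_zero[OF k that, of y \<xi>]
    by (simp add: Q_def defect_def[OF k] defect1_def[OF k] defect2_def[OF k] D_def E_def sum_pos_roots root_mult_simps inner_root_simps inner_2[of \<xi>] divide_inverse algebra_simps)
  have "((\<lambda>z. D z \<xi> + Q z) \<longlongrightarrow> dunkl_op k \<xi> E x) (at x within {z. regular z})"
    unfolding dunkl_op_def dd Q_def
  proof (intro tendsto_add tendsto_sum tendsto_mult tendsto_const)
    show "((\<lambda>z. D z \<xi>) \<longlongrightarrow> D x \<xi>) (at x within {z. regular z})"
      using cD[of x \<xi>] unfolding isCont_def by (rule tendsto_within_subset) simp
    show "((\<lambda>z. (E z - E (refl_along \<alpha> z)) / (\<alpha> \<bullet> z)) \<longlongrightarrow> diff_quot \<alpha> E x) (at x within {z. regular z})"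
      if "\<alpha> \<in> pos_roots" for \<alpha> using der that cD by (rule diff_quot_tendsto_regular)
  qed
  moreover have "((\<lambda>z. (\<xi> \<bullet> y) * E z) \<longlongrightarrow> (\<xi> \<bullet> y) * E x) (at x within {z. regular z})"
    using continuous_dunkl_series(1)[OF k, of x y] unfolding isCont_def E_def
    by (intro tendsto_intros) (rule tendsto_within_subset, auto)
  then have "((\<lambda>z. D z \<xi> + Q z) \<longlongrightarrow> (\<xi> \<bullet> y) * E x) (at x within {z. regular z})"
    by (rule Lim_transform_eventually)
      (unfold eventually_at_filter, intro always_eventually allI impI, simp only: mem_Collect_eq reg)
  moreover have "at x within {z. regular z} \<noteq> bot"
    using islimpt_regular[of x] trivial_limit_within by blast
  ultimately have "dunkl_op k \<xi> E x = (\<xi> \<bullet> y) * E x" by (intro tendsto_unique)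
  then show ?thesis by (simp only: E_def)
qed

lemma dunkl_series_is_kernel: "is_dunkl_kernel k y (dunkl_series k y)"
  unfolding is_dunkl_kernel_def
  using dunkl_series_eigen dunkl_series_zero[OF k] double_series_real_analytic[OF dunkl_series_entire[OF k]]
  by (simp add: dunkl_series_def)

text \<open>In the direction \<open>\<xi> = x\<close> the factor \<open>\<langle>\<alpha>, x\<rangle>\<close> cancels the denominator. On a wall both sides of this
cancellation are \<open>0\<close>, whatever the value of the continuous extension.\<close>

lemma dunkl_kernel_ray:
  assumes f: "is_dunkl_kernel k y f" and t: "t > 0"
  shows "((\<lambda>s. f (s *\<^sub>R x)) has_real_derivative
    (1 / t) * (t * (x \<bullet> y) * f (t *\<^sub>R x) - (\<Sum>\<alpha>\<in>pos_roots. root_mult k \<alpha> * (f (t *\<^sub>R x) - f (t *\<^sub>R refl_along \<alpha> x))))) (at t)"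
proof -
  have "f differentiable at (t *\<^sub>R x)"
    using f real_analytic_differentiable by (simp add: is_dunkl_kernel_def)
  then have d: "(f has_derivative frechet_derivative f (at (t *\<^sub>R x))) (at (t *\<^sub>R x))"
    by (simp add: frechet_derivative_works)
  have "((\<lambda>s. s *\<^sub>R x) has_derivative (\<lambda>h. h *\<^sub>R x)) (at t)" by (auto intro!: derivative_eq_intros)
  from has_derivative_compose[OF this d]
  have "((\<lambda>s. f (s *\<^sub>R x)) has_real_derivative dir_deriv x f (t *\<^sub>R x)) (at t)"
    unfolding has_field_derivative_def dir_deriv_def
    by (rule has_derivative_eq_rhs) (simp add: fun_eq_iff linear_scale[OF has_derivative_linear[OF d]])
  moreover have "dir_deriv x f (t *\<^sub>R x) = (x \<bullet> y) * f (t *\<^sub>R x) - (\<Sum>\<alpha>\<in>pos_roots. root_mult k \<alpha> * (\<alpha> \<bullet> x) * diff_quot \<alpha> f (t *\<^sub>R x))"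
  proof -
    have "dunkl_op k x f (t *\<^sub>R x) = (x \<bullet> y) * f (t *\<^sub>R x)" using f by (simp only: is_dunkl_kernel_def)
    then show ?thesis unfolding dunkl_op_def by linarith
  qed
  moreover have "root_mult k \<alpha> * (\<alpha> \<bullet> x) * diff_quot \<alpha> f (t *\<^sub>R x) = (1 / t) * (root_mult k \<alpha> * (f (t *\<^sub>R x) - f (t *\<^sub>R refl_along \<alpha> x)))" for \<alpha>
  proof (cases "\<alpha> \<bullet> x = 0")
    case True
    then have "refl_along \<alpha> x = x" by (simp add: refl_along_def)
    with True show ?thesis by simp
  next
    case False
    then show ?thesis using t by (simp add: diff_quot_def refl_scaleR field_simps)
  qed
  then have "(\<Sum>\<alpha>\<in>pos_roots. root_mult k \<alpha> * (\<alpha> \<bullet> x) * diff_quot \<alpha> f (t *\<^sub>R x)) = (1 / t) * (\<Sum>\<alpha>\<in>pos_roots. root_mult k \<alpha> * (f (t *\<^sub>R x) - f (t *\<^sub>R refl_along \<alpha> x)))"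
    by (simp only: sum_distrib_left)
  ultimately show ?thesis using t by (simp add: right_diff_distrib)
qed

lemma dunkl_kernel_unique:
  assumes f: "is_dunkl_kernel k y f"
  shows "f = dunkl_series k y"
proof
  fix x
  note g = dunkl_series_is_kernel
  define F where "F = (\<lambda>t w. f (t *\<^sub>R Rep_weyl w x) - dunkl_series k y (t *\<^sub>R Rep_weyl w x))"
  have "F 1 weyl_one = 0"
  proof (rule weyl_ray_zero[OF k, of F x y])
    fix w and t :: real assume t: "t > 0"
    show "((\<lambda>t. F t w) has_real_derivative (1 / t) * weyl_ray_op k x y t (F t) w) (at t)"
      unfolding F_def
      by (rule DERIV_cong[OF DERIV_diff[OF dunkl_kernel_ray[OF f t] dunkl_kernel_ray[OF g t]]])
        (simp add: weyl_ray_op_def Rep_lmult_refl right_diff_distrib sum_subtractf)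
  next
    fix w
    have lim: "((\<lambda>t. h (t *\<^sub>R Rep_weyl w x)) \<longlongrightarrow> 1) (at_right 0)" if "is_dunkl_kernel k y h" for h
    proof -
      have "isCont h 0"
        using that real_analytic_differentiable[of h 0] differentiable_imp_continuous_within[of h 0 UNIV]
        unfolding is_dunkl_kernel_def by blast
      moreover have "((\<lambda>t. t *\<^sub>R Rep_weyl w x) \<longlongrightarrow> 0 *\<^sub>R Rep_weyl w x) (at_right (0::real))" by (intro tendsto_intros)
      ultimately have "((\<lambda>t. h (t *\<^sub>R Rep_weyl w x)) \<longlongrightarrow> h 0) (at_right 0)"
        by (intro isCont_tendsto_compose[of _ h]) auto
      then show ?thesis using that by (simp add: is_dunkl_kernel_def)
    qed
    show "((\<lambda>t. F t w) \<longlongrightarrow> 0) (at_right 0)"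
      using tendsto_diff[OF lim[OF f] lim[OF g]] by (simp add: F_def)
  qed simp
  then show "f x = dunkl_series k y x" by (simp add: F_def Rep_weyl_one)
qed

lemma dunkl_kernel_eq_series: "dunkl_kernel k x y = dunkl_series k y x"
proof -
  have "(THE f. is_dunkl_kernel k y f) = dunkl_series k y"
    using dunkl_series_is_kernel dunkl_kernel_unique by (rule the_equality)
  then show ?thesis by (simp add: dunkl_kernel_def)
qed

end

section \<open>Bessel functions and their limits\<close>

text \<open>The diagonal of \<open>D\<close> in the radial system for the Bessel function.\<close>

definition weyl_pairing :: "real^2 \<Rightarrow> real^2 \<Rightarrow> real^weyl" where
  "weyl_pairing x y = (\<chi> w. x \<bullet> Rep_weyl w y)"

lemma norm_weyl_pairing: "norm (weyl_pairing x y) \<le> CARD(weyl) * (norm x * norm y)"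
proof -
  have "norm (weyl_pairing x y) \<le> (\<Sum>w\<in>UNIV. \<bar>x \<bullet> Rep_weyl w y\<bar>)"
    using norm_le_l1_cart[of "weyl_pairing x y"] by (simp add: weyl_pairing_def)
  also have "\<dots> \<le> (\<Sum>w\<in>(UNIV :: weyl set). norm x * norm y)"
    by (intro sum_mono) (metis Cauchy_Schwarz_ineq2 norm_weyl)
  finally show ?thesis by simp
qed

definition weyl_ray :: "real \<times> real \<Rightarrow> real^2 \<Rightarrow> real^2 \<Rightarrow> real \<Rightarrow> real^weyl" where
  "weyl_ray k x y t = (\<chi> w. dunkl_series k (Rep_weyl w y) (t *\<^sub>R x))"

lemma bessel_eq_weyl_ray:
  assumes "fst k \<ge> 0" "snd k \<ge> 0"
  shows "bessel_B2 k x y = mass (weyl_ray k x y 1) / 8"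
  by (simp add: bessel_B2_def sum_weyl_group dunkl_kernel_eq_series[OF assms] weyl_ray_def)

lemma dunkl_series_refl_swap:
  assumes "fst k \<ge> 0" "snd k \<ge> 0" "\<alpha> \<in> pos_roots"
  shows "dunkl_series k y (refl_along \<alpha> x) = dunkl_series k (refl_along \<alpha> y) x"
  using dunkl_series_equivariant[OF assms, of y "refl_along \<alpha> x"] refl_invol[OF root_nonzero[OF assms(3)]] by simp

text \<open>Here the group acts on the second argument of the kernel. Multiplicities and \<open>y\<close> both scale with \<open>\<kappa>\<close>, so
\<open>\<kappa>\<close> becomes a common factor and the operator \<open>ham\<close> belongs to the fixed multiplicity.\<close>

lemma weyl_ray_solution:
  assumes \<nu>: "\<nu>1 > 0" "\<nu>2 > 0" and \<kappa>: "\<kappa> > 0"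
  shows "connected_reflection_system.radial_solution pos_roots (root_mult (\<nu>1, \<nu>2)) lmult_refl \<kappa>
    (weyl_pairing x y) (weyl_ray (\<kappa> * \<nu>1, \<kappa> * \<nu>2) x (\<kappa> *\<^sub>R y))"
proof -
  interpret W: connected_reflection_system pos_roots "root_mult (\<nu>1, \<nu>2)" lmult_refl
    by (rule weyl_connected_reflection_system) (use \<nu> in auto)
  define k where "k = (\<kappa> * \<nu>1, \<kappa> * \<nu>2)"
  have k: "fst k \<ge> 0" "snd k \<ge> 0" using \<nu> \<kappa> by (auto simp: k_def)
  have rm: "root_mult k \<alpha> = \<kappa> * root_mult (\<nu>1, \<nu>2) \<alpha>" for \<alpha> by (simp add: root_mult_def k_def)
  show ?thesis unfolding W.radial_solution_def k_def[symmetric]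
  proof (intro conjI allI impI)
    show "continuous_on {0..1} (weyl_ray k x (\<kappa> *\<^sub>R y))"
      unfolding weyl_ray_def
    proof (intro continuous_on_vec_lambda)
      fix w
      have "continuous_on UNIV (dunkl_series k (Rep_weyl w (\<kappa> *\<^sub>R y)))"
        using continuous_dunkl_series(1)[OF k] by (intro continuous_at_imp_continuous_on) auto
      then show "continuous_on {0..1} (\<lambda>t. dunkl_series k (Rep_weyl w (\<kappa> *\<^sub>R y)) (t *\<^sub>R x))"
        by (rule continuous_on_compose2) (auto intro!: continuous_intros)
    qed
    show "weyl_ray k x (\<kappa> *\<^sub>R y) 0 = (\<chi> i. 1)"
      by (simp add: weyl_ray_def dunkl_series_zero[OF k])
    fix t :: real assume t: "t > 0"
    show "(weyl_ray k x (\<kappa> *\<^sub>R y) has_vector_derivative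
            (\<kappa> / t) *\<^sub>R W.ham (t *\<^sub>R weyl_pairing x y) (weyl_ray k x (\<kappa> *\<^sub>R y) t)) (at t)"
    proof (rule has_vector_derivative_vec)
      fix w
      define z where "z = Rep_weyl w (\<kappa> *\<^sub>R y)"
      define E where "E = dunkl_series k"
      have r: "E z (t *\<^sub>R refl_along \<alpha> x) = E (Rep_weyl (lmult_refl \<alpha> w) (\<kappa> *\<^sub>R y)) (t *\<^sub>R x)" if "\<alpha> \<in> pos_roots" for \<alpha>
        using dunkl_series_refl_swap[OF k that, of z "t *\<^sub>R x"] by (simp add: E_def z_def Rep_lmult_refl[OF that] refl_scaleR)
      have "((\<lambda>s. E z (s *\<^sub>R x)) has_real_derivative
        (1 / t) * (t * (x \<bullet> z) * E z (t *\<^sub>R x) - (\<Sum>\<alpha>\<in>pos_roots. root_mult k \<alpha> * (E z (t *\<^sub>R x) - E z (t *\<^sub>R refl_along \<alpha> x))))) (at t)"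
        unfolding E_def by (rule dunkl_kernel_ray[OF k dunkl_series_is_kernel[OF k] t])
      also have "(\<Sum>\<alpha>\<in>pos_roots. root_mult k \<alpha> * (E z (t *\<^sub>R x) - E z (t *\<^sub>R refl_along \<alpha> x))) =
          \<kappa> * W.lap (weyl_ray k x (\<kappa> *\<^sub>R y) t) $ w"
        unfolding W.lap_def vec_lambda_beta sum_distrib_left
        by (rule sum.cong[OF refl]) (simp only: rm r, simp add: weyl_ray_def E_def z_def)
      also have "x \<bullet> z = \<kappa> * (x \<bullet> Rep_weyl w y)" by (simp add: z_def weyl_scaleR)
      also have "(1 / t) * (t * (\<kappa> * (x \<bullet> Rep_weyl w y)) * E z (t *\<^sub>R x) - \<kappa> * W.lap (weyl_ray k x (\<kappa> *\<^sub>R y) t) $ w) =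
         ((\<kappa> / t) *\<^sub>R W.ham (t *\<^sub>R weyl_pairing x y) (weyl_ray k x (\<kappa> *\<^sub>R y) t)) $ w"
        using t by (simp add: W.ham_def weyl_pairing_def weyl_ray_def E_def z_def field_simps)
      finally show "((\<lambda>s. weyl_ray k x (\<kappa> *\<^sub>R y) s $ w) has_real_derivative
         ((\<kappa> / t) *\<^sub>R W.ham (t *\<^sub>R weyl_pairing x y) (weyl_ray k x (\<kappa> *\<^sub>R y) t)) $ w) (at t)"
        by (simp add: weyl_ray_def E_def z_def)
    qed
  qed
qed

lemma interior_chamber_regular:
  assumes "x \<in> interior chamber"
  shows "regular x"
proof -
  obtain r where r: "r > 0" "ball x r \<subseteq> chamber" using assms by (auto simp: mem_interior)
  define s where "s = r / 2"
  have "x - s *\<^sub>R e1 \<in> ball x r" "x - s *\<^sub>R e2 \<in> ball x r" using r by (auto simp: s_def dist_norm)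
  then have "x - s *\<^sub>R e1 \<in> chamber" "x - s *\<^sub>R e2 \<in> chamber" using r by auto
  then have "x $ 2 \<le> x $ 1 - s" "x $ 2 - s \<ge> 0" by (auto simp: chamber_def axis_components)
  then show ?thesis using r by (auto simp: regular_iff s_def)
qed

text \<open>Each difference term changes sign under \<open>w \<mapsto> \<sigma>\<^sub>\<alpha> w\<close>, so the sum of the Dunkl equations over the group
retains only the right-hand sides.\<close>

lemma bessel_dir_deriv:
  assumes k: "fst k \<ge> 0" "snd k \<ge> 0" and x: "regular x"
  shows "dir_deriv \<xi> (\<lambda>z. bessel_B2 k z y) x = (\<Sum>w\<in>UNIV. (\<xi> \<bullet> Rep_weyl w y) * weyl_ray k x y 1 $ w) / 8"
proof -
  define E where "E = (\<lambda>w. dunkl_series k (Rep_weyl w y))"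
  have diffE: "(E w has_derivative frechet_derivative (E w) (at x)) (at x)" for w
    unfolding E_def
    by (rule frechet_derivative_works[THEN iffD1, OF differentiableI[OF dunkl_series_has_derivative[OF k]]])
  have "(\<lambda>z. bessel_B2 k z y) = (\<lambda>z. 1 / 8 * (\<Sum>w\<in>UNIV. E w z))"
    by (simp add: bessel_eq_weyl_ray[OF k] weyl_ray_def E_def fun_eq_iff)
  moreover have "((\<lambda>z. 1 / 8 * (\<Sum>w\<in>UNIV. E w z)) has_derivative (\<lambda>h. 1 / 8 * (\<Sum>w\<in>UNIV. frechet_derivative (E w) (at x) h))) (at x)"
    by (intro has_derivative_mult_right has_derivative_sum diffE)
  ultimately have "((\<lambda>z. bessel_B2 k z y) has_derivative (\<lambda>h. 1 / 8 * (\<Sum>w\<in>UNIV. frechet_derivative (E w) (at x) h))) (at x)"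
    by simp
  then have "dir_deriv \<xi> (\<lambda>z. bessel_B2 k z y) x = 1 / 8 * (\<Sum>w\<in>UNIV. dir_deriv \<xi> (E w) x)"
    unfolding dir_deriv_def by (simp only: frechet_derivative_at[symmetric])
  also have "(\<Sum>w\<in>UNIV. dir_deriv \<xi> (E w) x) = (\<Sum>w\<in>UNIV. (\<xi> \<bullet> Rep_weyl w y) * E w x)"
  proof -
    have d: "dir_deriv \<xi> (E w) x = (\<xi> \<bullet> Rep_weyl w y) * E w x -
        (\<Sum>\<alpha>\<in>pos_roots. root_mult k \<alpha> * (\<alpha> \<bullet> \<xi>) / (\<alpha> \<bullet> x) * (E w x - E (lmult_refl \<alpha> w) x))" for w
    proof -
      have "dunkl_op k \<xi> (E w) x = (\<xi> \<bullet> Rep_weyl w y) * E w x"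
        unfolding E_def by (rule dunkl_series_eigen[OF k])
      moreover have "(\<Sum>\<alpha>\<in>pos_roots. root_mult k \<alpha> * (\<alpha> \<bullet> \<xi>) * diff_quot \<alpha> (E w) x) =
         (\<Sum>\<alpha>\<in>pos_roots. root_mult k \<alpha> * (\<alpha> \<bullet> \<xi>) / (\<alpha> \<bullet> x) * (E w x - E (lmult_refl \<alpha> w) x))"
      proof (rule sum.cong[OF refl])
        fix \<alpha> assume \<alpha>: "\<alpha> \<in> pos_roots"
        have "E w (refl_along \<alpha> x) = E (lmult_refl \<alpha> w) x"
          using dunkl_series_refl_swap[OF k \<alpha>] by (simp add: E_def Rep_lmult_refl[OF \<alpha>])
        moreover have "\<alpha> \<bullet> x \<noteq> 0" using x \<alpha> by (simp add: regular_def)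
        ultimately show "root_mult k \<alpha> * (\<alpha> \<bullet> \<xi>) * diff_quot \<alpha> (E w) x = root_mult k \<alpha> * (\<alpha> \<bullet> \<xi>) / (\<alpha> \<bullet> x) * (E w x - E (lmult_refl \<alpha> w) x)"
          by (simp add: diff_quot_def)
      qed
      ultimately show ?thesis unfolding dunkl_op_def by linarith
    qed
    interpret W: reflection_system pos_roots "root_mult k" lmult_refl by (rule weyl_reflection_system[OF k])
    have "(\<Sum>w\<in>UNIV. \<Sum>\<alpha>\<in>pos_roots. root_mult k \<alpha> * (\<alpha> \<bullet> \<xi>) / (\<alpha> \<bullet> x) * (E w x - E (lmult_refl \<alpha> w) x)) =
       (\<Sum>\<alpha>\<in>pos_roots. root_mult k \<alpha> * (\<alpha> \<bullet> \<xi>) / (\<alpha> \<bullet> x) * ((\<Sum>w\<in>UNIV. E w x) - (\<Sum>w\<in>UNIV. E (lmult_refl \<alpha> w) x)))"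
      by (subst sum.swap) (simp only: sum_distrib_left[symmetric] sum_subtractf)
    also have "\<dots> = 0"
      using W.sum_refl[where f = "\<lambda>w. E w x"] by (intro sum.neutral) auto
    finally show ?thesis by (simp only: d sum_subtractf)
  qed
  finally show ?thesis by (simp add: weyl_ray_def E_def)
qed

theorem mainTheorem5:
  fixes \<nu>1 \<nu>2 :: real
  assumes "\<nu>1 > 0" and "\<nu>2 > 0"
  shows "(\<exists>L :: (real^2) \<times> (real^2) \<Rightarrow> real.
            locally_uniform_limit (chamber \<times> chamber)
              (\<lambda>\<kappa> (x, y). bessel_B2 (\<kappa> * \<nu>1, \<kappa> * \<nu>2) x (\<kappa> *\<^sub>R y) powr (1 / \<kappa>))
              L at_top) \<and>
         (\<forall>j :: 2. \<exists>L :: (real^2) \<times> (real^2) \<Rightarrow> real.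
            locally_uniform_limit (interior chamber \<times> interior chamber)
              (\<lambda>\<kappa> (x, y).
                 dir_deriv (axis j 1) (\<lambda>z. bessel_B2 (\<kappa> * \<nu>1, \<kappa> * \<nu>2) z (\<kappa> *\<^sub>R y)) x
                 / (\<kappa> * bessel_B2 (\<kappa> * \<nu>1, \<kappa> * \<nu>2) x (\<kappa> *\<^sub>R y)))
              L at_top)"
proof -
  interpret W: connected_reflection_system pos_roots "root_mult (\<nu>1, \<nu>2)" lmult_refl
    by (rule weyl_connected_reflection_system) (use assms in auto)
  define \<Psi> where "\<Psi> = (\<lambda>\<kappa> x y. weyl_ray (\<kappa> * \<nu>1, \<kappa> * \<nu>2) x (\<kappa> *\<^sub>R y))"
  have sol: "W.radial_solution \<kappa> (weyl_pairing x y) (\<Psi> \<kappa> x y)" if "\<kappa> > 0" for \<kappa> x y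
    unfolding \<Psi>_def using assms that by (rule weyl_ray_solution)
  have bessel: "bessel_B2 (\<kappa> * \<nu>1, \<kappa> * \<nu>2) x (\<kappa> *\<^sub>R y) = mass (\<Psi> \<kappa> x y 1) / 8" if "\<kappa> > 0" for \<kappa> x y
    unfolding \<Psi>_def by (rule bessel_eq_weyl_ray) (use assms that in auto)
  \<comment> \<open>a common bound for the parameters of the radial systems, for points within distance 1 of p\<close>
  define N where "N = (\<lambda>p :: (real^2) \<times> (real^2). real CARD(weyl) * ((norm (fst p) + 2) * (norm (snd p) + 2)))"
  have N0: "N p \<ge> 0" for p by (simp add: N_def)
  have bounds: "norm (weyl_pairing x y) \<le> N p" "norm (weyl_pairing (axis j 1) y) \<le> N p"
    if "(x, y) \<in> ball (fst p) 1 \<times> ball (snd p) 1" for p x y and j :: 2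
  proof -
    have x: "norm x \<le> norm (fst p) + 2" and y: "norm y \<le> norm (snd p) + 2"
      using that norm_triangle_ineq2[of x "fst p"] norm_triangle_ineq2[of y "snd p"] by (auto simp: dist_norm norm_minus_commute)
    have "real CARD(weyl) * (norm z * norm y) \<le> N p" if "norm z \<le> norm (fst p) + 2" for z :: "real^2"
      unfolding N_def using that y by (intro mult_left_mono mult_mono) auto
    then have b: "norm (weyl_pairing z y) \<le> N p" if "norm z \<le> norm (fst p) + 2" for z :: "real^2"
      using that order_trans[OF norm_weyl_pairing] by blast
    show "norm (weyl_pairing x y) \<le> N p" using x by (rule b)
    show "norm (weyl_pairing (axis j 1) y) \<le> N p" by (rule b) (simp add: add_increasing)
  qed
  have "\<exists>L. locally_uniform_limit (chamber \<times> chamber)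
              (\<lambda>\<kappa> (x, y). bessel_B2 (\<kappa> * \<nu>1, \<kappa> * \<nu>2) x (\<kappa> *\<^sub>R y) powr (1 / \<kappa>)) L at_top"
  proof -
    define f where "f = (\<lambda>\<kappa> (x, y). bessel_B2 (\<kappa> * \<nu>1, \<kappa> * \<nu>2) x (\<kappa> *\<^sub>R y) powr (1 / \<kappa>))"
    define L where "L = (\<lambda>z. lim (\<lambda>n. f (real n) z))"
    have "locally_uniform_limit (chamber \<times> chamber) f L at_top"
      unfolding locally_uniform_limit_def
    proof
      fix p :: "(real^2) \<times> (real^2)"
      define U where "U = ball (fst p) 1 \<times> ball (snd p) 1"
      have "uniform_limit (chamber \<times> chamber \<inter> U) f L at_top"
        unfolding L_def
      proof (rule uniform_limit_at_top_Cauchy)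
        fix e :: real assume e: "e > 0"
        obtain \<kappa>0 where \<kappa>0: "\<kappa>0 > 0" and c: "\<And>\<kappa> \<kappa>' d \<Phi> \<Phi>'. \<kappa> \<ge> \<kappa>0 \<Longrightarrow> \<kappa>' \<ge> \<kappa>0 \<Longrightarrow> norm d \<le> N p \<Longrightarrow>
            W.radial_solution \<kappa> d \<Phi> \<Longrightarrow> W.radial_solution \<kappa>' d \<Phi>' \<Longrightarrow>
            \<bar>(mass (\<Phi> 1) / 8) powr (1 / \<kappa>) - (mass (\<Phi>' 1) / 8) powr (1 / \<kappa>')\<bar> \<le> e"
          using W.radial_growth_cauchy[OF N0[of p] e, of 8] by auto
        have "\<bar>f \<kappa> z - f \<kappa>' z\<bar> \<le> e" if "\<kappa> \<ge> \<kappa>0" "\<kappa>' \<ge> \<kappa>0" "z \<in> U" for \<kappa> \<kappa>' z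
        proof -
          obtain x y where z: "z = (x, y)" by force
          have "norm (weyl_pairing x y) \<le> N p" using that(3) z bounds(1) by (simp add: U_def)
          moreover have "\<kappa> > 0" "\<kappa>' > 0" using that \<kappa>0 by auto
          ultimately show ?thesis using c[OF that(1,2) _ sol sol] by (simp add: f_def z bessel)
        qed
        then show "\<exists>\<kappa>0. \<forall>\<kappa>\<ge>\<kappa>0. \<forall>\<kappa>'\<ge>\<kappa>0. \<forall>z\<in>chamber \<times> chamber \<inter> U. \<bar>f \<kappa> z - f \<kappa>' z\<bar> \<le> e" by blast
      qed
      moreover have "open U" "p \<in> U" by (auto simp: U_def open_Times mem_Times_iff)
      ultimately show "\<exists>U. open U \<and> p \<in> U \<and> uniform_limit (chamber \<times> chamber \<inter> U) f L at_top" by blast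
    qed
    then show ?thesis unfolding f_def by blast
  qed
  moreover have "\<exists>L. locally_uniform_limit (interior chamber \<times> interior chamber)
              (\<lambda>\<kappa> (x, y). dir_deriv (axis j 1) (\<lambda>z. bessel_B2 (\<kappa> * \<nu>1, \<kappa> * \<nu>2) z (\<kappa> *\<^sub>R y)) x
                 / (\<kappa> * bessel_B2 (\<kappa> * \<nu>1, \<kappa> * \<nu>2) x (\<kappa> *\<^sub>R y))) L at_top" for j :: 2
  proof -
    define f where "f = (\<lambda>\<kappa> (x, y). dir_deriv (axis j 1) (\<lambda>z. bessel_B2 (\<kappa> * \<nu>1, \<kappa> * \<nu>2) z (\<kappa> *\<^sub>R y)) x
                 / (\<kappa> * bessel_B2 (\<kappa> * \<nu>1, \<kappa> * \<nu>2) x (\<kappa> *\<^sub>R y)))"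
    define L where "L = (\<lambda>(x, y). wmean (weyl_pairing (axis j 1) y) (W.perron (weyl_pairing x y)))"
    have f: "f \<kappa> (x, y) = wmean (weyl_pairing (axis j 1) y) (\<Psi> \<kappa> x y 1)"
      if "\<kappa> > 0" "regular x" for \<kappa> x y
    proof -
      have "dir_deriv (axis j 1) (\<lambda>z. bessel_B2 (\<kappa> * \<nu>1, \<kappa> * \<nu>2) z (\<kappa> *\<^sub>R y)) x =
         (\<Sum>w\<in>UNIV. (axis j 1 \<bullet> Rep_weyl w (\<kappa> *\<^sub>R y)) * \<Psi> \<kappa> x y 1 $ w) / 8"
        unfolding \<Psi>_def by (rule bessel_dir_deriv) (use assms that in auto)
      also have "\<dots> = \<kappa> * (\<Sum>w\<in>UNIV. weyl_pairing (axis j 1) y $ w * \<Psi> \<kappa> x y 1 $ w) / 8"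
        by (simp add: weyl_scaleR weyl_pairing_def sum_distrib_left mult.assoc)
      finally show ?thesis using that(1) by (simp add: f_def bessel)
    qed
    have "locally_uniform_limit (interior chamber \<times> interior chamber) f L at_top"
      unfolding locally_uniform_limit_def
    proof
      fix p :: "(real^2) \<times> (real^2)"
      define U where "U = ball (fst p) 1 \<times> ball (snd p) 1"
      have "uniform_limit (interior chamber \<times> interior chamber \<inter> U) f L at_top"
        unfolding uniform_limit_iff eventually_at_top_linorder
      proof (intro allI impI)
        fix e :: real assume e: "e > 0"
        then have e2: "e / 2 > 0" by simp
        obtain \<kappa>0 where \<kappa>0: "\<kappa>0 > 0" and a: "\<And>\<kappa> d l \<Phi> t. \<kappa> \<ge> \<kappa>0 \<Longrightarrow> norm d \<le> N p \<Longrightarrow> norm l \<le> N p \<Longrightarrow>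
            W.radial_solution \<kappa> d \<Phi> \<Longrightarrow> t \<in> {0..1} \<Longrightarrow>
            \<bar>wmean l (\<Phi> t) - wmean l (W.perron (t *\<^sub>R d))\<bar> \<le> e / 2"
          using W.radial_asymptotics[OF N0[of p] e2] by blast
        have "dist (f \<kappa> z) (L z) < e" if "\<kappa> \<ge> \<kappa>0" "z \<in> interior chamber \<times> interior chamber \<inter> U" for \<kappa> z
        proof -
          obtain x y where z: "z = (x, y)" by force
          have \<kappa>: "\<kappa> > 0" using that \<kappa>0 by simp
          have U: "(x, y) \<in> ball (fst p) 1 \<times> ball (snd p) 1" using that(2) by (simp add: z U_def)
          have x: "regular x" using that(2) by (intro interior_chamber_regular) (simp add: z)
          show ?thesis using a[OF that(1) bounds(1)[OF U] bounds(2)[OF U, of j] sol[OF \<kappa>], of 1] e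
            by (simp add: z f[OF \<kappa> x] L_def dist_real_def)
        qed
        then show "\<exists>\<kappa>0. \<forall>\<kappa>\<ge>\<kappa>0. \<forall>z\<in>interior chamber \<times> interior chamber \<inter> U. dist (f \<kappa> z) (L z) < e" by blast
      qed
      moreover have "open U" "p \<in> U" by (auto simp: U_def open_Times mem_Times_iff)
      ultimately show "\<exists>U. open U \<and> p \<in> U \<and> uniform_limit (interior chamber \<times> interior chamber \<inter> U) f L at_top" by blast
    qed
    then show ?thesis unfolding f_def by blast
  qed
  ultimately show ?thesis by blast
qed

end
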